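(* Let $f:[0,\infty)^2\to\mathbb{R}$ be the viscosity solution of the Hamilton–Jacobi equation \[ \partial_t f - 2(\partial_h f)^2 = 0 \ \text{ in } (0,\infty)^2, \qquad -\partial_h f = 0 \ \text{ on } (0,\infty)\times\{0\}, \] with initial condition $f(0,h)=\psi(h)$ for all $h\ge 0$. Then for every $M\ge 1$, \[ \lim_{N\to\infty} \mathbb{E}\Big[\sup_{(t,h)\in[0,M]^2} \big(F_N(t,h)-f(t,h)\big)^2\Big] = 0 . \]
   Context: Let $P$ be a probability measure on $\mathbb{R}$ with bounded support, and $P_N:=P^{\otimes N}$. Under a probability $\mathbb{P}$ (expectation $\mathbb{E}$), let $\bar x=(\bar x_1,\dots,\bar x_N)$ have i.i.d. entries of law $P$, let $W=(W_{ij})_{1\le i,j\le N}$ and $z=(z_i)_{1\le i\le N}$ be independent standard Gaussian variables, with $\bar x,W,z$ mutually independent. For $t,h\ge0$ and $x\in\mathbb{R}^N$ set \[ H_N(t,h,x):=\sqrt{\tfrac tN}\, x\cdot Wx+\tfrac tN (x\cdot\bar x)^2-\tfrac{t}{2N}|x|^4+\sqrt h\, z\cdot x+h\,x\cdot\bar x-\tfrac h2|x|^2, \] where $|x|$ is the Euclidean norm, and $F_N(t,h):=\frac1N\log\int_{\mathbb{R}^N} e^{H_N(t,h,x)}\,dP_N(x)$. Let $\psi(h):=\mathbb{E}\log\int_{\mathbb{R}}\exp\big(\sqrt h z_1x+hx\bar x_1-\tfrac h2x^2\big)\,dP(x)$ for $h\ge0$ (scalar variables). Viscosity solutions: $f\in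 C([0,\infty)^2)$ is a viscosity subsolution if for every $(t,h)\in(0,\infty)\times[0,\infty)$ and $\phi\in C^\infty((0,\infty)\times[0,\infty))$ such that $f-\phi$ has a local maximum at $(t,h)$, we have $(\partial_t\phi-2(\partial_h\phi)^2)(t,h)\le0$ if $h>0$, and $\min(-\partial_h\phi,\partial_t\phi-2(\partial_h\phi)^2)(t,h)\le0$ if $h=0$. It is a viscosity supersolution if for every such $(t,h),\phi$ with $f-\phi$ having a local minimum at $(t,h)$, we have $(\partial_t\phi-2(\partial_h\phi)^2)(t,h)\ge0$ if $h>0$, and $\max(-\partial_h\phi,\partial_t\phi-2(\partial_h\phi)^2)(t,h)\ge0$ if $h=0$. A viscosity solution is both. *)

theory Defs
  imports "HOL-Probability.Probability"
begin

fun pdiff :: "bool list \<Rightarrow> (real \<Rightarrow> real \<Rightarrow> real) \<Rightarrow> real \<Rightarrow> real \<Rightarrow> real" where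
  "pdiff [] \<phi> = \<phi>"
| "pdiff (True # ks) \<phi> = (\<lambda>s k. deriv (\<lambda>s'. pdiff ks \<phi> s' k) s)"
| "pdiff (False # ks) \<phi> = (\<lambda>s k. deriv (\<lambda>k'. pdiff ks \<phi> s k') k)"

definition smooth2_on :: "(real \<times> real) set \<Rightarrow> (real \<Rightarrow> real \<Rightarrow> real) \<Rightarrow> bool" where
  "smooth2_on U \<phi> \<longleftrightarrow>
     (\<forall>ks. continuous_on U (\<lambda>p. pdiff ks \<phi> (fst p) (snd p)) \<and>
        (\<forall>p\<in>U. (\<lambda>s. pdiff ks \<phi> s (snd p)) differentiable (at (fst p)) \<and>
                (\<lambda>k. pdiff ks \<phi> (fst p) k) differentiable (at (snd p))))"

definition test_fun :: "(real \<Rightarrow> real \<Rightarrow> real) \<Rightarrow> bool" where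
  "test_fun \<phi> \<longleftrightarrow> (\<exists>U. open U \<and> {0<..} \<times> {0..} \<subseteq> U \<and> smooth2_on U \<phi>)"

definition dt :: "(real \<Rightarrow> real \<Rightarrow> real) \<Rightarrow> real \<Rightarrow> real \<Rightarrow> real" where
  "dt \<phi> t h = deriv (\<lambda>s. \<phi> s h) t"

definition dh :: "(real \<Rightarrow> real \<Rightarrow> real) \<Rightarrow> real \<Rightarrow> real \<Rightarrow> real" where
  "dh \<phi> t h = deriv (\<lambda>k. \<phi> t k) h"

definition quadrant :: "(real \<times> real) set" where
  "quadrant = {0..} \<times> {0..}"

definition local_max_at :: "(real \<Rightarrow> real \<Rightarrow> real) \<Rightarrow> real \<Rightarrow> real \<Rightarrow> bool" where
  "local_max_at g t h \<longleftrightarrow> (\<exists>e>0. \<forall>s k. (s, k) \<in> quadrant \<and> dist (s, k) (t, h) < e \<longrightarrow> g s k \<le> g t h)"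

definition local_min_at :: "(real \<Rightarrow> real \<Rightarrow> real) \<Rightarrow> real \<Rightarrow> real \<Rightarrow> bool" where
  "local_min_at g t h \<longleftrightarrow> (\<exists>e>0. \<forall>s k. (s, k) \<in> quadrant \<and> dist (s, k) (t, h) < e \<longrightarrow> g t h \<le> g s k)"

definition viscosity_subsolution :: "(real \<Rightarrow> real \<Rightarrow> real) \<Rightarrow> bool" where
  "viscosity_subsolution f \<longleftrightarrow>
     continuous_on quadrant (\<lambda>p. f (fst p) (snd p)) \<and>
     (\<forall>t h \<phi>. t > 0 \<and> h \<ge> 0 \<and> test_fun \<phi> \<and> local_max_at (\<lambda>s k. f s k - \<phi> s k) t h \<longrightarrow>
        (if h > 0 then dt \<phi> t h - 2 * (dh \<phi> t h)\<^sup>2 \<le> 0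
         else min (- dh \<phi> t h) (dt \<phi> t h - 2 * (dh \<phi> t h)\<^sup>2) \<le> 0))"

definition viscosity_supersolution :: "(real \<Rightarrow> real \<Rightarrow> real) \<Rightarrow> bool" where
  "viscosity_supersolution f \<longleftrightarrow>
     continuous_on quadrant (\<lambda>p. f (fst p) (snd p)) \<and>
     (\<forall>t h \<phi>. t > 0 \<and> h \<ge> 0 \<and> test_fun \<phi> \<and> local_min_at (\<lambda>s k. f s k - \<phi> s k) t h \<longrightarrow>
        (if h > 0 then dt \<phi> t h - 2 * (dh \<phi> t h)\<^sup>2 \<ge> 0
         else max (- dh \<phi> t h) (dt \<phi> t h - 2 * (dh \<phi> t h)\<^sup>2) \<ge> 0))"

definition viscosity_solution :: "(real \<Rightarrow> real \<Rightarrow> real) \<Rightarrow> bool" where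
  "viscosity_solution f \<longleftrightarrow> viscosity_subsolution f \<and> viscosity_supersolution f"

definition gauss :: "real measure" where
  "gauss = density lborel std_normal_density"

text \<open>Vectors in R^N are functions nat => real on the index set {..<N};
  the matrix W is a function on {..<N} x {..<N}.\<close>
definition HN :: "nat \<Rightarrow> real \<Rightarrow> real \<Rightarrow> (nat \<Rightarrow> real) \<Rightarrow> (nat \<times> nat \<Rightarrow> real) \<Rightarrow> (nat \<Rightarrow> real)
                   \<Rightarrow> (nat \<Rightarrow> real) \<Rightarrow> real" where
  "HN N t h xb W z x =
     (let xx = (\<Sum>i<N. x i * x i); xxb = (\<Sum>i<N. x i * xb i) in
       sqrt (t / real N) * (\<Sum>i<N. \<Sum>j<N. x i * W (i, j) * x j)
       + t / real N * xxb\<^sup>2 - t / (2 * real N) * xx\<^sup>2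
       + sqrt h * (\<Sum>i<N. z i * x i) + h * xxb - h / 2 * xx)"

definition FN :: "real measure \<Rightarrow> nat \<Rightarrow> real \<Rightarrow> real \<Rightarrow> (nat \<Rightarrow> real) \<Rightarrow> (nat \<times> nat \<Rightarrow> real)
                   \<Rightarrow> (nat \<Rightarrow> real) \<Rightarrow> real" where
  "FN P N t h xb W z =
     1 / real N * ln (\<integral>x. exp (HN N t h xb W z x) \<partial>(PiM {..<N} (\<lambda>_. P)))"

definition disorder :: "real measure \<Rightarrow> nat \<Rightarrow> ((nat \<Rightarrow> real) \<times> (nat \<times> nat \<Rightarrow> real) \<times> (nat \<Rightarrow> real)) measure" where
  "disorder P N = PiM {..<N} (\<lambda>_. P) \<Otimes>\<^sub>M (PiM ({..<N} \<times> {..<N}) (\<lambda>_. gauss) \<Otimes>\<^sub>M PiM {..<N} (\<lambda>_. gauss))"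

definition psi :: "real measure \<Rightarrow> real \<Rightarrow> real" where
  "psi P h = (\<integral>(xb, z). ln (\<integral>x. exp (sqrt h * z * x + h * x * xb - h / 2 * x\<^sup>2) \<partial>P) \<partial>(P \<Otimes>\<^sub>M gauss))"

end

theory Submission
  imports Defs
begin

text \<open>Both \<open>f\<close> and the limit of \<open>F\<^sub>N\<close> are identified with the Hopf--Lax function
  \<open>g(t, h) = SUP y\<ge>0. \<psi> y - (y - h)\<^sup>2 / (8t)\<close>. A supersolution dominates Hopf--Lax along straight
  lines, which also shows that a solution grows subquadratically in \<open>h\<close>; this growth bound makes
  the comparison with \<open>g\<close> by doubling of variables work without any growth assumption on \<open>f\<close>.

  For \<open>F\<^sub>N\<close>, Gaussian interpolation trades the matrix observation against the vector observation:
  in the planted model the Nishimori identity makes the error a square of the right sign, so that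
  \<open>\<bbbE> F\<^sub>N \<ge> g\<close>. For the upper bound, the term \<open>(x \<cdot> x\<^sub>0)\<^sup>2\<close>, where \<open>x\<^sub>0\<close> is the signal, is
  linearised over a finite net of overlaps, after which Guerra interpolation
  has the opposite sign; the maximum over the net is harmless because each free energy has variance
  of order \<open>1/N\<close>. Finally \<open>F\<^sub>N(s\<^sup>2, u\<^sup>2) + C (s\<^sup>2 + u\<^sup>2)\<close> is convex in \<open>(s, u)\<close>, so convergence at
  finitely many points controls the supremum.\<close>

section \<open>Viscosity solutions and the Hopf--Lax function\<close>

text \<open>The dual of the Hamiltonian \<open>2 * p^2\<close> is \<open>q^2 / 8\<close>. In
  \<open>hopf_lax\<close> the path has velocity \<open>2 * q\<close>, and the optimal
  \<open>q\<close> is twice the slope, which for the free energy is the overlap between sample and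
  signal. So the same \<open>q\<close> is the free parameter of the interpolations: a matrix channel
  of strength \<open>t\<close> is traded for an increase of the vector channel by
  \<open>2 * t * q\<close>, and completing a square costs \<open>t * q^2 / 2\<close> per site.

  The upper bound is the delicate half. In the planted model the error has a fixed sign, so the tilt
  towards the signal must be detached from the noise strength; the noise is then interpolated at
  fixed tilt. Linearisation may produce a negative tilt \<open>r + 2 * t * \<mu>\<close>, outside
  the domain of \<psi>, and a relative entropy argument brings it back.

  The prior is bounded only almost surely while the estimates are pointwise. Hence all energies use
  truncated coordinates, and the truncation is removed in \<open>psi_eq\<close> and
  \<open>FN_eq_logZ\<close>.\<close>

inductive poly2 :: "(real \<Rightarrow> real \<Rightarrow> real) \<Rightarrow> bool" where
  const: "poly2 (\<lambda>s k. c)"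
| fst: "poly2 (\<lambda>s k. s)"
| snd: "poly2 (\<lambda>s k. k)"
| add: "poly2 f \<Longrightarrow> poly2 g \<Longrightarrow> poly2 (\<lambda>s k. f s k + g s k)"
| mult: "poly2 f \<Longrightarrow> poly2 g \<Longrightarrow> poly2 (\<lambda>s k. f s k * g s k)"

lemma poly2_diff: "poly2 f \<Longrightarrow> poly2 g \<Longrightarrow> poly2 (\<lambda>s k. f s k - g s k)"
  using poly2.add[of f "\<lambda>s k. (-1) * g s k"] poly2.mult[OF poly2.const[of "-1"], of g]
  by simp

lemma poly2_power: "poly2 f \<Longrightarrow> poly2 (\<lambda>s k. f s k ^ n)"
  by (induction n) (auto intro: poly2.intros)

lemma poly2_partials:
  assumes "poly2 f"
  shows "\<exists>fs fk. poly2 fs \<and> poly2 fk \<and>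
    (\<forall>s k. ((\<lambda>s. f s k) has_real_derivative fs s k) (at s)) \<and>
    (\<forall>s k. ((\<lambda>k. f s k) has_real_derivative fk s k) (at k))"
  using assms
proof induction
  case (const c)
  show ?case by (intro exI[of _ "\<lambda>s k. 0"]) (auto intro: poly2.intros)
next
  case fst
  show ?case by (intro exI[of _ "\<lambda>s k. 1"] exI[of _ "\<lambda>s k. 0"]) (auto intro: poly2.intros)
next
  case snd
  show ?case by (intro exI[of _ "\<lambda>s k. 0"] exI[of _ "\<lambda>s k. 1"]) (auto intro: poly2.intros)
next
  case (add f g)
  then obtain fs fk gs gk where H: "poly2 fs" "poly2 fk" "poly2 gs" "poly2 gk"
    "\<And>s k. ((\<lambda>s. f s k) has_real_derivative fs s k) (at s)"
    "\<And>s k. ((\<lambda>k. f s k) has_real_derivative fk s k) (at k)"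
    "\<And>s k. ((\<lambda>s. g s k) has_real_derivative gs s k) (at s)"
    "\<And>s k. ((\<lambda>k. g s k) has_real_derivative gk s k) (at k)"
    by blast
  show ?case
    by (rule exI[of _ "\<lambda>s k. fs s k + gs s k"], rule exI[of _ "\<lambda>s k. fk s k + gk s k"])
      (auto intro!: poly2.intros derivative_eq_intros H)
next
  case (mult f g)
  then obtain fs fk gs gk where H: "poly2 fs" "poly2 fk" "poly2 gs" "poly2 gk"
    "\<And>s k. ((\<lambda>s. f s k) has_real_derivative fs s k) (at s)"
    "\<And>s k. ((\<lambda>k. f s k) has_real_derivative fk s k) (at k)"
    "\<And>s k. ((\<lambda>s. g s k) has_real_derivative gs s k) (at s)"
    "\<And>s k. ((\<lambda>k. g s k) has_real_derivative gk s k) (at k)"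
    by blast
  show ?case
    by (rule exI[of _ "\<lambda>s k. fs s k * g s k + gs s k * f s k"],
        rule exI[of _ "\<lambda>s k. fk s k * g s k + gk s k * f s k"])
      (auto intro!: poly2.intros derivative_eq_intros H mult.hyps)
qed

text \<open>\<open>test_fun\<close> asks for all iterated partial derivatives at once. Polynomials
  are closed under both partials, so a single induction certifies every test function used below;
  the barriers are accordingly built from powers instead of singular terms such as
  \<open>1 / (T - s)\<close>.\<close>

lemma poly2_pdiff: "poly2 f \<Longrightarrow> poly2 (pdiff ks f)"
proof (induction ks)
  case Nil
  then show ?case by simp
next
  case (Cons b ks)
  then obtain fs fk where H: "poly2 fs" "poly2 fk"
    "\<And>s k. ((\<lambda>s. pdiff ks f s k) has_real_derivative fs s k) (at s)"
    "\<And>s k. ((\<lambda>k. pdiff ks f s k) has_real_derivative fk s k) (at k)"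
    using poly2_partials[of "pdiff ks f"] by blast
  have "pdiff (True # ks) f = fs" "pdiff (False # ks) f = fk"
    by (auto intro!: ext DERIV_imp_deriv H)
  with H show ?case by (cases b) auto
qed

lemma poly2_continuous: "poly2 f \<Longrightarrow> continuous_on A (\<lambda>p. f (fst p) (snd p))"
  by (induction rule: poly2.induct) (auto intro!: continuous_intros)

lemma poly2_test_fun: "poly2 f \<Longrightarrow> test_fun f"
  unfolding test_fun_def smooth2_on_def
proof (intro exI[of _ UNIV] conjI allI ballI)
  fix ks p assume f: "poly2 f"
  note pk = poly2_pdiff[OF f, of ks]
  show "continuous_on UNIV (\<lambda>p. pdiff ks f (fst p) (snd p))"
    by (rule poly2_continuous[OF pk])
  show "(\<lambda>s. pdiff ks f s (snd p)) differentiable at (fst p)"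
    "(\<lambda>k. pdiff ks f (fst p) k) differentiable at (snd p)"
    using poly2_partials[OF pk] by (meson real_differentiable_def)+
qed auto

text \<open>At \<open>t = 0\<close> this is \<open>\<psi> h\<close>; for \<open>t > 0\<close> the substitution \<open>y = h + 2tq\<close> turns it into
  \<open>SUP y\<ge>0. \<psi> y - (y - h)\<^sup>2 / (8t)\<close>.\<close>
definition hopf_lax :: "(real \<Rightarrow> real) \<Rightarrow> real \<Rightarrow> real \<Rightarrow> real" where
  "hopf_lax \<psi> t h = (SUP q\<in>{q. h + 2 * t * q \<ge> 0}. \<psi> (h + 2 * t * q) - t * q\<^sup>2 / 2)"

section \<open>Bounds and dynamic programming for the Hopf--Lax function\<close>

locale half_line_lipschitz =
  fixes \<psi> :: "real \<Rightarrow> real" and L :: real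
  assumes L_nonneg: "L \<ge> 0"
    and lip: "h \<ge> 0 \<Longrightarrow> k \<ge> 0 \<Longrightarrow> \<bar>\<psi> h - \<psi> k\<bar> \<le> L * \<bar>h - k\<bar>"
begin

text \<open>The expression \<open>2 * L * t * |q| - t * q^2 / 2\<close> is largest at
  \<open>|q| = 2 * L\<close>, with value \<open>2 * L^2 * t\<close>: growth in time is at most the
  Hamiltonian at the steepest slope. This also makes the defining supremum finite.\<close>

lemma hl_term_le:
  assumes "t \<ge> 0" "h \<ge> 0" "h + 2 * t * q \<ge> 0"
  shows "\<psi> (h + 2 * t * q) - t * q\<^sup>2 / 2 \<le> \<psi> h + 2 * L\<^sup>2 * t"
proof -
  have "\<psi> (h + 2 * t * q) \<le> \<psi> h + L * (2 * t * \<bar>q\<bar>)"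
    using lip[of "h + 2 * t * q" h] assms by (auto simp: abs_mult)
  moreover have "0 \<le> t * (\<bar>q\<bar> - 2 * L)\<^sup>2" using assms by simp
  ultimately show ?thesis by (simp add: power2_eq_square algebra_simps)
qed

lemma hl_ge:
  assumes "t \<ge> 0" "h \<ge> 0" "h + 2 * t * q \<ge> 0"
  shows "\<psi> (h + 2 * t * q) - t * q\<^sup>2 / 2 \<le> hopf_lax \<psi> t h"
  unfolding hopf_lax_def
proof (rule cSUP_upper)
  show "bdd_above ((\<lambda>q. \<psi> (h + 2 * t * q) - t * q\<^sup>2 / 2) ` {q. h + 2 * t * q \<ge> 0})"
    using hl_term_le[OF assms(1,2)] by (auto intro!: bdd_aboveI2)
qed (use assms in auto)

lemma hl_le:
  assumes "h \<ge> 0" "\<And>q. h + 2 * t * q \<ge> 0 \<Longrightarrow> \<psi> (h + 2 * t * q) - t * q\<^sup>2 / 2 \<le> c"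
  shows "hopf_lax \<psi> t h \<le> c"
  unfolding hopf_lax_def using assms by (intro cSUP_least) (auto intro: exI[of _ 0])

lemma hl_0: "h \<ge> 0 \<Longrightarrow> hopf_lax \<psi> 0 h = \<psi> h"
  using hl_ge[of 0 h 0] hl_le[of h 0 "\<psi> h"] by auto

text \<open>One half of the dynamic programming principle. A path using parameter \<open>q\<close>
  for time \<delta> and \<open>r\<close> for time \<open>t\<close> is replaced by the straight path
  with the averaged parameter \<open>m\<close>; convexity of the square makes that cheaper. In the
  comparison proof it plays the part of the supersolution property of
  \<open>hopf_lax\<close>.\<close>

lemma hl_step:
  assumes "t \<ge> 0" "\<delta> \<ge> 0" "h \<ge> 0" "h + 2 * q * \<delta> \<ge> 0"
  shows "hopf_lax \<psi> t (h + 2 * q * \<delta>) - \<delta> * q\<^sup>2 / 2 \<le> hopf_lax \<psi> (t + \<delta>) h"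
proof -
  have "hopf_lax \<psi> t (h + 2 * q * \<delta>) \<le> hopf_lax \<psi> (t + \<delta>) h + \<delta> * q\<^sup>2 / 2"
  proof (rule hl_le[OF assms(4)])
    fix r assume r: "0 \<le> h + 2 * q * \<delta> + 2 * t * r"
    show "\<psi> (h + 2 * q * \<delta> + 2 * t * r) - t * r\<^sup>2 / 2 \<le> hopf_lax \<psi> (t + \<delta>) h + \<delta> * q\<^sup>2 / 2"
    proof (cases "t + \<delta> = 0")
      case True
      then have "t = 0" "\<delta> = 0" using assms by auto
      then show ?thesis using assms by (simp add: hl_0)
    next
      case False
      then have pos: "t + \<delta> > 0" using assms by auto
      define m where "m = (\<delta> * q + t * r) / (t + \<delta>)"
      have m: "(t + \<delta>) * m = \<delta> * q + t * r" using pos by (simp add: m_def)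
      have e: "h + 2 * (t + \<delta>) * m = h + 2 * q * \<delta> + 2 * t * r"
        using m by (simp add: algebra_simps)
      have "(t + \<delta>) * ((t + \<delta>) * m\<^sup>2) = (\<delta> * q + t * r)\<^sup>2"
        unfolding m[symmetric] by (simp add: power2_eq_square)
      also have "\<dots> \<le> (t + \<delta>) * (\<delta> * q\<^sup>2 + t * r\<^sup>2)"
      proof -
        have "(t + \<delta>) * (\<delta> * q\<^sup>2 + t * r\<^sup>2) - (\<delta> * q + t * r)\<^sup>2 = t * \<delta> * (q - r)\<^sup>2"
          by (simp add: power2_eq_square algebra_simps)
        moreover have "t * \<delta> * (q - r)\<^sup>2 \<ge> 0" using assms by simp
        ultimately show ?thesis by linarith
      qed
      finally have "(t + \<delta>) * m\<^sup>2 \<le> \<delta> * q\<^sup>2 + t * r\<^sup>2"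
        using pos by simp
      moreover have "\<psi> (h + 2 * (t + \<delta>) * m) - (t + \<delta>) * m\<^sup>2 / 2 \<le> hopf_lax \<psi> (t + \<delta>) h"
        by (rule hl_ge) (use assms r e pos in auto)
      ultimately show ?thesis unfolding e by argo
    qed
  qed
  then show ?thesis by simp
qed

lemma hl_mono: "t \<ge> 0 \<Longrightarrow> \<delta> \<ge> 0 \<Longrightarrow> h \<ge> 0 \<Longrightarrow> hopf_lax \<psi> t h \<le> hopf_lax \<psi> (t + \<delta>) h"
  using hl_step[of t \<delta> h 0] by simp

lemma hl_ge_psi: "t \<ge> 0 \<Longrightarrow> h \<ge> 0 \<Longrightarrow> \<psi> h \<le> hopf_lax \<psi> t h"
  using hl_ge[of t h 0] by simp

text \<open>Apply the same displacement from \<open>k\<close>. If this leaves the half line, stop at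
  \<open>0\<close> instead: the path is shorter, hence cheaper, and its end point is within
  \<open>|h - k|\<close> of the original one.\<close>

lemma hl_lip_le:
  assumes "t \<ge> 0" "h \<ge> 0" "k \<ge> 0"
  shows "hopf_lax \<psi> t h \<le> hopf_lax \<psi> t k + L * \<bar>h - k\<bar>"
proof (rule hl_le[OF assms(2)])
  fix q assume q: "0 \<le> h + 2 * t * q"
  show "\<psi> (h + 2 * t * q) - t * q\<^sup>2 / 2 \<le> hopf_lax \<psi> t k + L * \<bar>h - k\<bar>"
  proof (cases "k + 2 * t * q \<ge> 0")
    case True
    from hl_ge[OF assms(1,3) True] lip[OF q True] show ?thesis by auto
  next
    case False
    then have t: "t > 0" using assms by (cases "t = 0") auto
    define r where "r = - k / (2 * t)"
    have r: "k + 2 * t * r = 0" using t by (simp add: r_def)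
    have "\<bar>r\<bar> \<le> \<bar>q\<bar>"
    proof -
      have "2 * t * q < 2 * t * r" using False r by linarith
      then have "q < r" using t by simp
      moreover have "r \<le> 0" using t assms by (simp add: r_def)
      ultimately show ?thesis by linarith
    qed
    then have sq: "t * r\<^sup>2 \<le> t * q\<^sup>2" using t by (simp add: abs_le_square_iff)
    have "\<psi> (h + 2 * t * q) - \<psi> 0 \<le> L * (h + 2 * t * q)"
      using lip[OF q, of 0] q by auto
    also have "\<dots> \<le> L * \<bar>h - k\<bar>" using False L_nonneg by (intro mult_left_mono) auto
    finally show ?thesis using hl_ge[OF assms(1,3), of r] sq unfolding r by auto
  qed
qed

lemma hl_lip: "t \<ge> 0 \<Longrightarrow> h \<ge> 0 \<Longrightarrow> k \<ge> 0 \<Longrightarrow> \<bar>hopf_lax \<psi> t h - hopf_lax \<psi> t k\<bar> \<le> L * \<bar>h - k\<bar>"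
  using hl_lip_le[of t h k] hl_lip_le[of t k h] by (auto simp: abs_minus_commute)

text \<open>Spending the extra time \<delta> first moves the starting point by
  \<open>2 * \<delta> * q\<close>; the Lipschitz bound in \<open>h\<close> pays for this, and
  optimising over \<open>q\<close> gives the constant \<open>2 * L^2\<close> again.\<close>

lemma hl_time_le:
  assumes "t \<ge> 0" "\<delta> \<ge> 0" "h \<ge> 0"
  shows "hopf_lax \<psi> (t + \<delta>) h \<le> hopf_lax \<psi> t h + 2 * L\<^sup>2 * \<delta>"
proof (rule hl_le[OF assms(3)])
  fix q assume q: "0 \<le> h + 2 * (t + \<delta>) * q"
  show "\<psi> (h + 2 * (t + \<delta>) * q) - (t + \<delta>) * q\<^sup>2 / 2 \<le> hopf_lax \<psi> t h + 2 * L\<^sup>2 * \<delta>"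
  proof -
    have y: "h + 2 * \<delta> * q \<ge> 0"
    proof (cases "q \<ge> 0")
      case False
      then have "t * q \<le> 0" using assms by (simp add: mult_nonneg_nonpos)
      then show ?thesis using q by (simp add: algebra_simps)
    qed (use assms in auto)
    have e: "h + 2 * \<delta> * q + 2 * t * q = h + 2 * (t + \<delta>) * q" by (simp add: algebra_simps)
    have "\<psi> (h + 2 * (t + \<delta>) * q) - t * q\<^sup>2 / 2 \<le> hopf_lax \<psi> t (h + 2 * \<delta> * q)"
      using hl_ge[OF assms(1) y, of q] q unfolding e by auto
    also have "\<dots> \<le> hopf_lax \<psi> t h + L * \<bar>2 * \<delta> * q\<bar>"
      using hl_lip_le[OF assms(1) y assms(3)] by simp
    finally have "\<psi> (h + 2 * (t + \<delta>) * q) - t * q\<^sup>2 / 2 \<le> hopf_lax \<psi> t h + 2 * L * \<delta> * \<bar>q\<bar>"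
      using assms by (simp add: abs_mult mult.assoc mult.left_commute)
    moreover have "0 \<le> \<delta> * (\<bar>q\<bar> - 2 * L)\<^sup>2" using assms by simp
    then have "2 * L * \<delta> * \<bar>q\<bar> \<le> \<delta> * q\<^sup>2 / 2 + 2 * L\<^sup>2 * \<delta>"
      by (simp add: power2_eq_square algebra_simps)
    ultimately show ?thesis by (simp add: distrib_right add_divide_distrib)
  qed
qed

lemma hl_time_lip:
  assumes "s \<ge> 0" "t \<ge> 0" "h \<ge> 0"
  shows "\<bar>hopf_lax \<psi> s h - hopf_lax \<psi> t h\<bar> \<le> 2 * L\<^sup>2 * \<bar>s - t\<bar>"
proof -
  have *: "\<bar>hopf_lax \<psi> s h - hopf_lax \<psi> t h\<bar> \<le> 2 * L\<^sup>2 * \<bar>s - t\<bar>" if "s \<ge> 0" "s \<le> t" for s t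
    using hl_time_le[of s "t - s" h] hl_mono[of s "t - s" h] that assms by auto
  show ?thesis using *[of s t] *[of t s] assms by (cases "s \<le> t") (auto simp: abs_minus_commute)
qed

lemma hl_joint_lip:
  assumes "s \<ge> 0" "t \<ge> 0" "h \<ge> 0" "k \<ge> 0"
  shows "\<bar>hopf_lax \<psi> s h - hopf_lax \<psi> t k\<bar> \<le> 2 * L\<^sup>2 * \<bar>s - t\<bar> + L * \<bar>h - k\<bar>"
  using hl_time_lip[OF assms(1,2,3)] hl_lip[OF assms(2,3,4)] by linarith

lemma hl_continuous: "continuous_on quadrant (\<lambda>p. hopf_lax \<psi> (fst p) (snd p))"
proof -
  have "(2 * L\<^sup>2 + L)-lipschitz_on quadrant (\<lambda>p. hopf_lax \<psi> (fst p) (snd p))"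
  proof (rule lipschitz_onI)
    fix x y :: "real \<times> real" assume "x \<in> quadrant" "y \<in> quadrant"
    then have "\<bar>hopf_lax \<psi> (fst x) (snd x) - hopf_lax \<psi> (fst y) (snd y)\<bar>
       \<le> 2 * L\<^sup>2 * \<bar>fst x - fst y\<bar> + L * \<bar>snd x - snd y\<bar>"
      by (intro hl_joint_lip) (auto simp: quadrant_def mem_Times_iff)
    also have "\<dots> \<le> 2 * L\<^sup>2 * dist x y + L * dist x y"
      using L_nonneg dist_fst_le[of x y] dist_snd_le[of x y]
      by (intro add_mono mult_left_mono) (auto simp: dist_real_def)
    finally show "dist (hopf_lax \<psi> (fst x) (snd x)) (hopf_lax \<psi> (fst y) (snd y))
       \<le> (2 * L\<^sup>2 + L) * dist x y" by (simp add: dist_real_def distrib_right)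
  qed (use L_nonneg in auto)
  then show ?thesis by (rule lipschitz_on_continuous_on)
qed

end

section \<open>Comparison of viscosity solutions with the Hopf--Lax function\<close>

lemma supersolutionD:
  assumes "viscosity_supersolution f" "t > 0" "h \<ge> 0" "test_fun \<phi>"
    "local_min_at (\<lambda>s k. f s k - \<phi> s k) t h" "h = 0 \<Longrightarrow> dh \<phi> t h > 0"
  shows "dt \<phi> t h - 2 * (dh \<phi> t h)\<^sup>2 \<ge> 0"
proof -
  have "if h > 0 then dt \<phi> t h - 2 * (dh \<phi> t h)\<^sup>2 \<ge> 0
         else max (- dh \<phi> t h) (dt \<phi> t h - 2 * (dh \<phi> t h)\<^sup>2) \<ge> 0"
    using assms(1-5) unfolding viscosity_supersolution_def by blast
  then show ?thesis using assms(3,6) by (auto split: if_splits simp: le_max_iff_disj)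
qed

text \<open>At \<open>h = 0\<close> the boundary alternative is
  \<open>- dh \<phi> t h \<le> 0\<close>; a strictly negative slope of the test function excludes it
  and leaves the equation itself. The penalties below are tilted to have this sign, and the test
  function of the supersolution case has the opposite one.\<close>

lemma subsolutionD:
  assumes "viscosity_subsolution f" "t > 0" "h \<ge> 0" "test_fun \<phi>"
    "local_max_at (\<lambda>s k. f s k - \<phi> s k) t h" "h = 0 \<Longrightarrow> dh \<phi> t h < 0"
  shows "dt \<phi> t h - 2 * (dh \<phi> t h)\<^sup>2 \<le> 0"
proof -
  have "if h > 0 then dt \<phi> t h - 2 * (dh \<phi> t h)\<^sup>2 \<le> 0
         else min (- dh \<phi> t h) (dt \<phi> t h - 2 * (dh \<phi> t h)\<^sup>2) \<le> 0"
    using assms(1-5) unfolding viscosity_subsolution_def by blast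
  then show ?thesis using assms(3,6) by (auto split: if_splits simp: min_le_iff_disj)
qed

text \<open>The test function is a narrow downward parabola around the segment \<open>l\<close> from
  \<open>(s0, y)\<close> to \<open>(t0, h0)\<close>. Moving with velocity \<open>w\<close> costs at
  most \<open>w^2 / 8\<close> per unit of time, whatever the slope, so \<phi> violates the
  supersolution inequality strictly. The minimum of \<open>f - \<phi>\<close> over a box must
  therefore sit on the initial side \<open>s = s0\<close>, where the parabola forces it close to
  \<open>y\<close>; comparing with the value at \<open>(t0, h0)\<close> gives the claim.\<close>

lemma supersolution_line_aux:
  assumes f: "viscosity_supersolution f"
    and s0: "0 \<le> s0" "s0 < t0" and y: "y > 0" and h0: "h0 > 0" and e: "e > 0"
  shows "f s0 y \<le> f t0 h0 + (y - h0)\<^sup>2 / (8 * (t0 - s0)) + 4 * e"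
proof -
  define w where "w = (h0 - y) / (t0 - s0)"
  define l where "l = (\<lambda>s. y + w * (s - s0))"
  have l0: "l s0 = y" by (simp add: l_def)
  have lt: "l t0 = h0" using s0 by (simp add: l_def w_def)
  \<comment> \<open>Continuing the segment past \<open>t0\<close> for time \<open>d\<close> changes
    it by less than \<open>h0\<close>, so \<open>l\<close> stays positive. At \<open>k = 0\<close>
    this gives \<phi> the positive slope that \<open>supersolutionD\<close> asks for.\<close>
  define d where "d = h0 / (2 * (\<bar>w\<bar> + 1))"
  have d: "d > 0" using h0 by (simp add: d_def divide_pos_pos)
  have dw: "\<bar>w\<bar> * d < h0"
  proof -
    have "\<bar>w\<bar> * d \<le> (\<bar>w\<bar> + 1) * d" using d by simp
    also have "\<dots> = h0 / 2" by (simp add: d_def field_simps add_nonneg_eq_0_iff)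
    finally show ?thesis using h0 by simp
  qed
  define T where "T = t0 + d"
  have l_pos: "l s > 0" if "s0 \<le> s" "s \<le> T" for s
  proof (cases "s \<le> t0")
    case True
    define u where "u = (s - s0) / (t0 - s0)"
    have u: "0 \<le> u" "u \<le> 1" using True that s0 by (auto simp: u_def divide_le_eq)
    have "l s = (1 - u) * y + u * h0"
    proof -
      have "w * (s - s0) = w * (t0 - s0) * u" using s0 by (simp add: u_def)
      also have "\<dots> = (h0 - y) * u" using s0 by (simp add: w_def)
      finally show ?thesis by (simp add: l_def algebra_simps)
    qed
    then show ?thesis using u y h0 by (cases "u = 1") (auto intro: add_pos_nonneg)
  next
    case False
    have "\<bar>w * (s - t0)\<bar> \<le> \<bar>w\<bar> * d" unfolding abs_mult
      using False that by (intro mult_left_mono) (auto simp: T_def)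
    moreover have "l s = h0 + w * (s - t0)" unfolding lt[symmetric] by (simp add: l_def algebra_simps)
    ultimately show ?thesis using dw by linarith
  qed
  \<comment> \<open>The box reaches one unit above the segment, so on its top side
    \<open>(k - l s)^2 \<ge> 1\<close>.\<close>
  define R where "R = y + \<bar>w\<bar> * (T - s0) + 1"
  have Tt: "t0 < T" using d by (simp add: T_def)
  have l_R: "l s \<le> R - 1" if "s0 \<le> s" "s \<le> T" for s
  proof -
    have "w * (s - s0) \<le> \<bar>w\<bar> * (T - s0)"
      using that by (intro mult_mono) auto
    then show ?thesis by (simp add: l_def R_def)
  qed
  have R_pos: "R > 0" using l_R[of t0] lt h0 s0 Tt by auto
  define B where "B = {s0..T} \<times> {0..R}"
  have B_comp: "compact B" unfolding B_def by (intro compact_Times) auto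
  have B_sub: "B \<subseteq> quadrant" using s0 by (auto simp: B_def quadrant_def)
  have f_cont: "continuous_on quadrant (\<lambda>p. f (fst p) (snd p))"
    using f by (simp add: viscosity_supersolution_def)
  obtain C where C: "\<And>s k. (s, k) \<in> B \<Longrightarrow> \<bar>f s k\<bar> \<le> C"
  proof -
    have "bounded ((\<lambda>p. f (fst p) (snd p)) ` B)"
      by (intro compact_imp_bounded compact_continuous_image continuous_on_subset[OF f_cont] B_comp B_sub)
    then show thesis using that by (force simp: bounded_iff)
  qed
  have t0B: "(t0, h0) \<in> B" using s0 Tt h0 l_R[of t0] lt by (auto simp: B_def)
  have C0: "C \<ge> 0" using C[OF t0B] by linarith
  obtain \<delta> where \<delta>: "\<delta> > 0" "\<And>k. k \<ge> 0 \<Longrightarrow> \<bar>k - y\<bar> < \<delta> \<Longrightarrow> \<bar>f s0 k - f s0 y\<bar> < e"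
  proof -
    have "continuous_on {0..} (f s0)"
      by (rule continuous_on_compose2[OF f_cont, of _ "\<lambda>k. (s0, k)", simplified])
        (use s0 in \<open>auto intro!: continuous_intros simp: quadrant_def\<close>)
    then show thesis using that y e unfolding continuous_on_iff dist_real_def
      by (metis atLeast_iff less_eq_real_def)
  qed
  \<comment> \<open>\<open>w^2 / 8\<close> is the dual cost of the velocity; the second summand
    gives strictness and amounts to just \<open>e\<close> by time \<open>t0\<close>.\<close>
  define V where "V = w\<^sup>2 / 8 + e / (t0 - s0)"
  have V0: "V \<ge> 0" using e s0 by (simp add: V_def)
  define D where "D = 2 * C + V * (T - s0) + e + 1"
  have D0: "D > 0" using C0 V0 s0 Tt e by (auto simp: D_def intro!: add_nonneg_pos)
  \<comment> \<open>\<open>K \<ge> 2 * D\<close> keeps the minimum off the top side;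
    \<open>K * \<delta>^2 \<ge> 2 * D\<close> brings it within \<delta> of \<open>y\<close> when
    \<open>s = s0\<close>.\<close>
  define K where "K = 2 * D + 2 * D / \<delta>\<^sup>2 + 1"
  have K: "K > 0" "K \<ge> 2 * D" "K * \<delta>\<^sup>2 \<ge> 2 * D"
    using D0 \<delta> by (auto simp: K_def distrib_right intro: add_nonneg_pos)
  define t1 where "t1 = (t0 + T) / 2"
  have t1: "t0 < t1" "t1 < T" using Tt by (auto simp: t1_def)
  \<comment> \<open>A barrier at the final time: with \<open>t1\<close> between \<open>t0\<close>
    and \<open>T\<close>, a high power of \<open>(s - s0) / (t1 - s0)\<close> is below
    \<open>e\<close> at \<open>t0\<close> and above \<open>D\<close> at \<open>T\<close>.\<close>
  define \<rho> where "\<rho> = (t0 - s0) / (t1 - s0)"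
  define \<rho>' where "\<rho>' = (T - s0) / (t1 - s0)"
  have \<rho>: "0 < \<rho>" "\<rho> < 1" "\<rho>' > 1" using t1 s0 by (auto simp: \<rho>_def \<rho>'_def)
  obtain n where n: "\<rho> ^ n < e" "\<rho>' ^ n > D"
  proof -
    have "(\<lambda>n. \<rho> ^ n) \<longlonglongrightarrow> 0" using \<rho> by (intro LIMSEQ_realpow_zero) auto
    then have 1: "eventually (\<lambda>n. \<rho> ^ n < e) sequentially"
      using e by (auto dest!: order_tendstoD(2))
    have 2: "eventually (\<lambda>n. \<rho>' ^ n > D) sequentially"
      using filterlim_realpow_sequentially_gt1[of \<rho>'] \<rho>
      by (simp add: filterlim_at_infinity_imp_norm_at_top filterlim_at_top_dense power_abs)
         (use \<rho> in \<open>auto simp: filterlim_at_infinity_conv_norm_at_top filterlim_at_top_dense power_abs\<close>)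
    show thesis using eventually_conj[OF 1 2] that by (auto simp: eventually_sequentially)
  qed
  define c where "c = 1 / (t1 - s0)"
  have c: "c > 0" using t1 s0 by (simp add: c_def)
  have c_eq: "x * c = x / (t1 - s0)" for x by (simp add: c_def)
  define H where "H = K / 2"
  have HK: "K = 2 * H" by (simp add: H_def)
  define \<phi> where "\<phi> = (\<lambda>s k. (- H) * (k - l s)\<^sup>2 - V * (s - s0) - ((s - s0) * c) ^ n)"
  have \<phi>_poly: "poly2 \<phi>" unfolding \<phi>_def l_def power2_eq_square
    by (intro poly2_diff poly2.intros poly2_power)
  then have \<phi>_test: "test_fun \<phi>" by (rule poly2_test_fun)
  have \<phi>_dt: "dt \<phi> s k = K * (k - l s) * w - V - n * ((s - s0) * c) ^ (n - 1) * c" for s k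
    unfolding dt_def \<phi>_def l_def
    by (rule DERIV_imp_deriv) (auto intro!: derivative_eq_intros simp: HK algebra_simps)
  have \<phi>_dh: "dh \<phi> s k = - K * (k - l s)" for s k
    unfolding dh_def \<phi>_def
    by (rule DERIV_imp_deriv) (auto intro!: derivative_eq_intros simp: HK)
  have strict: "dt \<phi> s k - 2 * (dh \<phi> s k)\<^sup>2 < 0" if "s \<ge> s0" for s k
  proof -
    define m where "m = K * (k - l s)"
    have "n * ((s - s0) * c) ^ (n - 1) * c \<ge> 0"
      using that c by auto
    moreover have "m * w - w\<^sup>2 / 8 - 2 * m\<^sup>2 = - 2 * (m - w / 4)\<^sup>2"
      by (simp add: power2_eq_square algebra_simps)
    moreover have "- 2 * (m - w / 4)\<^sup>2 \<le> 0" by simp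
    moreover have "e / (t0 - s0) > 0" using e s0 by simp
    moreover have "(dh \<phi> s k)\<^sup>2 = m\<^sup>2" by (simp add: \<phi>_dh m_def power_mult_distrib)
    moreover have "dt \<phi> s k = m * w - (w\<^sup>2 / 8 + e / (t0 - s0)) - n * ((s - s0) * c) ^ (n - 1) * c"
      by (simp add: \<phi>_dt m_def V_def)
    ultimately show ?thesis by linarith
  qed
  let ?g = "\<lambda>s k. f s k - \<phi> s k"
  obtain s k where sk: "(s, k) \<in> B" and mn: "\<And>s' k'. (s', k') \<in> B \<Longrightarrow> ?g s k \<le> ?g s' k'"
  proof -
    have "continuous_on B (\<lambda>p. ?g (fst p) (snd p))"
      by (intro continuous_on_diff continuous_on_subset[OF f_cont] B_sub poly2_continuous[OF \<phi>_poly])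
    then obtain p where "p \<in> B" "\<And>q. q \<in> B \<Longrightarrow> ?g (fst p) (snd p) \<le> ?g (fst q) (snd q)"
      using continuous_attains_inf[OF B_comp, of "\<lambda>p. ?g (fst p) (snd p)"] t0B by blast
    then show thesis by (intro that[of "fst p" "snd p"]) auto
  qed
  have sk': "s0 \<le> s" "s \<le> T" "0 \<le> k" "k \<le> R" using sk by (auto simp: B_def)
  have target: "?g t0 h0 = f t0 h0 + V * (t0 - s0) + \<rho> ^ n"
    by (simp add: \<phi>_def lt \<rho>_def c_eq)
  have upper: "?g s k < f t0 h0 + V * (t0 - s0) + e"
    using mn[OF t0B] n(1) unfolding target by linarith
  have "?g s k < C + V * (T - s0) + e"
  proof -
    have "V * (t0 - s0) \<le> V * (T - s0)" using V0 Tt by (intro mult_left_mono) auto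
    then show ?thesis using upper C[OF t0B] by linarith
  qed
  then have bnd: "K / 2 * (k - l s)\<^sup>2 + V * (s - s0) + ((s - s0) / (t1 - s0)) ^ n < D"
    using C[OF sk] by (simp add: \<phi>_def D_def c_eq H_def)
  have pw: "((s - s0) / (t1 - s0)) ^ n \<ge> 0" using sk' t1 s0 by simp
  have Vs: "V * (s - s0) \<ge> 0" using V0 sk' by simp
  have sq: "K * (k - l s)\<^sup>2 < 2 * D" using bnd pw Vs by linarith
  have kR: "k < R"
  proof (rule ccontr)
    assume "\<not> k < R"
    then have "k - l s \<ge> 1" using l_R[OF sk'(1,2)] sk' by linarith
    then have "(k - l s)\<^sup>2 \<ge> 1" by simp
    then have "K * (k - l s)\<^sup>2 \<ge> K * 1" using K by (intro mult_left_mono) auto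
    then show False using sq K by linarith
  qed
  have sT: "s < T"
  proof (rule ccontr)
    assume "\<not> s < T"
    then have "s = T" using sk' by simp
    then have "((s - s0) / (t1 - s0)) ^ n > D" using n(2) by (simp add: \<rho>'_def)
    moreover have "K / 2 * (k - l s)\<^sup>2 \<ge> 0" using K by simp
    ultimately show False using bnd Vs by linarith
  qed
  have ss0: "s = s0"
  proof (rule ccontr)
    assume "s \<noteq> s0"
    then have s: "s > s0" using sk' by simp
    define r where "r = Min {s - s0, T - s, R - k}"
    have r: "r > 0" "r \<le> s - s0" "r \<le> T - s" "r \<le> R - k" using s sT kR by (auto simp: r_def)
    \<comment> \<open>A minimum with \<open>k = 0\<close> is covered as well: near it the quadrant
      lies inside \<open>B\<close>.\<close>
    have "local_min_at ?g s k" unfolding local_min_at_def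
    proof (intro exI[of _ r] conjI allI impI)
      fix s' k' assume a: "(s', k') \<in> quadrant \<and> dist (s', k') (s, k) < r"
      have "\<bar>s' - s\<bar> < r" "\<bar>k' - k\<bar> < r"
        using a dist_fst_le[of "(s', k')" "(s, k)"] dist_snd_le[of "(s', k')" "(s, k)"]
        by (auto simp: dist_real_def)
      then have "(s', k') \<in> B" using r a by (auto simp: B_def quadrant_def)
      then show "?g s k \<le> ?g s' k'" by (rule mn)
    qed (use r in auto)
    then have "dt \<phi> s k - 2 * (dh \<phi> s k)\<^sup>2 \<ge> 0"
      using supersolutionD[OF f _ sk'(3) \<phi>_test] s s0 K l_pos[OF sk'(1,2)] by (simp add: \<phi>_dh)
    then show False using strict[of s k] s by simp
  qed
  have "(k - y)\<^sup>2 < \<delta>\<^sup>2"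
  proof -
    have "K * (k - y)\<^sup>2 < K * \<delta>\<^sup>2" using sq K unfolding ss0 l0 by linarith
    then show ?thesis using K by simp
  qed
  then have "\<bar>k - y\<bar> < \<delta>" using \<delta> power2_less_imp_less[of "\<bar>k - y\<bar>" \<delta>] by simp
  then have "\<bar>f s0 k - f s0 y\<bar> < e" using \<delta> sk' by auto
  moreover have "f s0 k \<le> ?g s k"
    using K pw Vs unfolding ss0 \<phi>_def by (simp add: c_eq H_def)
  moreover have "V * (t0 - s0) = (y - h0)\<^sup>2 / (8 * (t0 - s0)) + e"
  proof -
    define u where "u = t0 - s0"
    have u: "u > 0" using s0 by (simp add: u_def)
    have "y - h0 = - (w * u)" using u by (simp add: w_def u_def)
    then have "(y - h0)\<^sup>2 = w\<^sup>2 * u\<^sup>2" by (simp add: power_mult_distrib)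
    then show ?thesis using u unfolding V_def u_def[symmetric]
      by (simp add: field_simps power2_eq_square)
  qed
  ultimately show ?thesis using upper by linarith
qed

text \<open>Shifting both end points up by the same amount leaves the cost unchanged, so end points
  on the boundary follow by letting the shift tend to \<open>0\<close>.\<close>

lemma supersolution_line:
  assumes f: "viscosity_supersolution f"
    and s0: "0 \<le> s0" "s0 < t0" and y: "y \<ge> 0" and h0: "h0 \<ge> 0"
  shows "f s0 y \<le> f t0 h0 + (y - h0)\<^sup>2 / (8 * (t0 - s0))"
proof -
  have f_cont: "continuous_on quadrant (\<lambda>p. f (fst p) (snd p))"
    using f by (simp add: viscosity_supersolution_def)
  have pos: "f s0 y \<le> f t0 h0 + (y - h0)\<^sup>2 / (8 * (t0 - s0))" if "y > 0" "h0 > 0" for y h0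
  proof (rule field_le_epsilon)
    fix e :: real assume "e > 0"
    then show "f s0 y \<le> f t0 h0 + (y - h0)\<^sup>2 / (8 * (t0 - s0)) + e"
      using supersolution_line_aux[OF f s0 that, of "e / 4"] by simp
  qed
  have "continuous_on {0..} (\<lambda>x. f s (z + x))" if "s \<ge> 0" "z \<ge> 0" for s z
    by (rule continuous_on_compose2[OF f_cont, of _ "\<lambda>x. (s, z + x)", simplified])
      (use that in \<open>auto intro!: continuous_intros simp: quadrant_def\<close>)
  then have lim: "((\<lambda>x. f s (z + x)) \<longlongrightarrow> f s z) (at_right 0)" if "s \<ge> 0" "z \<ge> 0" for s z
    using that unfolding continuous_on_def
    by (metis add.right_neutral atLeast_iff at_within_Ici_at_right order_refl)
  have "f s0 y - f t0 h0 \<le> (y - h0)\<^sup>2 / (8 * (t0 - s0))"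
  proof (rule tendsto_upperbound)
    show "((\<lambda>x. f s0 (y + x) - f t0 (h0 + x)) \<longlongrightarrow> f s0 y - f t0 h0) (at_right 0)"
      by (intro tendsto_diff lim) (use assms in auto)
    show "\<forall>\<^sub>F x in at_right 0. f s0 (y + x) - f t0 (h0 + x) \<le> (y - h0)\<^sup>2 / (8 * (t0 - s0))"
      using eventually_at_right_less
    proof (rule eventually_mono)
      fix x :: real assume "0 < x"
      then show "f s0 (y + x) - f t0 (h0 + x) \<le> (y - h0)\<^sup>2 / (8 * (t0 - s0))"
        using pos[of "y + x" "h0 + x"] y h0 by auto
    qed
  qed auto
  then show ?thesis by simp
qed

lemma ex_pos_mult_le3:
  fixes b1 b2 b3 :: real
  assumes "b1 > 0" "b2 > 0" "b3 > 0"
  obtains x where "x > 0" "a1 * x \<le> b1" "a2 * x \<le> b2" "a3 * x \<le> b3"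
proof -
  have *: "a * x \<le> b" if "x \<le> b / (\<bar>a\<bar> + 1)" "b > 0" "x > 0" for a b x :: real
  proof -
    have "a * x \<le> \<bar>a\<bar> * x" using that by (intro mult_right_mono) auto
    also have "\<dots> \<le> (\<bar>a\<bar> + 1) * x" using that by (intro mult_right_mono) auto
    also have "\<dots> \<le> b" using that by (simp add: le_divide_eq mult.commute split: if_splits)
    finally show ?thesis .
  qed
  define x where "x = Min {b1 / (\<bar>a1\<bar> + 1), b2 / (\<bar>a2\<bar> + 1), b3 / (\<bar>a3\<bar> + 1)}"
  have x: "x > 0" "x \<le> b1 / (\<bar>a1\<bar> + 1)" "x \<le> b2 / (\<bar>a2\<bar> + 1)" "x \<le> b3 / (\<bar>a3\<bar> + 1)"
    using assms by (auto simp: x_def intro!: divide_pos_pos)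
  show thesis using that[OF x(1)] x *[of x] assms by blast
qed

context half_line_lipschitz
begin

lemma viscosity_ge_hopf_lax:
  assumes f: "viscosity_supersolution f" and init: "\<forall>h\<ge>0. f 0 h = \<psi> h"
    and th: "t \<ge> 0" "h \<ge> 0"
  shows "hopf_lax \<psi> t h \<le> f t h"
proof (rule hl_le[OF th(2)])
  fix q assume q: "0 \<le> h + 2 * t * q"
  show "\<psi> (h + 2 * t * q) - t * q\<^sup>2 / 2 \<le> f t h"
  proof (cases "t = 0")
    case True
    then show ?thesis using init th by simp
  next
    case False
    then show ?thesis using supersolution_line[OF f _ _ q th(2), of 0 t] init th q
      by (simp add: power2_eq_square field_simps)
  qed
qed

text \<open>Doubling of variables: one point for \<open>f\<close>, one for \<open>hopf_lax\<close>,
  and a quadratic coupling. Two devices replace a growth assumption on \<open>f\<close>. Since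
  \<open>supersolution_line\<close> bounds \<open>f\<close> by \<open>\<kappa> / 2 * k^2\<close>
  plus a constant for any small \<kappa>, a penalty \<open>\<kappa> * k^2\<close> confines the
  maximum. Its gradient perturbs the equation by terms of size \<open>\<kappa> * k\<close> and
  \<open>\<kappa>^2 * k^2\<close>; letting the coefficient grow with time, as
  \<open>\<kappa> * (1 + s / T)\<close>, produces a time derivative
  \<open>\<kappa> * k^2 / T\<close> that absorbs them up to a small constant.\<close>

lemma viscosity_le_hopf_lax:
  assumes f: "viscosity_solution f" and init: "\<forall>h\<ge>0. f 0 h = \<psi> h"
    and th: "t0 > 0" "h0 \<ge> 0"
  shows "f t0 h0 \<le> hopf_lax \<psi> t0 h0"
proof (rule ccontr)
  let ?g = "hopf_lax \<psi>"
  assume "\<not> f t0 h0 \<le> ?g t0 h0"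
  \<comment> \<open>Of the gap \<open>8 * \<gamma>\<close> the penalties at \<open>(t0, h0)\<close>
    use at most \<open>3 * \<gamma>\<close>; the remaining \<open>5 * \<gamma>\<close> still beats
    the at most \<open>3 * \<gamma>\<close> available when one of the two times is
    \<open>0\<close>.\<close>
  define \<gamma> where "\<gamma> = (f t0 h0 - ?g t0 h0) / 8"
  have \<gamma>: "\<gamma> > 0" "f t0 h0 - ?g t0 h0 = 8 * \<gamma>" using \<open>\<not> _\<close> by (auto simp: \<gamma>_def)
  have sub: "viscosity_subsolution f" and super: "viscosity_supersolution f"
    using f by (auto simp: viscosity_solution_def)
  have f_cont: "continuous_on quadrant (\<lambda>p. f (fst p) (snd p))"
    using super by (simp add: viscosity_supersolution_def)
  define T where "T = t0 + 1"
  define t1 where "t1 = t0 + 1 / 2"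
  have T: "T > 0" "t0 < t1" "t1 < T" "t1 > 0" using th by (auto simp: T_def t1_def)
  define \<epsilon> where "\<epsilon> = \<gamma> / t0"
  have \<epsilon>: "\<epsilon> > 0" "\<epsilon> * t0 = \<gamma>" using \<gamma> th by (auto simp: \<epsilon>_def)
  \<comment> \<open>The first two bounds serve to absorb the cross term and the square of the
    penalty gradient at the end; the last makes the penalty at \<open>h0\<close> cost at most
    \<gamma>.\<close>
  obtain \<kappa> where \<kappa>: "\<kappa> > 0" "1024 * L\<^sup>2 * T * \<kappa> \<le> \<epsilon> / 4" "256 * T * \<kappa> \<le> 1" "2 * h0\<^sup>2 * \<kappa> \<le> \<gamma>"
    using ex_pos_mult_le3[of "\<epsilon> / 4" 1 \<gamma>] \<epsilon> \<gamma> by (metis divide_pos_pos zero_less_numeral zero_less_one)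
  \<comment> \<open>The term \<open>- \<eta> * k\<close> will tilt the penalty so that its slope is
    negative at \<open>k = 0\<close>, as \<open>subsolutionD\<close> requires.\<close>
  obtain \<eta> where \<eta>: "\<eta> > 0" "1 * \<eta> \<le> 1" "(8 * L + 4) * \<eta> \<le> \<epsilon> / 4" "1 * \<eta> \<le> 4 * \<kappa> * \<gamma>"
    using ex_pos_mult_le3[of 1 "\<epsilon> / 4" "4 * \<kappa> * \<gamma>" 1 "8 * L + 4" 1] \<epsilon> \<gamma> \<kappa> by auto
  have \<eta>2: "\<eta> * \<eta> \<le> \<eta>" using \<eta> mult_right_mono[of \<eta> 1 \<eta>] by simp
  have pen_k: "\<eta> * k - \<kappa> * k\<^sup>2 \<le> \<gamma>" for k
  proof -
    have "0 \<le> (2 * \<kappa> * k - \<eta>)\<^sup>2" by simp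
    then have "4 * \<kappa> * (\<eta> * k - \<kappa> * k\<^sup>2) \<le> \<eta> * \<eta>"
      by (simp add: power2_eq_square algebra_simps)
    also have "\<dots> \<le> 4 * \<kappa> * \<gamma>" using \<eta>2 \<eta> by linarith
    finally show ?thesis using \<kappa> by simp
  qed
  \<comment> \<open>Chosen so that the segment from \<open>(s, k)\<close> to \<open>(T1, 0)\<close>
    costs at most \<open>\<kappa> / 2 * k^2\<close> for all \<open>s \<le> T\<close>.\<close>
  define T1 where "T1 = T + 1 / (4 * \<kappa>)"
  define Cg where "Cg = f T1 0"
  have growth: "f s k \<le> Cg + \<kappa> / 2 * k\<^sup>2" if "0 \<le> s" "s \<le> T" "0 \<le> k" for s k
  proof -
    have T1: "T1 > T" using \<kappa> by (simp add: T1_def)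
    have "f s k \<le> f T1 0 + (k - 0)\<^sup>2 / (8 * (T1 - s))"
      by (rule supersolution_line[OF super]) (use that T1 in auto)
    also have "(k - 0)\<^sup>2 / (8 * (T1 - s)) \<le> k\<^sup>2 / (8 * (T1 - T))"
      using that T1 by (simp add: frac_le)
    also have "\<dots> = \<kappa> / 2 * k\<^sup>2" using \<kappa> by (simp add: T1_def)
    finally show ?thesis by (simp add: Cg_def)
  qed
  \<comment> \<open>Constants for the bound on \<Phi> at the maximum: the coupling yields
    \<open>L^2 / 2\<close> by Young's inequality, and maximising
    \<open>(L + 1) * k - \<kappa> / 2 * k^2\<close> turns \<open>C2\<close> into
    \<open>C1\<close>.\<close>
  define C2 where "C2 = Cg - \<psi> 0 + L\<^sup>2 / 2"
  define C1 where "C1 = C2 + (L + 1)\<^sup>2 / (2 * \<kappa>)"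
  have C1: "C2 + (L + 1) * k - \<kappa> / 2 * k\<^sup>2 \<le> C1" for k
  proof -
    have "0 \<le> (\<kappa> * k - (L + 1))\<^sup>2" by simp
    then have "2 * \<kappa> * ((L + 1) * k - \<kappa> / 2 * k\<^sup>2) \<le> (L + 1)\<^sup>2"
      by (simp add: power2_eq_square algebra_simps)
    then have "(L + 1) * k - \<kappa> / 2 * k\<^sup>2 \<le> (L + 1)\<^sup>2 / (2 * \<kappa>)"
      using \<kappa> by (simp add: le_divide_eq mult.commute)
    then show ?thesis by (simp add: C1_def)
  qed
  define R0 where "R0 = 2 * (L + 1 + \<bar>C2\<bar>) / \<kappa> + 1 + h0"
  have "2 * (L + 1 + \<bar>C2\<bar>) / \<kappa> \<ge> 0" using \<kappa> L_nonneg by simp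
  then have R0: "R0 > h0" "R0 \<ge> 1" "R0 > 0" using th unfolding R0_def by linarith+
  have R0_big: "C2 + (L + 1) * k - \<kappa> / 2 * k\<^sup>2 \<le> 0" if "k \<ge> R0" for k
  proof -
    have k1: "k \<ge> 1" using that R0 by simp
    have "2 * (L + 1 + \<bar>C2\<bar>) / \<kappa> \<le> k" using that th by (simp add: R0_def)
    then have "2 * (L + 1 + \<bar>C2\<bar>) \<le> k * \<kappa>" using \<kappa> by (simp add: divide_le_eq)
    then have "(L + 1 + \<bar>C2\<bar>) * k \<le> (\<kappa> / 2 * k) * k"
      using k1 by (intro mult_right_mono) (auto simp: mult.commute)
    moreover have "\<bar>C2\<bar> * 1 \<le> \<bar>C2\<bar> * k" using k1 by (intro mult_left_mono) auto
    ultimately show ?thesis by (simp add: power2_eq_square algebra_simps)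
  qed
  \<comment> \<open>The maximum will have \<open>k < R0\<close> and
    \<open>|k - k'| \<le> 2 * L\<close>; the extra unit leaves room to displace \<open>k'\<close>
    without leaving the box.\<close>
  define R where "R = R0 + 2 * L + 1"
  obtain d where d: "d > 0" "\<And>s k. 0 \<le> s \<Longrightarrow> s \<le> d \<Longrightarrow> s \<le> T \<Longrightarrow> 0 \<le> k \<Longrightarrow> k \<le> R \<Longrightarrow> f s k - \<psi> k \<le> \<gamma>"
  proof -
    have "uniformly_continuous_on ({0..T} \<times> {0..R}) (\<lambda>p. f (fst p) (snd p))"
      by (intro compact_uniformly_continuous compact_Times continuous_on_subset[OF f_cont])
        (auto simp: quadrant_def)
    then obtain d where "d > 0" and d: "\<And>p q. p \<in> {0..T} \<times> {0..R} \<Longrightarrow> q \<in> {0..T} \<times> {0..R} \<Longrightarrow>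
      dist q p < d \<Longrightarrow> dist (f (fst q) (snd q)) (f (fst p) (snd p)) < \<gamma>"
      using \<gamma>(1) unfolding uniformly_continuous_on_def by meson
    show thesis
    proof (rule that[of "d / 2"])
      fix s k assume "0 \<le> s" "s \<le> d / 2" "s \<le> T" "0 \<le> k" "k \<le> R"
      then show "f s k - \<psi> k \<le> \<gamma>"
        using d[of "(0, k)" "(s, k)"] \<open>d > 0\<close> init by (auto simp: dist_real_def dist_Pair_Pair)
    qed (use \<open>d > 0\<close> in auto)
  qed
  \<comment> \<open>The coupling is strong enough that \<open>s' = 0\<close> forces
    \<open>s \<le> d\<close>, and that \<open>L * |k - k'| \<le> \<gamma>\<close>.\<close>
  define K where "K = 1 + 4 * L\<^sup>2 / d + 2 * L\<^sup>2 / \<gamma>"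
  have K: "K \<ge> 1" "4 * L\<^sup>2 \<le> d * K" "2 * L\<^sup>2 \<le> \<gamma> * K"
    using d \<gamma> by (auto simp: K_def distrib_left)
  obtain n where n: "(t0 / t1) ^ n < \<gamma>" "(T / t1) ^ n > C1"
  proof -
    have "(\<lambda>n. (t0 / t1) ^ n) \<longlonglongrightarrow> 0" using T th by (intro LIMSEQ_realpow_zero) auto
    then have 1: "eventually (\<lambda>n. (t0 / t1) ^ n < \<gamma>) sequentially"
      using \<gamma> by (auto dest!: order_tendstoD(2))
    obtain N where N: "C1 < (T / t1) ^ N" using real_arch_pow[of "T / t1" C1] T by auto
    have 2: "eventually (\<lambda>n. C1 < (T / t1) ^ n) sequentially"
      unfolding eventually_sequentially
    proof (intro exI[of _ N] allI impI)
      fix n assume "N \<le> n"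
      then have "(T / t1) ^ N \<le> (T / t1) ^ n" using T by (intro power_increasing) auto
      with N show "C1 < (T / t1) ^ n" by simp
    qed
    show thesis using eventually_conj[OF 1 2] that by (auto simp: eventually_sequentially)
  qed
  define i where "i = 1 / T"
  define j where "j = 1 / t1"
  have i: "i > 0" "i * T = 1" and j: "j > 0" using T by (auto simp: i_def j_def)
  have is1: "s * i \<le> 1" if "s \<le> T" for s using that T by (simp add: i_def)
  \<comment> \<open>Four terms: quadratic confinement growing with time, boundary tilt, strictness,
    and the power barrier at the final time \<open>T\<close>.\<close>
  define pen where "pen = (\<lambda>s k. \<kappa> * (1 + s * i) * k\<^sup>2 - \<eta> * k + \<epsilon> * s + (s * j) ^ n)"
  have pen_poly: "poly2 pen"
    unfolding pen_def by (intro poly2_diff poly2.intros poly2_power)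
  have pen_ge: "\<kappa> * k\<^sup>2 - \<eta> * k + (s * j) ^ n \<le> pen s k" "(s * j) ^ n \<ge> 0" if "s \<ge> 0" for s k
  proof -
    have "0 \<le> \<kappa> * (s * i) * k\<^sup>2" "0 \<le> \<epsilon> * s" using that \<kappa> i \<epsilon> by auto
    then show "\<kappa> * k\<^sup>2 - \<eta> * k + (s * j) ^ n \<le> pen s k" by (simp add: pen_def algebra_simps)
    show "(s * j) ^ n \<ge> 0" using that j by simp
  qed
  define \<Phi> where "\<Phi> = (\<lambda>s k s' k'. f s k - ?g s' k' - K / 2 * ((s - s')\<^sup>2 + (k - k')\<^sup>2) - pen s k)"
  define B where "B = {0..T} \<times> {0..R}"
  have B_comp: "compact B" unfolding B_def by (intro compact_Times) auto
  have B_sub: "B \<subseteq> quadrant" by (auto simp: B_def quadrant_def)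
  have R: "R \<ge> R0 + 1" using L_nonneg by (auto simp: R_def)
  have t0B: "(t0, h0) \<in> B" using T th R R0 by (auto simp: B_def)
  obtain s k s' k' where skB: "(s, k) \<in> B" "(s', k') \<in> B"
    and mx: "\<And>u x u' x'. (u, x) \<in> B \<Longrightarrow> (u', x') \<in> B \<Longrightarrow> \<Phi> u x u' x' \<le> \<Phi> s k s' k'"
  proof -
    have 1: "continuous_on (B \<times> B) (\<lambda>p. f (fst (fst p)) (snd (fst p)))"
      by (rule continuous_on_compose2[OF continuous_on_subset[OF f_cont B_sub], of _ fst])
        (auto intro!: continuous_intros)
    have 2: "continuous_on (B \<times> B) (\<lambda>p. ?g (fst (snd p)) (snd (snd p)))"
      by (rule continuous_on_compose2[OF continuous_on_subset[OF hl_continuous B_sub], of _ snd])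
        (auto intro!: continuous_intros)
    have 3: "continuous_on (B \<times> B) (\<lambda>p. pen (fst (fst p)) (snd (fst p)))"
      by (rule continuous_on_compose2[OF poly2_continuous[OF pen_poly, of UNIV], of _ fst])
        (auto intro!: continuous_intros)
    have "continuous_on (B \<times> B) (\<lambda>p. \<Phi> (fst (fst p)) (snd (fst p)) (fst (snd p)) (snd (snd p)))"
      unfolding \<Phi>_def by (intro continuous_intros 1 2 3)
    from continuous_attains_sup[OF compact_Times[OF B_comp B_comp] _ this] t0B
    obtain p where "p \<in> B \<times> B" "\<And>q. q \<in> B \<times> B \<Longrightarrow>
      \<Phi> (fst (fst q)) (snd (fst q)) (fst (snd q)) (snd (snd q)) \<le>
      \<Phi> (fst (fst p)) (snd (fst p)) (fst (snd p)) (snd (snd p))"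
      by blast
    then show thesis
      by (intro that[of "fst (fst p)" "snd (fst p)" "fst (snd p)" "snd (snd p)"])
        (auto simp: mem_Times_iff)
  qed
  have sk: "0 \<le> s" "s \<le> T" "0 \<le> k" "k \<le> R" and sk': "0 \<le> s'" "s' \<le> T" "0 \<le> k'" "k' \<le> R"
    using skB by (auto simp: B_def)
  have "\<Phi> t0 h0 t0 h0 \<ge> 5 * \<gamma>"
  proof -
    have "\<kappa> * (1 + t0 * i) * h0\<^sup>2 \<le> \<kappa> * 2 * h0\<^sup>2"
      using \<kappa> is1[of t0] T by (intro mult_right_mono mult_left_mono) auto
    moreover have "\<kappa> * 2 * h0\<^sup>2 = 2 * h0\<^sup>2 * \<kappa>" by simp
    moreover have "\<eta> * h0 \<ge> 0" using \<eta>(1) th by simp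
    moreover have "(t0 * j) ^ n = (t0 / t1) ^ n" by (simp add: j_def)
    ultimately have "pen t0 h0 \<le> 3 * \<gamma>"
      using \<kappa>(4) \<epsilon>(2) n(1) unfolding pen_def by linarith
    then show ?thesis using \<gamma>(2) by (simp add: \<Phi>_def)
  qed
  then have big: "\<Phi> s k s' k' \<ge> 5 * \<gamma>" using mx[OF t0B t0B] by linarith
  have Lk: "L * \<bar>x\<bar> \<le> L\<^sup>2 / 2 + K / 2 * x\<^sup>2" for x
  proof -
    have "0 \<le> (L - \<bar>x\<bar>)\<^sup>2" by simp
    then have "L * \<bar>x\<bar> \<le> L\<^sup>2 / 2 + 1 / 2 * x\<^sup>2" by (simp add: power2_diff)
    also have "1 / 2 * x\<^sup>2 \<le> K / 2 * x\<^sup>2" using K by (intro mult_right_mono) auto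
    finally show ?thesis by simp
  qed
  have \<Phi>_le: "\<Phi> s k s' k' \<le> C2 + (L + 1) * k - \<kappa> / 2 * k\<^sup>2 - (s * j) ^ n"
  proof -
    have "\<psi> 0 - L * k - L * \<bar>k - k'\<bar> \<le> ?g s' k'"
      using hl_ge_psi[OF sk'(1,3)] lip[OF sk(3) sk'(3)] lip[of 0 k] sk by auto
    moreover have "\<eta> * k \<le> 1 * k" using \<eta> sk by (intro mult_right_mono) auto
    moreover have "0 \<le> K / 2 * (s - s')\<^sup>2" using K by simp
    ultimately show ?thesis
      using growth[OF sk(1-3)] Lk[of "k - k'"] pen_ge(1)[OF sk(1), of k]
      by (simp add: \<Phi>_def C2_def algebra_simps)
  qed
  have sT: "s < T"
  proof (rule ccontr)
    assume "\<not> s < T"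
    then have "(s * j) ^ n > C1" using n(2) sk by (simp add: j_def)
    then show False using \<Phi>_le C1[of k] big \<gamma> by linarith
  qed
  have kR: "k < R0"
    using \<Phi>_le R0_big[of k] big \<gamma> pen_ge(2)[OF sk(1)] by (cases "k < R0") auto
  \<comment> \<open>Only the second point is moved, here to \<open>(s', k)\<close>: the Lipschitz
    bound comes from \<open>hopf_lax\<close>, nothing of the kind being known about
    \<open>f\<close>. The time variable is treated alike below.\<close>
  have p: "K * \<bar>k - k'\<bar> \<le> 2 * L"
  proof (cases "k = k'")
    case False
    have "(s', k) \<in> B" using sk sk' by (auto simp: B_def)
    then have "K / 2 * (k - k')\<^sup>2 \<le> ?g s' k - ?g s' k'"
      using mx[OF skB(1), of s' k] by (simp add: \<Phi>_def algebra_simps)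
    also have "\<dots> \<le> L * \<bar>k - k'\<bar>" using hl_lip[OF sk'(1) sk(3) sk'(3)] by auto
    finally have "K / 2 * \<bar>k - k'\<bar> * \<bar>k - k'\<bar> \<le> L * \<bar>k - k'\<bar>"
      by (simp add: power2_eq_square)
    then show ?thesis using False by simp
  qed (use L_nonneg in simp)
  have a: "K * \<bar>s - s'\<bar> \<le> 4 * L\<^sup>2"
  proof (cases "s = s'")
    case False
    have "(s, k') \<in> B" using sk sk' by (auto simp: B_def)
    then have "K / 2 * (s - s')\<^sup>2 \<le> ?g s k' - ?g s' k'"
      using mx[OF skB(1), of s k'] by (simp add: \<Phi>_def algebra_simps)
    also have "\<dots> \<le> 2 * L\<^sup>2 * \<bar>s - s'\<bar>" using hl_time_lip[OF sk(1) sk'(1,3)] by auto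
    finally have "K / 2 * \<bar>s - s'\<bar> * \<bar>s - s'\<bar> \<le> 2 * L\<^sup>2 * \<bar>s - s'\<bar>"
      by (simp add: power2_eq_square)
    then show ?thesis using False by simp
  qed simp
  have kk: "\<bar>k - k'\<bar> \<le> 2 * L"
    using p mult_right_mono[of 1 K "\<bar>k - k'\<bar>"] K by simp
  have Lkk: "L * \<bar>k - k'\<bar> \<le> \<gamma>"
  proof -
    have "K * (L * \<bar>k - k'\<bar>) \<le> L * (2 * L)"
      using mult_left_mono[OF p L_nonneg] by (simp add: algebra_simps)
    also have "\<dots> \<le> K * \<gamma>" using K(3) by (simp add: power2_eq_square mult.commute)
    finally show ?thesis using K by simp
  qed
  have quad0: "K / 2 * ((s - s')\<^sup>2 + (k - k')\<^sup>2) \<ge> 0" using K by simp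
  have pen0: "- pen s k \<le> \<gamma>" using pen_ge(1)[OF sk(1), of k] pen_ge(2)[OF sk(1)] pen_k[of k] by linarith
  have s_pos: "s > 0"
  proof (rule ccontr)
    assume "\<not> s > 0"
    then have "s = 0" using sk by simp
    then have "\<Phi> s k s' k' \<le> \<psi> k - \<psi> k' + \<gamma>"
      using quad0 pen0 init sk hl_ge_psi[OF sk'(1,3)] by (simp add: \<Phi>_def)
    then show False using lip[OF sk(3) sk'(3)] Lkk big \<gamma>(1) by linarith
  qed
  have s'_pos: "s' > 0"
  proof (rule ccontr)
    assume "\<not> s' > 0"
    then have s'0: "s' = 0" using sk' by simp
    have "K * s \<le> K * d" using a K(2) sk unfolding s'0 by (simp add: mult.commute)
    then have "s \<le> d" using K by simp
    then have "f s k - \<psi> k \<le> \<gamma>" using d(2) sk by simp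
    then show False using quad0 pen0 hl_0[OF sk'(3)] lip[OF sk(3) sk'(3)] Lkk big \<gamma>(1)
      unfolding s'0 \<Phi>_def by linarith
  qed
  define a where "a = K * (s - s')"
  define p where "p = K * (k - k')"
  have p_le: "\<bar>p\<bar> \<le> 2 * L" using \<open>K * \<bar>k - k'\<bar> \<le> 2 * L\<close> K by (simp add: p_def abs_mult)
  \<comment> \<open>The supersolution inequality of \<open>hopf_lax\<close> at
    \<open>(s', k')\<close>, read off from \<open>hl_step\<close>: go back by \<delta> in time along
    the characteristic of velocity \<open>4 * p\<close> and compare with the maximum to first order
    in \<delta>. The constant \<open>D\<close> collects the second order.\<close>
  have g_side: "2 * p\<^sup>2 \<le> a"
  proof (rule ccontr)
    assume "\<not> 2 * p\<^sup>2 \<le> a"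
    define D where "D = K / 2 * (1 + 16 * p\<^sup>2)"
    have D: "D > 0" using K by (auto simp: D_def intro!: mult_pos_pos add_pos_nonneg)
    \<comment> \<open>Room for the displacement: for \<open>p < 0\<close> the point moves down, and
      then \<open>k < k'\<close> makes \<open>k'\<close> positive.\<close>
    define m where "m = (if p < 0 then k' else 1)"
    have m: "m > 0" using sk K by (auto simp: m_def p_def zero_less_mult_iff mult_less_0_iff)
    obtain \<delta> where \<delta>: "\<delta> > 0" "1 * \<delta> \<le> s'" "4 * \<bar>p\<bar> * \<delta> \<le> min 1 m" "D * \<delta> \<le> (2 * p\<^sup>2 - a) / 2"
      using ex_pos_mult_le3[of s' "min 1 m" "(2 * p\<^sup>2 - a) / 2" 1 "4 * \<bar>p\<bar>" D] s'_pos m \<open>\<not> 2 * p\<^sup>2 \<le> a\<close>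
      by auto
    define x where "x = k' + 2 * (2 * p) * \<delta>"
    have ab: "\<bar>2 * (2 * p) * \<delta>\<bar> \<le> min 1 m" using \<delta> by (simp add: abs_mult)
    have x: "0 \<le> x" "x \<le> R"
    proof -
      show "0 \<le> x"
      proof (cases "p < 0")
        case True
        then show ?thesis using ab by (auto simp: x_def m_def)
      next
        case False
        then show ?thesis using sk' \<delta> by (simp add: x_def)
      qed
      show "x \<le> R" using ab kk kR unfolding x_def R_def by linarith
    qed
    have "(s' - \<delta>, x) \<in> B" using x sk' \<delta> by (auto simp: B_def)
    from mx[OF skB(1) this]
    have "?g s' k' + K / 2 * ((s - s')\<^sup>2 + (k - k')\<^sup>2) \<le>
      ?g (s' - \<delta>) x + K / 2 * ((s - (s' - \<delta>))\<^sup>2 + (k - x)\<^sup>2)"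
      by (simp add: \<Phi>_def)
    moreover have "?g (s' - \<delta>) x - \<delta> * (2 * p)\<^sup>2 / 2 \<le> ?g s' k'"
      using hl_step[of "s' - \<delta>" \<delta> k' "2 * p"] \<delta> sk' x unfolding x_def by simp
    moreover have "K / 2 * ((s - (s' - \<delta>))\<^sup>2 + (k - x)\<^sup>2) =
      K / 2 * ((s - s')\<^sup>2 + (k - k')\<^sup>2) + a * \<delta> - 4 * p\<^sup>2 * \<delta> + D * \<delta> * \<delta>"
      by (simp add: x_def a_def p_def D_def power2_eq_square field_simps)
    ultimately have "0 \<le> (a - 2 * p\<^sup>2 + D * \<delta>) * \<delta>"
      by (simp add: algebra_simps power2_eq_square)
    then have "0 \<le> a - 2 * p\<^sup>2 + D * \<delta>" using \<delta>(1) by (simp add: zero_le_mult_iff)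
    then have "2 * p\<^sup>2 - a \<le> (2 * p\<^sup>2 - a) / 2" using \<delta>(4) by simp
    then show False using \<open>\<not> 2 * p\<^sup>2 \<le> a\<close> by simp
  qed
  define H where "H = K / 2"
  have HK: "K = 2 * H" by (simp add: H_def)
  define \<phi> where "\<phi> = (\<lambda>u x. H * ((u - s')\<^sup>2 + (x - k')\<^sup>2) + pen u x)"
  have \<phi>_poly: "poly2 \<phi>" unfolding \<phi>_def power2_eq_square
    by (intro poly2_diff poly2.intros poly2_power pen_poly)
  have \<phi>_dt: "dt \<phi> s k = a + \<kappa> * i * k\<^sup>2 + \<epsilon> + n * (s * j) ^ (n - 1) * j"
  proof -
    define pw where "pw = (\<lambda>u. (u * j) ^ n)"
    define pw' where "pw' = n * (s * j) ^ (n - 1) * j"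
    have pw: "(pw has_real_derivative pw') (at s)"
      unfolding pw_def pw'_def by (auto intro!: derivative_eq_intros)
    show ?thesis
      unfolding dt_def \<phi>_def pen_def a_def HK pw'_def[symmetric]
        fun_cong[OF pw_def[symmetric], simplified]
      by (rule DERIV_imp_deriv) (auto intro!: derivative_eq_intros pw simp: algebra_simps)
  qed
  define w where "w = 2 * (\<kappa> * (1 + s * i)) * k - \<eta>"
  have \<phi>_dh: "dh \<phi> s k = p + w"
    unfolding dh_def \<phi>_def pen_def p_def HK w_def
    by (rule DERIV_imp_deriv) (auto intro!: derivative_eq_intros simp: algebra_simps)
  have "local_max_at (\<lambda>u x. f u x - \<phi> u x) s k"
    unfolding local_max_at_def
  proof (intro exI[of _ "Min {s, T - s, R - k}"] conjI allI impI)
    fix u x assume a: "(u, x) \<in> quadrant \<and> dist (u, x) (s, k) < Min {s, T - s, R - k}"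
    then have "\<bar>u - s\<bar> < T - s" "\<bar>x - k\<bar> < R - k"
      using dist_fst_le[of "(u, x)" "(s, k)"] dist_snd_le[of "(u, x)" "(s, k)"]
      by (auto simp: dist_real_def)
    then have "(u, x) \<in> B" using a by (auto simp: B_def quadrant_def)
    from mx[OF this skB(2)] show "f u x - \<phi> u x \<le> f s k - \<phi> s k"
      by (simp add: \<Phi>_def \<phi>_def H_def)
  qed (use s_pos sT kR R in auto)
  moreover have "dh \<phi> s k < 0" if "k = 0"
  proof -
    have "p \<le> 0" using that K sk' by (simp add: p_def)
    moreover have "w = - \<eta>" using that by (simp add: w_def)
    ultimately show ?thesis using \<eta>(1) unfolding \<phi>_dh by linarith
  qed
  ultimately have "dt \<phi> s k - 2 * (dh \<phi> s k)\<^sup>2 \<le> 0"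
    by (intro subsolutionD[OF sub s_pos sk(3) poly2_test_fun[OF \<phi>_poly]])
  moreover have "n * (s * j) ^ (n - 1) * j \<ge> 0" using sk j by simp
  moreover have "2 * (p + w)\<^sup>2 = 2 * p\<^sup>2 + 4 * (p * w) + 2 * w\<^sup>2"
    by (simp add: power2_eq_square algebra_simps)
  ultimately have main: "\<kappa> * i * k\<^sup>2 + \<epsilon> \<le> 4 * (p * w) + 2 * w\<^sup>2"
    unfolding \<phi>_dt \<phi>_dh using g_side by linarith
  have w_le: "\<bar>w\<bar> \<le> 4 * \<kappa> * k + \<eta>"
  proof -
    define X where "X = 2 * (\<kappa> * (1 + s * i)) * k"
    have "X \<le> 2 * (\<kappa> * 2) * k" unfolding X_def
      using \<kappa> sk is1[of s] by (intro mult_right_mono mult_left_mono) auto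
    moreover have "X \<ge> 0" unfolding X_def using \<kappa> sk i by simp
    moreover have "\<kappa> * k \<ge> 0" using \<kappa> sk by simp
    moreover have "w = X - \<eta>" by (simp add: w_def X_def)
    ultimately show ?thesis using \<eta>(1) by linarith
  qed
  have "4 * (p * w) \<le> 8 * L * (4 * \<kappa> * k + \<eta>)"
  proof -
    have "p * w \<le> \<bar>p\<bar> * \<bar>w\<bar>" by (simp flip: abs_mult)
    also have "\<dots> \<le> 2 * L * (4 * \<kappa> * k + \<eta>)" using p_le w_le by (intro mult_mono) auto
    finally show ?thesis by simp
  qed
  also have "\<dots> = \<kappa> * (32 * L * k) + 8 * L * \<eta>" by (simp add: algebra_simps)
  also have "32 * L * k \<le> i / 4 * k\<^sup>2 + 1024 * L\<^sup>2 * T"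
  proof -
    have "0 \<le> T * (i / 2 * k - 32 * L)\<^sup>2" using T by simp
    also have "\<dots> = (i * T) * (i / 4 * k\<^sup>2) - (i * T) * (32 * L * k) + 1024 * L\<^sup>2 * T"
      by (simp add: power2_eq_square algebra_simps)
    finally show ?thesis using i by simp
  qed
  finally have 1: "4 * (p * w) \<le> \<kappa> * (i / 4 * k\<^sup>2 + 1024 * L\<^sup>2 * T) + 8 * L * \<eta>"
    using \<kappa> by (simp add: mult_left_mono)
  have "2 * w\<^sup>2 \<le> 2 * (4 * \<kappa> * k + \<eta>)\<^sup>2"
    using power_mono[OF w_le, of 2] by simp
  also have "\<dots> \<le> 64 * \<kappa> * \<kappa> * k\<^sup>2 + 4 * \<eta> * \<eta>"
  proof -
    have "0 \<le> 2 * (4 * \<kappa> * k - \<eta>)\<^sup>2" by simp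
    then show ?thesis by (simp add: power2_eq_square algebra_simps)
  qed
  also have "64 * \<kappa> * \<kappa> * k\<^sup>2 \<le> i / 4 * \<kappa> * k\<^sup>2"
  proof -
    have "256 * \<kappa> \<le> i" using \<kappa>(3) T by (simp add: i_def le_divide_eq algebra_simps)
    then show ?thesis using i \<kappa> by (intro mult_right_mono) auto
  qed
  finally have 2: "2 * w\<^sup>2 \<le> i / 4 * \<kappa> * k\<^sup>2 + 4 * \<eta> * \<eta>" by simp
  \<comment> \<open>The right side of \<open>main\<close> is at most
    \<open>Y / 2 + \<epsilon> / 2\<close>, against \<open>Y + \<epsilon>\<close> on its
    left.\<close>
  have "8 * L * \<eta> + 4 * \<eta> * \<eta> \<le> \<epsilon> / 4" using \<eta>(3) \<eta>2 by (simp add: algebra_simps)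
  moreover define Y where "Y = \<kappa> * i * k\<^sup>2"
  moreover have "\<kappa> * (i / 4 * k\<^sup>2 + 1024 * L\<^sup>2 * T) = Y / 4 + 1024 * L\<^sup>2 * T * \<kappa>"
    by (simp add: Y_def algebra_simps)
  moreover have "Y \<ge> 0" using \<kappa> i by (simp add: Y_def)
  moreover have "i / 4 * \<kappa> * k\<^sup>2 = Y / 4" by (simp add: Y_def)
  ultimately show False using main 1 2 \<kappa>(2) \<epsilon>(1) by simp
qed

theorem viscosity_solution_eq_hopf_lax:
  assumes f: "viscosity_solution f" and init: "\<forall>h\<ge>0. f 0 h = \<psi> h"
    and th: "t \<ge> 0" "h \<ge> 0"
  shows "f t h = hopf_lax \<psi> t h"
proof (cases "t = 0")
  case True
  then show ?thesis using init th by (simp add: hl_0)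
next
  case False
  have "viscosity_supersolution f" using f by (simp add: viscosity_solution_def)
  from viscosity_le_hopf_lax[OF f init _ th(2), of t] viscosity_ge_hopf_lax[OF this init th] False th
  show ?thesis by simp
qed

end

section \<open>Gaussian integration by parts and translation\<close>

lemma sets_gauss [measurable_cong, simp]: "sets gauss = sets borel"
  and space_gauss [simp]: "space gauss = UNIV"
  by (simp_all add: gauss_def)

lemma prob_space_gauss: "prob_space gauss"
  unfolding gauss_def by (rule prob_space_normal_density) simp

lemma integral_gauss:
  "f \<in> borel_measurable borel \<Longrightarrow> (\<integral>x. f x \<partial>gauss) = (\<integral>x. std_normal_density x * f x \<partial>lborel)"
  for f :: "real \<Rightarrow> real"
  unfolding gauss_def by (subst integral_density) auto

lemma integrable_gauss:
  "f \<in> borel_measurable borel \<Longrightarrow> integrable gauss f \<longleftrightarrow> integrable lborel (\<lambda>x. std_normal_density x * f x)"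
  for f :: "real \<Rightarrow> real"
  unfolding gauss_def by (subst integrable_density) auto

lemma integrable_gauss_power [simp]: "integrable gauss (\<lambda>x. x ^ k)"
  using integrable_std_normal_moment[of k] by (subst integrable_gauss) auto

lemma integrable_gauss_ident [simp]: "integrable gauss (\<lambda>x. x)"
  using integrable_gauss_power[of 1] by simp

lemma gauss_second_moment: "(\<integral>x. x\<^sup>2 \<partial>gauss) = 1"
  using integral_std_normal_moment_even[of 1] by (subst integral_gauss) auto

text \<open>Stein's identity: weighted by the density, the difference of the two integrands is the
  derivative of \<open>std_normal_density x * u x\<close>, which vanishes at both infinities since
  \<open>u\<close> is bounded.\<close>

lemma gauss_integral_by_parts:
  fixes u u' :: "real \<Rightarrow> real"
  assumes u: "\<And>x. (u has_real_derivative u' x) (at x)" and u': "\<And>x. isCont u' x"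
    and bdd: "\<And>x. \<bar>u x\<bar> \<le> C" "\<And>x. \<bar>u' x\<bar> \<le> C"
  shows "(\<integral>x. x * u x \<partial>gauss) = (\<integral>x. u' x \<partial>gauss)"
proof -
  let ?d = std_normal_density
  have C0: "C \<ge> 0" using bdd(1)[of 0] by simp
  have ucont: "continuous_on UNIV u" "continuous_on UNIV u'"
    using u' DERIV_isCont[OF u] by (auto intro!: continuous_at_imp_continuous_on)
  have [measurable]: "u \<in> borel_measurable borel" "u' \<in> borel_measurable borel"
    by (intro borel_measurable_continuous_onI ucont)+
  have i1: "integrable lborel (\<lambda>x. ?d x * u' x)"
    by (rule Bochner_Integration.integrable_bound[where f = "\<lambda>x. C * ?d x"])
      (use bdd C0 in \<open>auto simp: abs_mult mult.commute intro!: mult_right_mono\<close>)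
  have i2: "integrable lborel (\<lambda>x. ?d x * (x * u x))"
  proof (rule Bochner_Integration.integrable_bound[where f = "\<lambda>x. C * (?d x * \<bar>x\<bar> ^ 1)"])
    show "integrable lborel (\<lambda>x. C * (?d x * \<bar>x\<bar> ^ 1))"
      by (intro integrable_mult_right integrable_std_normal_moment_abs)
    have "\<bar>x\<bar> * \<bar>u x\<bar> \<le> C * \<bar>x\<bar>" for x
      using mult_left_mono[OF bdd(1)[of x], of "\<bar>x\<bar>"] by (simp add: mult.commute)
    then show "AE x in lborel. norm (?d x * (x * u x)) \<le> norm (C * (?d x * \<bar>x\<bar> ^ 1))"
      using C0 by (intro AE_I2) (simp add: abs_mult mult.left_commute[of C] mult_left_mono)
  qed simp
  have dd: "(?d has_real_derivative - x * ?d x) (at x)" for x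
  proof -
    have "((\<lambda>x. c * exp (- x\<^sup>2 / 2)) has_real_derivative - x * (c * exp (- x\<^sup>2 / 2))) (at x)" for c
      by (auto intro!: derivative_eq_intros)
    then show ?thesis unfolding std_normal_density_def .
  qed
  have F: "((\<lambda>x. ?d x * u x) has_real_derivative (?d x * u' x - ?d x * (x * u x))) (at x)" for x
    by (auto intro!: derivative_eq_intros dd u simp: algebra_simps)
  have dcont: "isCont ?d x" for x using dd by (rule DERIV_isCont)
  have lim0: "(?d \<longlongrightarrow> 0) at_top" "(?d \<longlongrightarrow> 0) at_bot"
  proof -
    have *: "(?d \<longlongrightarrow> 0) F" if "filterlim (\<lambda>x::real. x\<^sup>2) at_top F" for F
    proof -
      have "filterlim (\<lambda>x::real. 1 / 2 * x\<^sup>2) at_top F"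
        by (rule filterlim_tendsto_pos_mult_at_top[OF tendsto_const _ that]) simp
      then have "filterlim (\<lambda>x::real. - (1 / 2 * x\<^sup>2)) at_bot F"
        by (simp add: filterlim_uminus_at_top)
      from tendsto_mult_right_zero[OF filterlim_compose[OF exp_at_bot this], of "1 / sqrt (2 * pi)"]
      show ?thesis by (simp add: std_normal_density_def[abs_def])
    qed
    show "(?d \<longlongrightarrow> 0) at_top" by (intro * filterlim_pow_at_top filterlim_ident) simp
    show "(?d \<longlongrightarrow> 0) at_bot" by (intro * filterlim_pow_at_bot_even filterlim_ident) auto
  qed
  have lim: "((\<lambda>x. ?d x * u x) \<longlongrightarrow> 0) F" if "(?d \<longlongrightarrow> 0) F" for F
  proof (rule tendsto_rabs_zero_cancel, rule tendsto_sandwich[OF _ _ tendsto_const])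
    show "((\<lambda>x. ?d x * C) \<longlongrightarrow> 0) F" using tendsto_mult_left_zero[OF that] by simp
    show "\<forall>\<^sub>F x in F. \<bar>?d x * u x\<bar> \<le> ?d x * C"
      by (intro always_eventually allI) (simp add: abs_mult mult_left_mono bdd)
  qed auto
  have "(LBINT x=-\<infinity>..\<infinity>. ?d x * u' x - ?d x * (x * u x)) = 0 - 0"
  proof (rule interval_integral_FTC_integrable[where F = "\<lambda>x. ?d x * u x"])
    show "((\<lambda>x. ?d x * u x) has_vector_derivative ?d x * u' x - ?d x * (x * u x)) (at x)" for x
      using F[of x] by (simp add: has_real_derivative_iff_has_vector_derivative)
    show "isCont (\<lambda>x. ?d x * u' x - ?d x * (x * u x)) x" for x
      by (intro continuous_intros u' dcont DERIV_isCont[OF u])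
    show "set_integrable lborel (einterval (- \<infinity>) \<infinity>) (\<lambda>x. ?d x * u' x - ?d x * (x * u x))"
      using i1 i2 by (simp add: set_integrable_def einterval_def)
    show "(((\<lambda>x. ?d x * u x) \<circ> real_of_ereal) \<longlongrightarrow> 0) (at_right (- \<infinity>))"
      "(((\<lambda>x. ?d x * u x) \<circ> real_of_ereal) \<longlongrightarrow> 0) (at_left \<infinity>)"
      unfolding ereal_tendsto_simps by (intro lim lim0)+
  qed auto
  then have "(\<integral>x. ?d x * u' x - ?d x * (x * u x) \<partial>lborel) = 0"
    by (simp add: interval_lebesgue_integral_def set_lebesgue_integral_def einterval_def)
  then show ?thesis using i1 i2 by (simp add: integral_gauss)
qed

lemma distr_gauss_shift:
  "distr gauss borel (\<lambda>x. x + v) = density gauss (\<lambda>x. ennreal (exp (v * x - v\<^sup>2 / 2)))"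
proof (rule measure_eqI)
  fix A assume "A \<in> sets (distr gauss borel (\<lambda>x. x + v))"
  then have A [measurable]: "A \<in> sets borel" by simp
  have "emeasure (distr gauss borel (\<lambda>x. x + v)) A = (\<integral>\<^sup>+x. indicator A (x + v) \<partial>gauss)"
    by (simp add: nn_integral_distr flip: nn_integral_indicator)
  also have "\<dots> = (\<integral>\<^sup>+x. ennreal (std_normal_density x) * indicator A (x + v) \<partial>lborel)"
    unfolding gauss_def by (subst nn_integral_density) auto
  also have "\<dots> = (\<integral>\<^sup>+x. ennreal (std_normal_density (x - v)) * indicator A x \<partial>lborel)"
    using nn_integral_real_affine[of "\<lambda>x. ennreal (std_normal_density (x - v)) * indicator A x" 1 v]
    by (simp add: add.commute)
  also have "\<dots> = (\<integral>\<^sup>+x. ennreal (std_normal_density x) * (ennreal (exp (v * x - v\<^sup>2 / 2)) * indicator A x) \<partial>lborel)"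
  proof (rule nn_integral_cong)
    fix x
    have "std_normal_density (x - v) = std_normal_density x * exp (v * x - v\<^sup>2 / 2)"
      by (simp add: std_normal_density_def power2_eq_square field_simps flip: exp_add)
    then show "ennreal (std_normal_density (x - v)) * indicator A x =
      ennreal (std_normal_density x) * (ennreal (exp (v * x - v\<^sup>2 / 2)) * indicator A x)"
      by (simp add: ennreal_mult mult.assoc)
  qed
  also have "\<dots> = (\<integral>\<^sup>+x. ennreal (exp (v * x - v\<^sup>2 / 2)) * indicator A x \<partial>gauss)"
    unfolding gauss_def by (subst nn_integral_density) auto
  also have "\<dots> = emeasure (density gauss (\<lambda>x. ennreal (exp (v * x - v\<^sup>2 / 2)))) A"
    by (subst emeasure_density) auto
  finally show "emeasure (distr gauss borel (\<lambda>x. x + v)) A =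
    emeasure (density gauss (\<lambda>x. ennreal (exp (v * x - v\<^sup>2 / 2)))) A" .
qed simp

abbreviation gauss_vec :: "'i set \<Rightarrow> ('i \<Rightarrow> real) measure" where
  "gauss_vec I \<equiv> PiM I (\<lambda>_. gauss)"

interpretation gauss: product_sigma_finite "\<lambda>_. gauss"
  by (rule product_sigma_finite.intro) (intro prob_space_imp_sigma_finite prob_space_gauss)

lemma prob_space_gauss_vec: "prob_space (gauss_vec I)"
  by (intro prob_space_PiM prob_space_gauss)

text \<open>The Cameron--Martin formula. Both sides are identified with the product of the shifted
  one-dimensional laws by evaluating them on boxes.\<close>

lemma distr_gauss_vec_shift:
  assumes I: "finite I"
  shows "distr (gauss_vec I) (gauss_vec I) (\<lambda>g. \<lambda>i\<in>I. g i + v i) =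
    density (gauss_vec I) (\<lambda>g. ennreal (exp (\<Sum>i\<in>I. v i * g i - (v i)\<^sup>2 / 2)))"
proof -
  let ?S = "\<lambda>g. \<lambda>i\<in>I. g i + v i"
  let ?d = "\<lambda>v x :: real. ennreal (exp (v * x - v\<^sup>2 / 2))"
  have S [measurable]: "?S \<in> measurable (gauss_vec I) (gauss_vec I)"
    by (rule measurable_restrict) simp
  have d_prod: "ennreal (exp (\<Sum>i\<in>I. v i * g i - (v i)\<^sup>2 / 2)) = (\<Prod>i\<in>I. ?d (v i) (g i))" for g
    using I by (simp add: exp_sum prod_ennreal)
  have box: "emeasure (distr (gauss_vec I) (gauss_vec I) ?S) (Pi\<^sub>E I A) =
      (\<Prod>i\<in>I. emeasure (distr gauss borel (\<lambda>x. x + v i)) (A i))"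
    if A: "\<And>i. i \<in> I \<Longrightarrow> A i \<in> sets borel" for A
  proof -
    have AI: "Pi\<^sub>E I A \<in> sets (gauss_vec I)" using A I by (intro sets_PiM_I_finite) auto
    have "?S -` Pi\<^sub>E I A \<inter> space (gauss_vec I) = Pi\<^sub>E I (\<lambda>i. (\<lambda>x. x + v i) -` A i)"
      by (auto simp: space_PiM PiE_iff extensional_def)
    then have "emeasure (distr (gauss_vec I) (gauss_vec I) ?S) (Pi\<^sub>E I A) =
        emeasure (gauss_vec I) (Pi\<^sub>E I (\<lambda>i. (\<lambda>x. x + v i) -` A i))"
      using AI by (subst emeasure_distr) auto
    also have "\<dots> = (\<Prod>i\<in>I. emeasure gauss ((\<lambda>x. x + v i) -` A i))"
    proof (rule gauss.emeasure_PiM[OF I])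
      fix i assume "i \<in> I"
      then have [measurable]: "A i \<in> sets borel" by (rule A)
      have "(\<lambda>x. x + v i) -` A i \<inter> space borel \<in> sets borel" by measurable
      then show "(\<lambda>x. x + v i) -` A i \<in> sets gauss" by simp
    qed
    also have "\<dots> = (\<Prod>i\<in>I. emeasure (distr gauss borel (\<lambda>x. x + v i)) (A i))"
      using A by (intro prod.cong refl) (subst emeasure_distr, auto)
    finally show ?thesis .
  qed
  interpret D: product_sigma_finite "\<lambda>i. distr gauss borel (\<lambda>x. x + v i)"
    by (rule product_sigma_finite.intro)
      (intro prob_space_imp_sigma_finite prob_space.prob_space_distr prob_space_gauss, simp)
  have sets_eq: "sets (gauss_vec I) = sets (PiM I (\<lambda>i. distr gauss borel (\<lambda>x. x + v i)))"
    by (intro sets_PiM_cong) auto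
  have "PiM I (\<lambda>i. distr gauss borel (\<lambda>x. x + v i)) = distr (gauss_vec I) (gauss_vec I) ?S"
    by (rule sym, rule D.PiM_eqI[OF I]) (use box sets_eq in auto)
  moreover have "PiM I (\<lambda>i. distr gauss borel (\<lambda>x. x + v i)) =
    density (gauss_vec I) (\<lambda>g. ennreal (exp (\<Sum>i\<in>I. v i * g i - (v i)\<^sup>2 / 2)))"
  proof (rule sym, rule D.PiM_eqI[OF I])
    fix A assume "\<And>i. i \<in> I \<Longrightarrow> A i \<in> sets (distr gauss borel (\<lambda>x. x + v i))"
    then have A: "\<And>i. i \<in> I \<Longrightarrow> A i \<in> sets borel" by simp
    have AI: "Pi\<^sub>E I A \<in> sets (gauss_vec I)" using A I by (intro sets_PiM_I_finite) auto
    have "emeasure (density (gauss_vec I) (\<lambda>g. ennreal (exp (\<Sum>i\<in>I. v i * g i - (v i)\<^sup>2 / 2)))) (Pi\<^sub>E I A)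
      = (\<integral>\<^sup>+g. (\<Prod>i\<in>I. ?d (v i) (g i)) * indicator (Pi\<^sub>E I A) g \<partial>gauss_vec I)"
      unfolding d_prod using AI by (subst emeasure_density) auto
    also have "\<dots> = (\<integral>\<^sup>+g. (\<Prod>i\<in>I. ?d (v i) (g i) * indicator (A i) (g i)) \<partial>gauss_vec I)"
    proof (rule nn_integral_cong)
      fix g assume "g \<in> space (gauss_vec I)"
      then have g: "g \<in> extensional I" by (auto simp: space_PiM PiE_iff)
      have "(indicator (Pi\<^sub>E I A) g :: ennreal) = (\<Prod>i\<in>I. indicator (A i) (g i))"
      proof (cases "g \<in> Pi\<^sub>E I A")
        case True
        then show ?thesis by (auto simp: PiE_iff indicator_def intro!: prod.neutral[symmetric])
      next
        case False
        then obtain i where "i \<in> I" "g i \<notin> A i" using g by (auto simp: PiE_iff)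
        then have "(\<Prod>i\<in>I. indicator (A i) (g i) :: ennreal) = 0"
          using I by (intro prod_zero) (auto simp: indicator_def)
        then show ?thesis using False by (simp add: indicator_def)
      qed
      then show "(\<Prod>i\<in>I. ?d (v i) (g i)) * indicator (Pi\<^sub>E I A) g =
        (\<Prod>i\<in>I. ?d (v i) (g i) * indicator (A i) (g i))"
        by (simp add: prod.distrib)
    qed
    also have "\<dots> = (\<Prod>i\<in>I. \<integral>\<^sup>+x. ?d (v i) x * indicator (A i) x \<partial>gauss)"
      using I A by (intro gauss.product_nn_integral_prod) auto
    also have "\<dots> = (\<Prod>i\<in>I. emeasure (distr gauss borel (\<lambda>x. x + v i)) (A i))"
      unfolding distr_gauss_shift using A by (intro prod.cong refl) (subst emeasure_density, auto)
    finally show "emeasure (density (gauss_vec I) (\<lambda>g. ennreal (exp (\<Sum>i\<in>I. v i * g i - (v i)\<^sup>2 / 2)))) (Pi\<^sub>E I A)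
      = (\<Prod>i\<in>I. emeasure (distr gauss borel (\<lambda>x. x + v i)) (A i))" .
  qed (use sets_eq in auto)
  ultimately show ?thesis by simp
qed

lemma integral_gauss_vec_shift:
  fixes \<phi> :: "('i \<Rightarrow> real) \<Rightarrow> real"
  assumes I: "finite I" and [measurable]: "\<phi> \<in> borel_measurable (gauss_vec I)"
  shows "(\<integral>g. \<phi> (\<lambda>i\<in>I. g i + v i) \<partial>gauss_vec I) =
    (\<integral>g. exp (\<Sum>i\<in>I. v i * g i - (v i)\<^sup>2 / 2) * \<phi> g \<partial>gauss_vec I)"
proof -
  have [measurable]: "(\<lambda>g. \<lambda>i\<in>I. g i + v i) \<in> measurable (gauss_vec I) (gauss_vec I)"
    by (rule measurable_restrict) simp
  have "(\<integral>g. \<phi> (\<lambda>i\<in>I. g i + v i) \<partial>gauss_vec I) =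
    (\<integral>g. \<phi> g \<partial>distr (gauss_vec I) (gauss_vec I) (\<lambda>g. \<lambda>i\<in>I. g i + v i))"
    by (subst integral_distr) auto
  also have "\<dots> = (\<integral>g. exp (\<Sum>i\<in>I. v i * g i - (v i)\<^sup>2 / 2) * \<phi> g \<partial>gauss_vec I)"
    unfolding distr_gauss_vec_shift[OF I] by (subst integral_density) auto
  finally show ?thesis .
qed

lemma gauss_vec_component:
  fixes f :: "real \<Rightarrow> real"
  assumes "i \<in> I" "f \<in> borel_measurable borel"
  shows "(\<integral>g. f (g i) \<partial>gauss_vec I) = (\<integral>x. f x \<partial>gauss)"
    and "integrable gauss f \<Longrightarrow> integrable (gauss_vec I) (\<lambda>g. f (g i))"
proof -
  have d: "distr (gauss_vec I) gauss (\<lambda>g. g i) = gauss"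
    using assms by (intro distr_PiM_component prob_space_gauss) auto
  show "(\<integral>g. f (g i) \<partial>gauss_vec I) = (\<integral>x. f x \<partial>gauss)"
    by (subst (2) d[symmetric], subst integral_distr) (use assms in auto)
  assume "integrable gauss f"
  then have "integrable (distr (gauss_vec I) gauss (\<lambda>g. g i)) f" by (simp add: d)
  then show "integrable (gauss_vec I) (\<lambda>g. f (g i))"
    by (subst (asm) integrable_distr_eq) (use assms in auto)
qed

section \<open>Differentiation under the integral sign\<close>

text \<open>By the mean value inequality the function \<open>D\<close> that dominates the
  derivatives near \<open>s0\<close> also dominates the difference quotients, and dominated
  convergence applies along every sequence tending to \<open>s0\<close>.\<close>

lemma has_real_derivative_integral:
  fixes F F' :: "real \<Rightarrow> 'a \<Rightarrow> real"
  assumes e: "e > 0"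
    and int: "\<And>s. \<bar>s - s0\<bar> < e \<Longrightarrow> integrable M (F s)"
    and D: "\<And>s x. \<bar>s - s0\<bar> < e \<Longrightarrow> x \<in> space M \<Longrightarrow> ((\<lambda>s. F s x) has_real_derivative F' s x) (at s)"
    and bound: "\<And>s x. \<bar>s - s0\<bar> < e \<Longrightarrow> x \<in> space M \<Longrightarrow> \<bar>F' s x\<bar> \<le> D x"
    and Dint: "integrable M D" and F': "F' s0 \<in> borel_measurable M"
  shows "((\<lambda>s. \<integral>x. F s x \<partial>M) has_real_derivative (\<integral>x. F' s0 x \<partial>M)) (at s0)"
proof -
  define U where "U = {s0 - e<..<s0 + e}"
  have U: "s \<in> U \<longleftrightarrow> \<bar>s - s0\<bar> < e" for s by (auto simp: U_def)
  have at: "at s0 within U = at s0" unfolding U_def using e by (intro at_within_open) auto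
  have "((\<lambda>s. ((\<integral>x. F s x \<partial>M) - (\<integral>x. F s0 x \<partial>M)) / (s - s0)) \<longlongrightarrow> (\<integral>x. F' s0 x \<partial>M)) (at s0 within U)"
    unfolding tendsto_at_iff_sequentially
  proof (intro allI impI)
    fix X assume X: "\<forall>i::nat. X i \<in> U - {s0}" and lim: "X \<longlonglongrightarrow> s0"
    let ?q = "\<lambda>i x. (F (X i) x - F s0 x) / (X i - s0)"
    have Xe: "\<bar>X i - s0\<bar> < e" "X i \<noteq> s0" for i using X U by auto
    have [measurable]: "F s \<in> borel_measurable M" if "\<bar>s - s0\<bar> < e" for s using int[OF that] by auto
    have "(\<lambda>i. \<integral>x. ?q i x \<partial>M) \<longlonglongrightarrow> (\<integral>x. F' s0 x \<partial>M)"
    proof (rule integral_dominated_convergence[OF F' _ Dint])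
      show "?q i \<in> borel_measurable M" for i using Xe(1)[of i] e by (intro borel_measurable_divide borel_measurable_diff) auto
      show "AE x in M. (\<lambda>i. ?q i x) \<longlonglongrightarrow> F' s0 x"
      proof (rule AE_I2)
        fix x assume x: "x \<in> space M"
        have "((\<lambda>s. (F s x - F s0 x) / (s - s0)) \<longlongrightarrow> F' s0 x) (at s0)"
          using D[of s0, OF _ x] e by (simp add: has_field_derivative_iff)
        then show "(\<lambda>i. ?q i x) \<longlonglongrightarrow> F' s0 x"
          unfolding tendsto_at_iff_sequentially using Xe(2) lim by (auto simp: comp_def)
      qed
      show "AE x in M. norm (?q i x) \<le> D x" for i
      proof (rule AE_I2)
        fix x assume x: "x \<in> space M"
        have "norm (F (X i) x - F s0 x) \<le> D x * norm (X i - s0)"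
        proof (rule field_differentiable_bound[of U "\<lambda>s. F s x" "\<lambda>s. F' s x"])
          show "convex U" by (simp add: U_def)
          show "((\<lambda>s. F s x) has_field_derivative F' s x) (at s within U)" if "s \<in> U" for s
            using D[of s x] that x U by (auto intro: has_field_derivative_at_within)
          show "norm (F' s x) \<le> D x" if "s \<in> U" for s using bound that x U by auto
        qed (use X e U in auto)
        then show "norm (?q i x) \<le> D x" using Xe(2)[of i] by (simp add: divide_le_eq)
      qed
    qed
    moreover have eq: "(\<integral>x. ?q i x \<partial>M) = ((\<integral>x. F (X i) x \<partial>M) - (\<integral>x. F s0 x \<partial>M)) / (X i - s0)" for i
      using int[OF Xe(1)[of i]] int[of s0] e Xe(2)[of i] by simp
    ultimately show "((\<lambda>s. ((\<integral>x. F s x \<partial>M) - (\<integral>x. F s0 x \<partial>M)) / (s - s0)) \<circ> X) \<longlonglongrightarrow> (\<integral>x. F' s0 x \<partial>M)"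
      unfolding comp_def eq[symmetric] by simp
  qed
  then show ?thesis by (simp add: has_field_derivative_iff at)
qed

section \<open>Gibbs averages\<close>

text \<open>Boundedness at every point, not only almost everywhere, is preserved by the algebraic
  operations and by \<open>exp\<close>, so that integrability of all Gibbs integrands becomes a
  matter of introduction rules.\<close>

definition bounded_meas :: "'a measure \<Rightarrow> ('a \<Rightarrow> real) \<Rightarrow> bool" where
  "bounded_meas M f \<longleftrightarrow> f \<in> borel_measurable M \<and> (\<exists>C. \<forall>x\<in>space M. \<bar>f x\<bar> \<le> C)"

lemma bounded_measI: "f \<in> borel_measurable M \<Longrightarrow> (\<And>x. x \<in> space M \<Longrightarrow> \<bar>f x\<bar> \<le> C) \<Longrightarrow> bounded_meas M f"
  by (auto simp: bounded_meas_def)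

lemma bounded_meas_measurable: "bounded_meas M f \<Longrightarrow> f \<in> borel_measurable M"
  by (simp add: bounded_meas_def)

lemma bounded_meas_const: "bounded_meas M (\<lambda>x. c)"
  by (auto simp: bounded_meas_def)

lemma bounded_meas_add:
  assumes "bounded_meas M f" "bounded_meas M g"
  shows "bounded_meas M (\<lambda>x. f x + g x)"
proof -
  from assms obtain A B where "\<forall>x\<in>space M. \<bar>f x\<bar> \<le> A" "\<forall>x\<in>space M. \<bar>g x\<bar> \<le> B"
    by (auto simp: bounded_meas_def)
  then show ?thesis using assms
    by (intro bounded_measI[of _ _ "A + B"]) (auto simp: bounded_meas_def intro: order_trans[OF abs_triangle_ineq add_mono])
qed

lemma bounded_meas_mult:
  assumes "bounded_meas M f" "bounded_meas M g"
  shows "bounded_meas M (\<lambda>x. f x * g x)"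
proof -
  from assms obtain A B where *: "\<forall>x\<in>space M. \<bar>f x\<bar> \<le> A" "\<forall>x\<in>space M. \<bar>g x\<bar> \<le> B"
    by (auto simp: bounded_meas_def)
  have "\<bar>f x * g x\<bar> \<le> A * B" if "x \<in> space M" for x
    unfolding abs_mult using * that by (intro mult_mono') auto
  then show ?thesis using assms
    by (intro bounded_measI[of _ _ "A * B"]) (auto simp: bounded_meas_def)
qed

lemma bounded_meas_cmult: "bounded_meas M f \<Longrightarrow> bounded_meas M (\<lambda>x. c * f x)"
  by (intro bounded_meas_mult bounded_meas_const)

lemma bounded_meas_diff: "bounded_meas M f \<Longrightarrow> bounded_meas M g \<Longrightarrow> bounded_meas M (\<lambda>x. f x - g x)"
  using bounded_meas_add[of M f "\<lambda>x. (-1) * g x"] bounded_meas_cmult[of M g "-1"] by simp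

lemma bounded_meas_sum:
  "(\<And>i. i \<in> I \<Longrightarrow> bounded_meas M (f i)) \<Longrightarrow> bounded_meas M (\<lambda>x. \<Sum>i\<in>I. f i x)"
  by (induction I rule: infinite_finite_induct) (auto intro: bounded_meas_add bounded_meas_const)

lemma bounded_meas_power: "bounded_meas M f \<Longrightarrow> bounded_meas M (\<lambda>x. f x ^ n)"
  by (induction n) (auto intro: bounded_meas_mult bounded_meas_const)

lemma bounded_meas_exp:
  assumes "bounded_meas M f"
  shows "bounded_meas M (\<lambda>x. exp (f x))"
proof -
  from assms obtain A where "\<forall>x\<in>space M. \<bar>f x\<bar> \<le> A" by (auto simp: bounded_meas_def)
  then show ?thesis using assms
    by (intro bounded_measI[of _ _ "exp A"]) (auto simp: bounded_meas_def abs_le_iff)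
qed

lemmas bounded_meas_intros = bounded_meas_const bounded_meas_add bounded_meas_mult bounded_meas_diff
  bounded_meas_sum bounded_meas_power bounded_meas_exp

definition pf :: "'a measure \<Rightarrow> ('a \<Rightarrow> real) \<Rightarrow> real" where
  "pf M B = (\<integral>x. exp (B x) \<partial>M)"

definition gibbs :: "'a measure \<Rightarrow> ('a \<Rightarrow> real) \<Rightarrow> ('a \<Rightarrow> real) \<Rightarrow> real" where
  "gibbs M B \<phi> = (\<integral>x. \<phi> x * exp (B x) \<partial>M) / pf M B"

context prob_space
begin

lemma bounded_meas_integrable: "bounded_meas M f \<Longrightarrow> integrable M f"
  unfolding bounded_meas_def by (metis (no_types, lifting) AE_I2 integrable_const_bound real_norm_def)

lemma pf_ge:
  assumes B: "bounded_meas M B" and c: "\<And>x. x \<in> space M \<Longrightarrow> c \<le> B x"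
  shows "exp c \<le> pf M B"
proof -
  have "(\<integral>x. exp c \<partial>M) \<le> (\<integral>x. exp (B x) \<partial>M)"
    using B c by (intro integral_mono bounded_meas_integrable bounded_meas_intros) auto
  then show ?thesis by (simp add: pf_def prob_space)
qed

lemma pf_pos: assumes B: "bounded_meas M B" shows "pf M B > 0"
proof -
  from B obtain C where "\<forall>x\<in>space M. \<bar>B x\<bar> \<le> C" by (auto simp: bounded_meas_def)
  then have "exp (- C) \<le> pf M B" by (intro pf_ge B) (auto simp: abs_le_iff minus_le_iff)
  then show ?thesis by (meson exp_gt_zero less_le_trans)
qed

lemma ln_pf_mono:
  assumes B: "bounded_meas M B" "bounded_meas M B'" and le: "\<And>x. x \<in> space M \<Longrightarrow> B x \<le> B' x + c"
  shows "ln (pf M B) \<le> ln (pf M B') + c"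
proof -
  have "pf M B \<le> (\<integral>x. exp c * exp (B' x) \<partial>M)"
    unfolding pf_def using B le
    by (intro integral_mono bounded_meas_integrable bounded_meas_intros) (auto simp: add.commute simp flip: exp_add)
  then have "pf M B \<le> exp c * pf M B'" by (simp add: pf_def)
  then have "ln (pf M B) \<le> ln (exp c * pf M B')" using pf_pos[OF B(1)] by simp
  also have "\<dots> = c + ln (pf M B')" using pf_pos[OF B(2)] by (simp add: ln_mult)
  finally show ?thesis by simp
qed

text \<open>A uniform change of the energy by \<open>c\<close> multiplies the partition function by
  a factor between \<open>exp (- c)\<close> and \<open>exp c\<close>. All Lipschitz bounds of free
  energies in the noise, the signal and the strengths reduce to pointwise bounds on energies in this
  way.\<close>

lemma ln_pf_lip:
  assumes B: "bounded_meas M B" "bounded_meas M B'" and le: "\<And>x. x \<in> space M \<Longrightarrow> \<bar>B x - B' x\<bar> \<le> c"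
  shows "\<bar>ln (pf M B) - ln (pf M B')\<bar> \<le> c"
proof -
  have "ln (pf M B) \<le> ln (pf M B') + c" "ln (pf M B') \<le> ln (pf M B) + c"
    using le by (intro ln_pf_mono B; fastforce simp: abs_le_iff)+
  then show ?thesis by linarith
qed

lemma ln_pf_abs_le:
  assumes "bounded_meas M B" "\<And>x. x \<in> space M \<Longrightarrow> \<bar>B x\<bar> \<le> c"
  shows "\<bar>ln (pf M B)\<bar> \<le> c"
  using ln_pf_lip[OF assms(1) bounded_meas_const, of 0 c] assms(2) by (simp add: pf_def prob_space)

lemma gibbs_add:
  assumes "bounded_meas M B" "bounded_meas M f" "bounded_meas M g"
  shows "gibbs M B (\<lambda>x. f x + g x) = gibbs M B f + gibbs M B g"
  using assms unfolding gibbs_def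
  by (simp add: distrib_right add_divide_distrib bounded_meas_integrable bounded_meas_intros)

lemma gibbs_cmult: "gibbs M B (\<lambda>x. c * f x) = c * gibbs M B f"
  by (simp add: gibbs_def mult.assoc)

lemma gibbs_diff:
  assumes "bounded_meas M B" "bounded_meas M f" "bounded_meas M g"
  shows "gibbs M B (\<lambda>x. f x - g x) = gibbs M B f - gibbs M B g"
  using assms unfolding gibbs_def
  by (simp add: left_diff_distrib diff_divide_distrib bounded_meas_integrable bounded_meas_intros)

lemma gibbs_sum:
  assumes "bounded_meas M B" "\<And>i. i \<in> I \<Longrightarrow> bounded_meas M (f i)"
  shows "gibbs M B (\<lambda>x. \<Sum>i\<in>I. f i x) = (\<Sum>i\<in>I. gibbs M B (f i))"
  using assms(2)
proof (induction I rule: infinite_finite_induct)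
  case (insert i I)
  then show ?case using assms(1) by (simp add: gibbs_add bounded_meas_sum)
qed (simp_all add: gibbs_def)

lemma gibbs_const: "bounded_meas M B \<Longrightarrow> gibbs M B (\<lambda>x. c) = c"
  using pf_pos[of B] by (simp add: gibbs_def pf_def)

lemma gibbs_mono:
  assumes "bounded_meas M B" "bounded_meas M f" "bounded_meas M g"
    "\<And>x. x \<in> space M \<Longrightarrow> f x \<le> g x"
  shows "gibbs M B f \<le> gibbs M B g"
  unfolding gibbs_def using assms pf_pos[OF assms(1)]
  by (intro divide_right_mono integral_mono bounded_meas_integrable bounded_meas_intros) auto

lemma gibbs_abs_le:
  assumes "bounded_meas M B" "bounded_meas M f" "\<And>x. x \<in> space M \<Longrightarrow> \<bar>f x\<bar> \<le> c"
  shows "\<bar>gibbs M B f\<bar> \<le> c"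
proof -
  have "gibbs M B f \<le> gibbs M B (\<lambda>x. c)" "gibbs M B (\<lambda>x. - c) \<le> gibbs M B f"
    using assms by (intro gibbs_mono bounded_meas_const; force simp: abs_le_iff)+
  then show ?thesis using assms(1) by (simp add: gibbs_const abs_le_iff)
qed

lemma gibbs_square:
  assumes B: "bounded_meas M B" and f: "bounded_meas M f"
  shows "(gibbs M B f)\<^sup>2 \<le> gibbs M B (\<lambda>x. (f x)\<^sup>2)"
proof -
  define m where "m = gibbs M B f"
  have "gibbs M B (\<lambda>x. 0) \<le> gibbs M B (\<lambda>x. (f x)\<^sup>2 - 2 * m * f x + m\<^sup>2)"
  proof (intro gibbs_mono B bounded_meas_intros f)
    fix x show "0 \<le> (f x)\<^sup>2 - 2 * m * f x + m\<^sup>2"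
      using zero_le_power2[of "f x - m"] by (simp add: power2_diff mult.commute mult.left_commute)
  qed
  then show ?thesis using B f
    by (simp add: gibbs_add gibbs_diff gibbs_cmult gibbs_const bounded_meas_intros m_def[symmetric] power2_eq_square)
qed

lemma has_real_derivative_exp_integral:
  fixes B B' :: "real \<Rightarrow> 'a \<Rightarrow> real"
  assumes e: "e > 0" and \<phi>: "bounded_meas M \<phi>"
    and B: "\<And>s. \<bar>s - s0\<bar> < e \<Longrightarrow> B s \<in> borel_measurable M" and B': "B' s0 \<in> borel_measurable M"
    and D: "\<And>s x. \<bar>s - s0\<bar> < e \<Longrightarrow> x \<in> space M \<Longrightarrow> ((\<lambda>s. B s x) has_real_derivative B' s x) (at s)"
    and bd: "\<And>s x. \<bar>s - s0\<bar> < e \<Longrightarrow> x \<in> space M \<Longrightarrow> \<bar>B s x\<bar> \<le> C"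
      "\<And>s x. \<bar>s - s0\<bar> < e \<Longrightarrow> x \<in> space M \<Longrightarrow> \<bar>B' s x\<bar> \<le> C"
  shows "((\<lambda>s. \<integral>x. \<phi> x * exp (B s x) \<partial>M) has_real_derivative
      (\<integral>x. \<phi> x * B' s0 x * exp (B s0 x) \<partial>M)) (at s0)"
proof -
  obtain A where A: "\<And>x. x \<in> space M \<Longrightarrow> \<bar>\<phi> x\<bar> \<le> A" using \<phi> by (auto simp: bounded_meas_def)
  have bm: "bounded_meas M (B s)" if "\<bar>s - s0\<bar> < e" for s
    using that by (intro bounded_measI[of _ _ C] B bd)
  show ?thesis
  proof (rule has_real_derivative_integral[OF e, where F = "\<lambda>s x. \<phi> x * exp (B s x)"
        and F' = "\<lambda>s x. \<phi> x * B' s x * exp (B s x)" and D = "\<lambda>_. A * C * exp C"])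
    show "integrable M (\<lambda>x. \<phi> x * exp (B s x))" if "\<bar>s - s0\<bar> < e" for s
      using bm[OF that] \<phi> by (intro bounded_meas_integrable bounded_meas_intros)
    show "((\<lambda>s. \<phi> x * exp (B s x)) has_real_derivative \<phi> x * B' s x * exp (B s x)) (at s)"
      if "\<bar>s - s0\<bar> < e" "x \<in> space M" for s x
      using D[OF that] by (auto intro!: derivative_eq_intros)
    show "\<bar>\<phi> x * B' s x * exp (B s x)\<bar> \<le> A * C * exp C" if "\<bar>s - s0\<bar> < e" "x \<in> space M" for s x
      unfolding abs_mult using bd[OF that] A[OF that(2)]
      by (intro mult_mono) (auto simp: abs_le_iff)
    show "(\<lambda>x. \<phi> x * B' s0 x * exp (B s0 x)) \<in> borel_measurable M"
      using B' B[of s0] \<phi> e by (auto simp: bounded_meas_def)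
  qed simp
qed

text \<open>Differentiating the quotient turns the derivative of a Gibbs average into the covariance
  of the observable with the derivative of the energy.\<close>

lemma
  fixes B B' :: "real \<Rightarrow> 'a \<Rightarrow> real"
  assumes e: "e > 0"
    and B: "\<And>s. \<bar>s - s0\<bar> < e \<Longrightarrow> B s \<in> borel_measurable M" and B': "B' s0 \<in> borel_measurable M"
    and D: "\<And>s x. \<bar>s - s0\<bar> < e \<Longrightarrow> x \<in> space M \<Longrightarrow> ((\<lambda>s. B s x) has_real_derivative B' s x) (at s)"
    and bd: "\<And>s x. \<bar>s - s0\<bar> < e \<Longrightarrow> x \<in> space M \<Longrightarrow> \<bar>B s x\<bar> \<le> C"
      "\<And>s x. \<bar>s - s0\<bar> < e \<Longrightarrow> x \<in> space M \<Longrightarrow> \<bar>B' s x\<bar> \<le> C"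
  shows ln_pf_has_derivative:
      "((\<lambda>s. ln (pf M (B s))) has_real_derivative gibbs M (B s0) (B' s0)) (at s0)"
    and gibbs_has_derivative:
      "bounded_meas M \<phi> \<Longrightarrow> ((\<lambda>s. gibbs M (B s) \<phi>) has_real_derivative
        gibbs M (B s0) (\<lambda>x. \<phi> x * B' s0 x) - gibbs M (B s0) \<phi> * gibbs M (B s0) (B' s0)) (at s0)"
proof -
  have bm: "bounded_meas M (B s0)" using e by (intro bounded_measI[of _ _ C] B bd) auto
  have pos: "pf M (B s0) > 0" by (rule pf_pos[OF bm])
  note d = has_real_derivative_exp_integral[of e, OF e _ B B' D bd]
  have dp: "((\<lambda>s. pf M (B s)) has_real_derivative (\<integral>x. B' s0 x * exp (B s0 x) \<partial>M)) (at s0)"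
    using d[OF bounded_meas_const[of M 1]] unfolding pf_def by simp
  show "((\<lambda>s. ln (pf M (B s))) has_real_derivative gibbs M (B s0) (B' s0)) (at s0)"
    using pos by (auto intro!: derivative_eq_intros dp simp: gibbs_def)
  assume \<phi>: "bounded_meas M \<phi>"
  show "((\<lambda>s. gibbs M (B s) \<phi>) has_real_derivative
        gibbs M (B s0) (\<lambda>x. \<phi> x * B' s0 x) - gibbs M (B s0) \<phi> * gibbs M (B s0) (B' s0)) (at s0)"
    unfolding gibbs_def
    by (rule DERIV_cong[OF DERIV_divide[OF d[OF \<phi>] dp]]) (use pos in \<open>auto simp: field_simps\<close>)
qed

end

section \<open>Gaussian interpolation\<close>

lemma (in pair_prob_space) distr_pair_snd: "distr (M1 \<Otimes>\<^sub>M M2) M2 snd = M2"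
proof (rule measure_eqI)
  fix X assume "X \<in> sets (distr (M1 \<Otimes>\<^sub>M M2) M2 snd)"
  then have X: "X \<in> sets M2" by simp
  have "snd -` X \<inter> space (M1 \<Otimes>\<^sub>M M2) = space M1 \<times> X"
    using sets.sets_into_space[OF X] by (auto simp: space_pair_measure)
  then show "emeasure (distr (M1 \<Otimes>\<^sub>M M2) M2 snd) X = emeasure M2 X"
    using X by (simp add: emeasure_distr M2.emeasure_pair_measure_Times M1.emeasure_space_1)
qed simp

lemma (in pair_prob_space) distr_pair_fst: "distr (M1 \<Otimes>\<^sub>M M2) M1 fst = M1"
proof (rule measure_eqI)
  fix X assume "X \<in> sets (distr (M1 \<Otimes>\<^sub>M M2) M1 fst)"
  then have X: "X \<in> sets M1" by simp
  have "fst -` X \<inter> space (M1 \<Otimes>\<^sub>M M2) = X \<times> space M2"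
    using sets.sets_into_space[OF X] by (auto simp: space_pair_measure)
  then show "emeasure (distr (M1 \<Otimes>\<^sub>M M2) M1 fst) X = emeasure M1 X"
    using X by (simp add: emeasure_distr M2.emeasure_pair_measure_Times M2.emeasure_space_1)
qed simp

text \<open>The log-likelihood of \<open>x\<close> when the features \<open>a i\<close> are seen
  through Gaussian channels of strength \<open>(v i)^2\<close>: the data are
  \<open>g i + v i * c i y\<close>, and \<open>b\<close> is a further tilt. The term
  \<open>- (a i x)^2 / 2\<close> is the normalisation of the Gaussian likelihood.\<close>

definition obs_energy :: "'i set \<Rightarrow> ('i \<Rightarrow> 'x \<Rightarrow> real) \<Rightarrow> ('i \<Rightarrow> 'y \<Rightarrow> real) \<Rightarrow> ('y \<Rightarrow> 'x \<Rightarrow> real) \<Rightarrow>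
    ('i \<Rightarrow> real) \<Rightarrow> 'y \<Rightarrow> ('i \<Rightarrow> real) \<Rightarrow> 'x \<Rightarrow> real" where
  "obs_energy I a c b v y g x =
     b y x + (\<Sum>i\<in>I. v i * (g i * a i x) + (v i)\<^sup>2 * (c i y * a i x - (a i x)\<^sup>2 / 2))"

text \<open>General enough for both interpolations: \<open>c = a\<close>, \<open>b = 0\<close> gives
  the planted model, while \<open>c = 0\<close> with the dependence on the signal moved into
  \<open>b\<close> gives the model whose error has the opposite sign. The derivative of the free
  energy is computed once for both.\<close>

locale gaussian_observation =
  Q: prob_space Q + nu: prob_space \<nu>
  for Q :: "'y measure" and \<nu> :: "'x measure" +
  fixes I :: "'i set" and a :: "'i \<Rightarrow> 'x \<Rightarrow> real" and c :: "'i \<Rightarrow> 'y \<Rightarrow> real"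
    and b :: "'y \<Rightarrow> 'x \<Rightarrow> real" and A :: real
  assumes fin: "finite I" and A0: "A \<ge> 0"
    and a_meas [measurable]: "\<And>i. a i \<in> borel_measurable \<nu>"
    and c_meas [measurable]: "\<And>i. c i \<in> borel_measurable Q"
    and b_meas [measurable]: "(\<lambda>p. b (fst p) (snd p)) \<in> borel_measurable (Q \<Otimes>\<^sub>M \<nu>)"
    and a_bound: "\<And>i x. x \<in> space \<nu> \<Longrightarrow> \<bar>a i x\<bar> \<le> A"
    and c_bound: "\<And>i y. y \<in> space Q \<Longrightarrow> \<bar>c i y\<bar> \<le> A"
    and b_bound: "\<And>y x. y \<in> space Q \<Longrightarrow> x \<in> space \<nu> \<Longrightarrow> \<bar>b y x\<bar> \<le> A"
begin

abbreviation "G \<equiv> gauss_vec I"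
abbreviation "H \<equiv> obs_energy I a c b"
abbreviation "L v y g \<equiv> ln (pf \<nu> (H v y g))"
abbreviation "m v y g \<equiv> gibbs \<nu> (H v y g)"

sublocale G: prob_space G by (rule prob_space_gauss_vec)
sublocale QG: pair_prob_space Q G ..

lemma bm_a: "bounded_meas \<nu> (a i)"
  by (rule bounded_measI[OF a_meas a_bound])

lemma H_meas [measurable]:
  "(\<lambda>p. H v (fst (fst p)) (snd (fst p)) (snd p)) \<in> borel_measurable ((Q \<Otimes>\<^sub>M G) \<Otimes>\<^sub>M \<nu>)"
proof -
  have [measurable]: "(\<lambda>p. b (fst (fst p)) (snd p)) \<in> borel_measurable ((Q \<Otimes>\<^sub>M G) \<Otimes>\<^sub>M \<nu>)"
    using measurable_compose[OF _ b_meas, of "\<lambda>p. (fst (fst p), snd p)" "(Q \<Otimes>\<^sub>M G) \<Otimes>\<^sub>M \<nu>"] by simp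
  show ?thesis unfolding obs_energy_def
    by (intro borel_measurable_add borel_measurable_sum) measurable
qed

lemma H_meas_x: "y \<in> space Q \<Longrightarrow> H v y g \<in> borel_measurable \<nu>"
proof -
  assume y: "y \<in> space Q"
  have [measurable]: "b y \<in> borel_measurable \<nu>"
    using measurable_compose[OF measurable_Pair1'[OF y] b_meas] by simp
  show ?thesis unfolding obs_energy_def by measurable
qed

definition Hbd :: "('i \<Rightarrow> real) \<Rightarrow> ('i \<Rightarrow> real) \<Rightarrow> real" where
  "Hbd v g = A + (\<Sum>i\<in>I. \<bar>v i\<bar> * (\<bar>g i\<bar> * A) + (v i)\<^sup>2 * (2 * A\<^sup>2))"

lemma quad_bound:
  assumes "y \<in> space Q" "x \<in> space \<nu>"
  shows "\<bar>c i y * a i x - (a i x)\<^sup>2 / 2\<bar> \<le> 2 * A\<^sup>2"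
proof -
  have "\<bar>c i y * a i x\<bar> \<le> A * A" unfolding abs_mult
    using assms a_bound c_bound A0 by (intro mult_mono) auto
  moreover have "(a i x)\<^sup>2 \<le> A\<^sup>2" using a_bound[OF assms(2)] A0 abs_le_square_iff[of "a i x" A] by simp
  moreover have "0 \<le> (a i x)\<^sup>2" by simp
  ultimately show ?thesis unfolding power2_eq_square[of A] abs_le_iff by linarith
qed

lemma term_bound:
  assumes "y \<in> space Q" "x \<in> space \<nu>"
  shows "\<bar>s * (r * a i x) + q * (c i y * a i x - (a i x)\<^sup>2 / 2)\<bar> \<le> \<bar>s\<bar> * (\<bar>r\<bar> * A) + \<bar>q\<bar> * (2 * A\<^sup>2)"
proof -
  have "\<bar>s * (r * a i x)\<bar> \<le> \<bar>s\<bar> * (\<bar>r\<bar> * A)" unfolding abs_mult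
    using assms a_bound by (intro mult_left_mono) auto
  moreover have "\<bar>q * (c i y * a i x - (a i x)\<^sup>2 / 2)\<bar> \<le> \<bar>q\<bar> * (2 * A\<^sup>2)" unfolding abs_mult
    using quad_bound[OF assms] by (intro mult_left_mono) auto
  ultimately show ?thesis by linarith
qed

lemma H_bound:
  assumes "y \<in> space Q" "x \<in> space \<nu>"
  shows "\<bar>H v y g x\<bar> \<le> Hbd v g"
proof -
  have "\<bar>\<Sum>i\<in>I. v i * (g i * a i x) + (v i)\<^sup>2 * (c i y * a i x - (a i x)\<^sup>2 / 2)\<bar> \<le>
     (\<Sum>i\<in>I. \<bar>v i\<bar> * (\<bar>g i\<bar> * A) + (v i)\<^sup>2 * (2 * A\<^sup>2))"
    using term_bound[OF assms] by (intro order_trans[OF sum_abs] sum_mono) (metis abs_power2)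
  then show ?thesis using b_bound[OF assms] unfolding obs_energy_def Hbd_def by linarith
qed

lemma bm_H: "y \<in> space Q \<Longrightarrow> bounded_meas \<nu> (H v y g)"
  by (rule bounded_measI[OF H_meas_x H_bound])

lemma pf_meas [measurable]: "(\<lambda>p. pf \<nu> (H v (fst p) (snd p))) \<in> borel_measurable (Q \<Otimes>\<^sub>M G)"
  unfolding pf_def by measurable

lemma m_meas [measurable]:
  assumes [measurable]: "\<phi> \<in> borel_measurable \<nu>"
  shows "(\<lambda>p. m v (fst p) (snd p) \<phi>) \<in> borel_measurable (Q \<Otimes>\<^sub>M G)"
  unfolding gibbs_def by measurable

lemma L_abs_le: "y \<in> space Q \<Longrightarrow> \<bar>L v y g\<bar> \<le> Hbd v g"
  by (rule nu.ln_pf_abs_le[OF bm_H H_bound])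

lemma G_comp_integrable: "i \<in> I \<Longrightarrow> integrable G (\<lambda>g. \<bar>g i\<bar>)"
  by (rule gauss_vec_component(2)[of i I "\<lambda>x. \<bar>x\<bar>"]) auto

lemma QG_comp_integrable: "i \<in> I \<Longrightarrow> integrable (Q \<Otimes>\<^sub>M G) (\<lambda>p. \<bar>snd p i\<bar>)"
proof -
  assume i: "i \<in> I"
  have "integrable (distr (Q \<Otimes>\<^sub>M G) G snd) (\<lambda>g. \<bar>g i\<bar>)"
    using G_comp_integrable[OF i] by (simp add: QG.distr_pair_snd)
  then show ?thesis using i by (subst (asm) integrable_distr_eq) auto
qed

lemma QG_comp_integral: "i \<in> I \<Longrightarrow> (\<integral>p. \<bar>snd p i\<bar> \<partial>(Q \<Otimes>\<^sub>M G)) = (\<integral>x. \<bar>x\<bar> \<partial>gauss)"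
proof -
  assume i: "i \<in> I"
  have "(\<integral>x. \<bar>x\<bar> \<partial>gauss) = (\<integral>g. \<bar>g i\<bar> \<partial>distr (Q \<Otimes>\<^sub>M G) G snd)"
    using gauss_vec_component(1)[OF i, of "\<lambda>x. \<bar>x\<bar>"] by (simp add: QG.distr_pair_snd)
  also have "\<dots> = (\<integral>p. \<bar>snd p i\<bar> \<partial>(Q \<Otimes>\<^sub>M G))" using i by (subst integral_distr) auto
  finally show ?thesis by simp
qed

lemma QG_lin_integrable: "integrable (Q \<Otimes>\<^sub>M G) (\<lambda>p. C + (\<Sum>i\<in>I. d i * \<bar>snd p i\<bar>))"
  by (intro Bochner_Integration.integrable_add Bochner_Integration.integrable_sum integrable_mult_right QG_comp_integrable) auto

lemma L_integrable: "integrable (Q \<Otimes>\<^sub>M G) (\<lambda>p. L v (fst p) (snd p))"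
proof (rule Bochner_Integration.integrable_bound[OF QG_lin_integrable])
  show "AE p in Q \<Otimes>\<^sub>M G. norm (L v (fst p) (snd p)) \<le>
    norm ((A + (\<Sum>i\<in>I. (v i)\<^sup>2 * (2 * A\<^sup>2))) + (\<Sum>i\<in>I. (\<bar>v i\<bar> * A) * \<bar>snd p i\<bar>))"
  proof (rule AE_I2)
    fix p assume "p \<in> space (Q \<Otimes>\<^sub>M G)"
    then have "\<bar>L v (fst p) (snd p)\<bar> \<le> Hbd v (snd p)" by (intro L_abs_le) (auto simp: space_pair_measure)
    also have "\<dots> = (A + (\<Sum>i\<in>I. (v i)\<^sup>2 * (2 * A\<^sup>2))) + (\<Sum>i\<in>I. (\<bar>v i\<bar> * A) * \<bar>snd p i\<bar>)"
      unfolding Hbd_def by (simp add: sum.distrib algebra_simps)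
    finally show "norm (L v (fst p) (snd p)) \<le>
      norm ((A + (\<Sum>i\<in>I. (v i)\<^sup>2 * (2 * A\<^sup>2))) + (\<Sum>i\<in>I. (\<bar>v i\<bar> * A) * \<bar>snd p i\<bar>))" by simp
  qed
qed measurable

lemma m_abs_le: "y \<in> space Q \<Longrightarrow> bounded_meas \<nu> \<phi> \<Longrightarrow> (\<And>x. x \<in> space \<nu> \<Longrightarrow> \<bar>\<phi> x\<bar> \<le> C) \<Longrightarrow> \<bar>m v y g \<phi>\<bar> \<le> C"
  by (rule nu.gibbs_abs_le[OF bm_H])

lemma a2_bound: "x \<in> space \<nu> \<Longrightarrow> \<bar>(a i x)\<^sup>2\<bar> \<le> A\<^sup>2"
  using a_bound[of x i] A0 by (simp add: power2_le_iff_abs_le)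

lemma m_integrable:
  assumes "bounded_meas \<nu> \<phi>" "\<And>x. x \<in> space \<nu> \<Longrightarrow> \<bar>\<phi> x\<bar> \<le> C"
  shows "integrable (Q \<Otimes>\<^sub>M G) (\<lambda>p. m v (fst p) (snd p) \<phi>)"
    "integrable (Q \<Otimes>\<^sub>M G) (\<lambda>p. (m v (fst p) (snd p) \<phi>)\<^sup>2)"
    "integrable (Q \<Otimes>\<^sub>M G) (\<lambda>p. c i (fst p) * m v (fst p) (snd p) \<phi>)"
    "i \<in> I \<Longrightarrow> integrable (Q \<Otimes>\<^sub>M G) (\<lambda>p. snd p i * m v (fst p) (snd p) \<phi>)"
proof -
  have [measurable]: "\<phi> \<in> borel_measurable \<nu>" using assms(1) by (rule bounded_meas_measurable)
  have bd: "\<bar>m v (fst p) (snd p) \<phi>\<bar> \<le> C" "\<bar>c i (fst p)\<bar> \<le> A" if "p \<in> space (Q \<Otimes>\<^sub>M G)" for p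
    using that assms by (auto simp: space_pair_measure intro: m_abs_le c_bound)
  have C0: "C \<ge> 0" using assms(2) nu.not_empty by force
  show "integrable (Q \<Otimes>\<^sub>M G) (\<lambda>p. m v (fst p) (snd p) \<phi>)"
    by (rule QG.P.integrable_const_bound[of _ C]) (use bd in \<open>auto intro!: AE_I2\<close>)
  show "integrable (Q \<Otimes>\<^sub>M G) (\<lambda>p. (m v (fst p) (snd p) \<phi>)\<^sup>2)"
    by (rule QG.P.integrable_const_bound[of _ "C\<^sup>2"])
      (use bd C0 in \<open>auto intro!: AE_I2 simp: power2_le_iff_abs_le\<close>)
  show "integrable (Q \<Otimes>\<^sub>M G) (\<lambda>p. c i (fst p) * m v (fst p) (snd p) \<phi>)"
    by (rule QG.P.integrable_const_bound[of _ "A * C"])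
      (use bd A0 C0 in \<open>auto intro!: AE_I2 mult_mono simp: abs_mult\<close>)
  assume i: "i \<in> I"
  show "integrable (Q \<Otimes>\<^sub>M G) (\<lambda>p. snd p i * m v (fst p) (snd p) \<phi>)"
  proof (rule Bochner_Integration.integrable_bound)
    show "integrable (Q \<Otimes>\<^sub>M G) (\<lambda>p. C * \<bar>snd p i\<bar>)"
      by (intro integrable_mult_right QG_comp_integrable i)
    show "AE p in Q \<Otimes>\<^sub>M G. norm (snd p i * m v (fst p) (snd p) \<phi>) \<le> norm (C * \<bar>snd p i\<bar>)"
      using bd C0 by (intro AE_I2) (auto simp: abs_mult mult.commute[of C] intro!: mult_left_mono)
  qed (use i in measurable)
qed

text \<open>Along the \<open>i\<close>-th Gaussian coordinate the derivative of the Gibbs average of \<open>a\<^sub>i\<close> is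
  \<open>v\<^sub>i\<close> times its Gibbs variance.\<close>

lemma gibbs_integral_by_parts:
  assumes y: "y \<in> space Q" and i: "i \<in> I"
  shows "(\<integral>g. g i * m v y g (a i) \<partial>G) =
    v i * (\<integral>g. m v y g (\<lambda>x. (a i x)\<^sup>2) - (m v y g (a i))\<^sup>2 \<partial>G)"
proof -
  define J where "J = I - {i}"
  have J: "finite J" "i \<notin> J" "I = insert i J" using fin i by (auto simp: J_def)
  have sec [measurable]: "(\<lambda>g. m v y g \<phi>) \<in> borel_measurable G" if "\<phi> \<in> borel_measurable \<nu>" for \<phi>
    using measurable_compose[OF measurable_Pair1'[OF y] m_meas[OF that]] by simp
  have bma2: "bounded_meas \<nu> (\<lambda>x. (a i x)\<^sup>2)" by (intro bounded_meas_power bm_a)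
  have m1: "\<bar>m v y g (a i)\<bar> \<le> A" for g by (rule m_abs_le[OF y bm_a a_bound])
  have m2: "\<bar>m v y g (\<lambda>x. (a i x)\<^sup>2)\<bar> \<le> A\<^sup>2" for g by (rule m_abs_le[OF y bma2 a2_bound])
  have m3: "\<bar>(m v y g (a i))\<^sup>2\<bar> \<le> A\<^sup>2" for g using m1[of g] A0 by (simp add: power2_le_iff_abs_le)
  have m4: "\<bar>m v y g (\<lambda>x. (a i x)\<^sup>2) - (m v y g (a i))\<^sup>2\<bar> \<le> 2 * A\<^sup>2" for g
    using m2[of g] m3[of g] by linarith
  have int1: "integrable G (\<lambda>g. g i * m v y g (a i))"
  proof (rule Bochner_Integration.integrable_bound)
    show "integrable G (\<lambda>g. A * \<bar>g i\<bar>)" by (intro integrable_mult_right G_comp_integrable i)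
    show "AE g in G. norm (g i * m v y g (a i)) \<le> norm (A * \<bar>g i\<bar>)"
      using m1 A0 by (intro AE_I2) (auto simp: abs_mult mult.commute[of A] intro!: mult_left_mono)
  qed (use i in measurable)
  have int2: "integrable G (\<lambda>g. v i * (m v y g (\<lambda>x. (a i x)\<^sup>2) - (m v y g (a i))\<^sup>2))"
  proof (intro integrable_mult_right G.integrable_const_bound[of _ "2 * A\<^sup>2"] AE_I2)
    show "norm (m v y g (\<lambda>x. (a i x)\<^sup>2) - (m v y g (a i))\<^sup>2) \<le> 2 * A\<^sup>2" for g
      using m4[of g] by simp
  qed measurable
  have "(\<integral>w. w * m v y (g(i := w)) (a i) \<partial>gauss) =
      (\<integral>w. v i * (m v y (g(i := w)) (\<lambda>x. (a i x)\<^sup>2) - (m v y (g(i := w)) (a i))\<^sup>2) \<partial>gauss)" for g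
  proof -
    let ?B = "\<lambda>w. H v y (g(i := w))"
    define B0 where "B0 = ?B 0"
    have B_eq: "?B w x = B0 x + w * (v i * a i x)" for w x
      unfolding B0_def obs_energy_def J(3) using J(1,2)
      by (simp add: sum.distrib algebra_simps cong: sum.cong)
        (rule sum.cong, auto)
    have der: "((\<lambda>w. gibbs \<nu> (?B w) \<phi>) has_real_derivative
        v i * (gibbs \<nu> (?B w) (\<lambda>x. \<phi> x * a i x) - gibbs \<nu> (?B w) \<phi> * gibbs \<nu> (?B w) (a i))) (at w)"
      if \<phi>: "bounded_meas \<nu> \<phi>" for w \<phi>
    proof -
      have bd1: "\<bar>?B w' x\<bar> \<le> Hbd v (g(i := 0)) + (\<bar>w\<bar> + 1) * (\<bar>v i\<bar> * A) + \<bar>v i\<bar> * A"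
        if "\<bar>w' - w\<bar> < 1" "x \<in> space \<nu>" for w' x
      proof -
        have "\<bar>w' * (v i * a i x)\<bar> \<le> (\<bar>w\<bar> + 1) * (\<bar>v i\<bar> * A)" unfolding abs_mult
          using that a_bound A0 by (intro mult_mono) auto
        moreover have "0 \<le> \<bar>v i\<bar> * A" using A0 by simp
        ultimately show ?thesis using H_bound[OF y that(2), of v "g(i := 0)", folded B0_def]
          unfolding B_eq[of w'] by linarith
      qed
      have bd2: "\<bar>v i * a i x\<bar> \<le> Hbd v (g(i := 0)) + (\<bar>w\<bar> + 1) * (\<bar>v i\<bar> * A) + \<bar>v i\<bar> * A"
        if "x \<in> space \<nu>" for x
      proof -
        have "\<bar>v i * a i x\<bar> \<le> \<bar>v i\<bar> * A" unfolding abs_mult using that a_bound by (intro mult_left_mono) auto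
        moreover have "0 \<le> (\<bar>w\<bar> + 1) * (\<bar>v i\<bar> * A)" using A0 by simp
        moreover have "0 \<le> Hbd v (g(i := 0))" using H_bound[OF y that, of v "g(i := 0)"] by linarith
        ultimately show ?thesis by linarith
      qed
      have "((\<lambda>w. gibbs \<nu> (?B w) \<phi>) has_real_derivative
          gibbs \<nu> (?B w) (\<lambda>x. \<phi> x * (v i * a i x)) - gibbs \<nu> (?B w) \<phi> * gibbs \<nu> (?B w) (\<lambda>x. v i * a i x)) (at w)"
      proof (rule nu.gibbs_has_derivative[where e = 1 and B' = "\<lambda>w x. v i * a i x", OF _ _ _ _ bd1 bd2 \<phi>])
        show "((\<lambda>w. ?B w x) has_real_derivative v i * a i x) (at s)" for s x
          unfolding B_eq by (auto intro!: derivative_eq_intros)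
      qed (auto intro: H_meas_x y)
      moreover have "gibbs \<nu> (?B w) (\<lambda>x. \<phi> x * (v i * a i x)) = v i * gibbs \<nu> (?B w) (\<lambda>x. \<phi> x * a i x)"
        unfolding nu.gibbs_cmult[symmetric] by (simp only: mult.left_commute)
      moreover have "gibbs \<nu> (?B w) (\<lambda>x. v i * a i x) = v i * gibbs \<nu> (?B w) (a i)"
        by (rule nu.gibbs_cmult)
      ultimately show ?thesis by (simp only: right_diff_distrib mult.left_commute)
    qed
    let ?u' = "\<lambda>w. v i * (gibbs \<nu> (?B w) (\<lambda>x. (a i x)\<^sup>2) - (gibbs \<nu> (?B w) (a i))\<^sup>2)"
    show ?thesis
    proof (rule gauss_integral_by_parts[where C = "A + \<bar>v i\<bar> * (2 * A\<^sup>2)"])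
      show "((\<lambda>w. m v y (g(i := w)) (a i)) has_real_derivative ?u' w) (at w)" for w
        using der[OF bm_a, of i w] by (simp add: power2_eq_square)
      show "isCont ?u' w" for w
        by (intro continuous_intros DERIV_isCont[OF der] bm_a bma2)
      show "\<bar>m v y (g(i := w)) (a i)\<bar> \<le> A + \<bar>v i\<bar> * (2 * A\<^sup>2)" for w
        using m1[of "g(i := w)"] by (simp add: add_increasing2)
      have "\<bar>?u' w\<bar> \<le> \<bar>v i\<bar> * (2 * A\<^sup>2)" for w
        unfolding abs_mult using m4[of "g(i := w)"] by (intro mult_left_mono) auto
      then show "\<bar>?u' w\<bar> \<le> A + \<bar>v i\<bar> * (2 * A\<^sup>2)" for w
        using A0 by (meson add_increasing)
    qed
  qed
  then have "(\<integral>g. g i * m v y g (a i) \<partial>G) =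
    (\<integral>g. v i * (m v y g (\<lambda>x. (a i x)\<^sup>2) - (m v y g (a i))\<^sup>2) \<partial>G)"
    using gauss.product_integral_insert[OF J(1,2), of "\<lambda>g. g i * m v y g (a i)"] int1
      gauss.product_integral_insert[OF J(1,2), of "\<lambda>g. v i * (m v y g (\<lambda>x. (a i x)\<^sup>2) - (m v y g (a i))\<^sup>2)"] int2
    unfolding J(3)[symmetric] by auto
  then show ?thesis by simp
qed

end

context gaussian_observation
begin

definition free_energy :: "('i \<Rightarrow> real) \<Rightarrow> real" where
  "free_energy v = (\<integral>p. L v (fst p) (snd p) \<partial>(Q \<Otimes>\<^sub>M G))"

lemma L_lip:
  assumes y: "y \<in> space Q"
  shows "\<bar>L v y g - L w y g\<bar> \<le> (\<Sum>i\<in>I. \<bar>v i - w i\<bar> * (\<bar>g i\<bar> * A) + \<bar>(v i)\<^sup>2 - (w i)\<^sup>2\<bar> * (2 * A\<^sup>2))"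
proof (rule nu.ln_pf_lip[OF bm_H[OF y] bm_H[OF y]])
  fix x assume x: "x \<in> space \<nu>"
  have "H v y g x - H w y g x =
    (\<Sum>i\<in>I. (v i - w i) * (g i * a i x) + ((v i)\<^sup>2 - (w i)\<^sup>2) * (c i y * a i x - (a i x)\<^sup>2 / 2))"
    unfolding obs_energy_def by (simp add: left_diff_distrib sum.distrib sum_subtractf)
  then show "\<bar>H v y g x - H w y g x\<bar> \<le>
    (\<Sum>i\<in>I. \<bar>v i - w i\<bar> * (\<bar>g i\<bar> * A) + \<bar>(v i)\<^sup>2 - (w i)\<^sup>2\<bar> * (2 * A\<^sup>2))"
    using term_bound[OF y x] by (auto intro!: order_trans[OF sum_abs] sum_mono)
qed

lemma free_energy_lip:
  "\<bar>free_energy v - free_energy w\<bar> \<le>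
    (\<Sum>i\<in>I. \<bar>v i - w i\<bar> * (A * (\<integral>x. \<bar>x\<bar> \<partial>gauss)) + \<bar>(v i)\<^sup>2 - (w i)\<^sup>2\<bar> * (2 * A\<^sup>2))"
proof -
  let ?r = "\<lambda>p. \<Sum>i\<in>I. \<bar>v i - w i\<bar> * (\<bar>snd p i\<bar> * A) + \<bar>(v i)\<^sup>2 - (w i)\<^sup>2\<bar> * (2 * A\<^sup>2)"
  have "\<bar>free_energy v - free_energy w\<bar> = \<bar>\<integral>p. L v (fst p) (snd p) - L w (fst p) (snd p) \<partial>(Q \<Otimes>\<^sub>M G)\<bar>"
    unfolding free_energy_def by (subst Bochner_Integration.integral_diff) (auto intro: L_integrable)
  also have "\<dots> \<le> (\<integral>p. \<bar>L v (fst p) (snd p) - L w (fst p) (snd p)\<bar> \<partial>(Q \<Otimes>\<^sub>M G))"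
    using integral_abs_bound by blast
  also have "\<dots> \<le> (\<integral>p. ?r p \<partial>(Q \<Otimes>\<^sub>M G))"
  proof (rule integral_mono)
    show "integrable (Q \<Otimes>\<^sub>M G) (\<lambda>p. \<bar>L v (fst p) (snd p) - L w (fst p) (snd p)\<bar>)"
      by (intro integrable_abs Bochner_Integration.integrable_diff L_integrable)
    show "integrable (Q \<Otimes>\<^sub>M G) ?r"
      by (intro Bochner_Integration.integrable_sum Bochner_Integration.integrable_add integrable_mult_right
          integrable_mult_left QG_comp_integrable) auto
    show "\<bar>L v (fst p) (snd p) - L w (fst p) (snd p)\<bar> \<le> ?r p" if "p \<in> space (Q \<Otimes>\<^sub>M G)" for p
      using that by (intro L_lip) (auto simp: space_pair_measure)
  qed
  also have "\<dots> = (\<Sum>i\<in>I. \<integral>p. \<bar>v i - w i\<bar> * (\<bar>snd p i\<bar> * A) + \<bar>(v i)\<^sup>2 - (w i)\<^sup>2\<bar> * (2 * A\<^sup>2) \<partial>(Q \<Otimes>\<^sub>M G))"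
    by (intro Bochner_Integration.integral_sum Bochner_Integration.integrable_add integrable_mult_right
          integrable_mult_left QG_comp_integrable) auto
  also have "\<dots> = (\<Sum>i\<in>I. \<bar>v i - w i\<bar> * (A * (\<integral>x. \<bar>x\<bar> \<partial>gauss)) + \<bar>(v i)\<^sup>2 - (w i)\<^sup>2\<bar> * (2 * A\<^sup>2))"
  proof (rule sum.cong[OF refl])
    fix i assume i: "i \<in> I"
    have "(\<integral>p. \<bar>v i - w i\<bar> * (\<bar>snd p i\<bar> * A) + \<bar>(v i)\<^sup>2 - (w i)\<^sup>2\<bar> * (2 * A\<^sup>2) \<partial>(Q \<Otimes>\<^sub>M G)) =
      \<bar>v i - w i\<bar> * ((\<integral>p. \<bar>snd p i\<bar> \<partial>(Q \<Otimes>\<^sub>M G)) * A) + \<bar>(v i)\<^sup>2 - (w i)\<^sup>2\<bar> * (2 * A\<^sup>2)"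
      by (subst Bochner_Integration.integral_add)
        (auto intro!: integrable_mult_right integrable_mult_left QG_comp_integrable i simp: QG.P.prob_space)
    then show "(\<integral>p. \<bar>v i - w i\<bar> * (\<bar>snd p i\<bar> * A) + \<bar>(v i)\<^sup>2 - (w i)\<^sup>2\<bar> * (2 * A\<^sup>2) \<partial>(Q \<Otimes>\<^sub>M G)) =
      \<bar>v i - w i\<bar> * (A * (\<integral>x. \<bar>x\<bar> \<partial>gauss)) + \<bar>(v i)\<^sup>2 - (w i)\<^sup>2\<bar> * (2 * A\<^sup>2)"
      using i by (simp add: QG_comp_integral mult.commute)
  qed
  finally show ?thesis .
qed

text \<open>The square root paths used later may fail to be differentiable at an end of the
  interval; there the mean value theorem relies on continuity, which comes from the Lipschitz
  estimate.\<close>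

lemma free_energy_continuous:
  fixes \<sigma> :: "'i \<Rightarrow> real \<Rightarrow> real"
  assumes \<sigma>: "\<And>i. i \<in> I \<Longrightarrow> continuous_on S (\<sigma> i)"
  shows "continuous_on S (\<lambda>s. free_energy (\<lambda>i. \<sigma> i s))"
  unfolding continuous_on_def
proof
  fix s assume s: "s \<in> S"
  let ?R = "\<lambda>u. \<Sum>i\<in>I. \<bar>\<sigma> i u - \<sigma> i s\<bar> * (A * (\<integral>x. \<bar>x\<bar> \<partial>gauss)) + \<bar>(\<sigma> i u)\<^sup>2 - (\<sigma> i s)\<^sup>2\<bar> * (2 * A\<^sup>2)"
  have "(?R \<longlongrightarrow> (\<Sum>i\<in>I. \<bar>\<sigma> i s - \<sigma> i s\<bar> * (A * (\<integral>x. \<bar>x\<bar> \<partial>gauss)) + \<bar>(\<sigma> i s)\<^sup>2 - (\<sigma> i s)\<^sup>2\<bar> * (2 * A\<^sup>2))) (at s within S)"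
    using \<sigma> s by (intro tendsto_intros) (auto simp: continuous_on_def)
  then have R: "(?R \<longlongrightarrow> 0) (at s within S)" by simp
  have "((\<lambda>u. free_energy (\<lambda>i. \<sigma> i u) - free_energy (\<lambda>i. \<sigma> i s)) \<longlongrightarrow> 0) (at s within S)"
    by (rule Lim_null_comparison[OF _ R]) (auto simp: free_energy_lip)
  then show "((\<lambda>s. free_energy (\<lambda>i. \<sigma> i s)) \<longlongrightarrow> free_energy (\<lambda>i. \<sigma> i s)) (at s within S)"
    by (rule Lim_null[THEN iffD2])
qed

definition dH :: "('i \<Rightarrow> real) \<Rightarrow> ('i \<Rightarrow> real) \<Rightarrow> 'y \<Rightarrow> ('i \<Rightarrow> real) \<Rightarrow> 'x \<Rightarrow> real" where
  "dH v v' y g x = (\<Sum>i\<in>I. v' i * (g i * a i x) + 2 * v i * v' i * (c i y * a i x - (a i x)\<^sup>2 / 2))"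

lemma gibbs_dH:
  assumes y: "y \<in> space Q"
  shows "m v y g (dH v v' y g) = (\<Sum>i\<in>I. v' i * (g i * m v y g (a i)) +
    2 * v i * v' i * (c i y * m v y g (a i) - m v y g (\<lambda>x. (a i x)\<^sup>2) / 2))"
proof -
  have e: "dH v v' y g = (\<lambda>x. \<Sum>i\<in>I. (v' i * g i + 2 * v i * v' i * c i y) * a i x - (v i * v' i) * (a i x)\<^sup>2)"
    unfolding dH_def by (intro ext sum.cong) (auto simp: algebra_simps)
  have "m v y g (dH v v' y g) = (\<Sum>i\<in>I. m v y g (\<lambda>x. (v' i * g i + 2 * v i * v' i * c i y) * a i x - (v i * v' i) * (a i x)\<^sup>2))"
    unfolding e by (intro nu.gibbs_sum bm_H[OF y] bounded_meas_intros bm_a)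
  also have "\<dots> = (\<Sum>i\<in>I. (v' i * g i + 2 * v i * v' i * c i y) * m v y g (a i) - (v i * v' i) * m v y g (\<lambda>x. (a i x)\<^sup>2))"
    by (subst nu.gibbs_diff) (auto intro!: bm_H[OF y] bounded_meas_intros bm_a simp: nu.gibbs_cmult)
  also have "\<dots> = (\<Sum>i\<in>I. v' i * (g i * m v y g (a i)) +
    2 * v i * v' i * (c i y * m v y g (a i) - m v y g (\<lambda>x. (a i x)\<^sup>2) / 2))"
    by (intro sum.cong) (auto simp: algebra_simps)
  finally show ?thesis .
qed

lemma integral_component_gibbs:
  assumes i: "i \<in> I"
  shows "(\<integral>p. snd p i * m v (fst p) (snd p) (a i) \<partial>(Q \<Otimes>\<^sub>M G)) =
    v i * (\<integral>p. m v (fst p) (snd p) (\<lambda>x. (a i x)\<^sup>2) - (m v (fst p) (snd p) (a i))\<^sup>2 \<partial>(Q \<Otimes>\<^sub>M G))"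
proof -
  have bma2: "bounded_meas \<nu> (\<lambda>x. (a i x)\<^sup>2)" by (intro bounded_meas_power bm_a)
  have i1: "integrable (Q \<Otimes>\<^sub>M G) (\<lambda>p. snd p i * m v (fst p) (snd p) (a i))"
    by (rule m_integrable(4)[OF bm_a a_bound i])
  have i2: "integrable (Q \<Otimes>\<^sub>M G) (\<lambda>p. v i * (m v (fst p) (snd p) (\<lambda>x. (a i x)\<^sup>2) - (m v (fst p) (snd p) (a i))\<^sup>2))"
    by (intro integrable_mult_right Bochner_Integration.integrable_diff
        m_integrable(1)[OF bma2 a2_bound] m_integrable(2)[OF bm_a a_bound])
  have "(\<integral>p. snd p i * m v (fst p) (snd p) (a i) \<partial>(Q \<Otimes>\<^sub>M G)) =
      (\<integral>y. \<integral>g. g i * m v y g (a i) \<partial>G \<partial>Q)"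
    using QG.integral_fst'[OF i1] by simp
  also have "\<dots> = (\<integral>y. \<integral>g. v i * (m v y g (\<lambda>x. (a i x)\<^sup>2) - (m v y g (a i))\<^sup>2) \<partial>G \<partial>Q)"
    by (rule Bochner_Integration.integral_cong[OF refl]) (simp add: gibbs_integral_by_parts[OF _ i])
  also have "\<dots> = (\<integral>p. v i * (m v (fst p) (snd p) (\<lambda>x. (a i x)\<^sup>2) - (m v (fst p) (snd p) (a i))\<^sup>2) \<partial>(Q \<Otimes>\<^sub>M G))"
    using QG.integral_fst'[OF i2] by simp
  finally show ?thesis by simp
qed

text \<open>Write \<open><.>\<close> for the Gibbs average. Integration by parts turns the mean of
  \<open>\<sigma>' i * g i * <a i>\<close> into \<open>\<sigma> i * \<sigma>' i\<close> times the
  mean Gibbs variance of \<open>a i\<close>. Its second moment cancels against the normalisation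
  term \<open>- (a i)^2 / 2\<close>, and only \<open>2 * c i * <a i> - <a i>^2\<close> is
  left.\<close>

lemma free_energy_has_derivative:
  fixes \<sigma> \<sigma>' :: "'i \<Rightarrow> real \<Rightarrow> real"
  assumes s0: "0 < s0" "s0 < 1"
    and D: "\<And>i s. i \<in> I \<Longrightarrow> 0 < s \<Longrightarrow> s < 1 \<Longrightarrow> ((\<sigma> i) has_real_derivative \<sigma>' i s) (at s)"
    and \<sigma>': "\<And>i s. i \<in> I \<Longrightarrow> 0 < s \<Longrightarrow> s < 1 \<Longrightarrow> isCont (\<sigma>' i) s"
  shows "((\<lambda>s. free_energy (\<lambda>i. \<sigma> i s)) has_real_derivative
    (\<Sum>i\<in>I. \<sigma> i s0 * \<sigma>' i s0 * (\<integral>p. 2 * (c i (fst p) * m (\<lambda>i. \<sigma> i s0) (fst p) (snd p) (a i)) -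
       (m (\<lambda>i. \<sigma> i s0) (fst p) (snd p) (a i))\<^sup>2 \<partial>(Q \<Otimes>\<^sub>M G)))) (at s0)"
proof -
  let ?v = "\<lambda>s i. \<sigma> i s" and ?v' = "\<lambda>s i. \<sigma>' i s"
  \<comment> \<open>A common bound on all strengths and their derivatives near \<open>s0\<close>;
    with it \<open>?K g\<close>, affine in the \<open>|g i|\<close> and hence integrable, dominates
    both the energy and its derivative.\<close>
  obtain C where C: "C \<ge> 0" "eventually (\<lambda>s. \<forall>i\<in>I. \<bar>\<sigma> i s\<bar> < C \<and> \<bar>\<sigma>' i s\<bar> < C) (nhds s0)"
  proof -
    define C where "C = (\<Sum>i\<in>I. \<bar>\<sigma> i s0\<bar> + \<bar>\<sigma>' i s0\<bar>) + 1"
    have nn: "(\<Sum>i\<in>I. \<bar>\<sigma> i s0\<bar> + \<bar>\<sigma>' i s0\<bar>) \<ge> 0" by (intro sum_nonneg) auto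
    have "eventually (\<lambda>s. \<bar>\<sigma> i s\<bar> < C \<and> \<bar>\<sigma>' i s\<bar> < C) (nhds s0)" if i: "i \<in> I" for i
    proof -
      have "\<bar>\<sigma> i s0\<bar> + \<bar>\<sigma>' i s0\<bar> \<le> (\<Sum>i\<in>I. \<bar>\<sigma> i s0\<bar> + \<bar>\<sigma>' i s0\<bar>)"
        using member_le_sum[of i I "\<lambda>i. \<bar>\<sigma> i s0\<bar> + \<bar>\<sigma>' i s0\<bar>"] fin i by auto
      then have lt: "\<bar>\<sigma> i s0\<bar> < C" "\<bar>\<sigma>' i s0\<bar> < C" unfolding C_def by linarith+
      have "isCont (\<lambda>s. \<bar>\<sigma> i s\<bar>) s0" "isCont (\<lambda>s. \<bar>\<sigma>' i s\<bar>) s0"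
        using DERIV_isCont[OF D[OF i s0]] \<sigma>'[OF i s0] by (auto intro: continuous_rabs)
      then have "((\<lambda>s. \<bar>\<sigma> i s\<bar>) \<longlongrightarrow> \<bar>\<sigma> i s0\<bar>) (nhds s0)" "((\<lambda>s. \<bar>\<sigma>' i s\<bar>) \<longlongrightarrow> \<bar>\<sigma>' i s0\<bar>) (nhds s0)"
        by (auto simp: isCont_def tendsto_nhds_iff)
      from eventually_conj[OF order_tendstoD(2)[OF this(1) lt(1)] order_tendstoD(2)[OF this(2) lt(2)]]
      show ?thesis .
    qed
    then have "eventually (\<lambda>s. \<forall>i\<in>I. \<bar>\<sigma> i s\<bar> < C \<and> \<bar>\<sigma>' i s\<bar> < C) (nhds s0)"
      using fin by (subst eventually_ball_finite_distrib) auto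
    then show thesis using that[of C] nn by (simp add: C_def)
  qed
  obtain e where e: "e > 0" "\<And>s. \<bar>s - s0\<bar> < e \<Longrightarrow> 0 < s \<and> s < 1 \<and> (\<forall>i\<in>I. \<bar>\<sigma> i s\<bar> < C \<and> \<bar>\<sigma>' i s\<bar> < C)"
  proof -
    have "eventually (\<lambda>s. s \<in> {0<..<1}) (nhds s0)" using s0 by (intro eventually_nhds_in_open) auto
    then have "eventually (\<lambda>s. s \<in> {0<..<1} \<and> (\<forall>i\<in>I. \<bar>\<sigma> i s\<bar> < C \<and> \<bar>\<sigma>' i s\<bar> < C)) (nhds s0)"
      by (rule eventually_conj[OF _ C(2)])
    then obtain e where "e > 0" "\<And>s. dist s s0 < e \<Longrightarrow> s \<in> {0<..<1} \<and> (\<forall>i\<in>I. \<bar>\<sigma> i s\<bar> < C \<and> \<bar>\<sigma>' i s\<bar> < C)"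
      unfolding eventually_nhds_metric by blast
    then show thesis using that[of e] by (auto simp: dist_real_def)
  qed
  let ?K = "\<lambda>g. A + (\<Sum>i\<in>I. C * (\<bar>g i\<bar> * A) + 2 * C\<^sup>2 * (2 * A\<^sup>2))"
  have H_le: "\<bar>H (?v s) y g x\<bar> \<le> ?K g" if "\<bar>s - s0\<bar> < e" "y \<in> space Q" "x \<in> space \<nu>" for s y g x
  proof -
    have "\<bar>H (?v s) y g x\<bar> \<le> Hbd (?v s) g" by (rule H_bound[OF that(2,3)])
    also have "\<dots> \<le> ?K g" unfolding Hbd_def
    proof (intro add_left_mono sum_mono add_mono)
      fix i assume i: "i \<in> I"
      have l: "\<bar>\<sigma> i s\<bar> \<le> C" using e(2)[OF that(1)] i by auto
      show "\<bar>\<sigma> i s\<bar> * (\<bar>g i\<bar> * A) \<le> C * (\<bar>g i\<bar> * A)" using l A0 by (intro mult_right_mono) auto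
      have "(\<sigma> i s)\<^sup>2 \<le> C\<^sup>2" using l C by (simp add: power2_le_iff_abs_le)
      also have "\<dots> \<le> 2 * C\<^sup>2" by simp
      finally show "(\<sigma> i s)\<^sup>2 * (2 * A\<^sup>2) \<le> 2 * C\<^sup>2 * (2 * A\<^sup>2)" by (intro mult_right_mono) auto
    qed
    finally show ?thesis .
  qed
  have dH_le: "\<bar>dH (?v s) (?v' s) y g x\<bar> \<le> ?K g" if "\<bar>s - s0\<bar> < e" "y \<in> space Q" "x \<in> space \<nu>" for s y g x
  proof -
    have "\<bar>dH (?v s) (?v' s) y g x\<bar> \<le> (\<Sum>i\<in>I. C * (\<bar>g i\<bar> * A) + 2 * C\<^sup>2 * (2 * A\<^sup>2))"
      unfolding dH_def
    proof (rule order_trans[OF sum_abs], rule sum_mono)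
      fix i assume i: "i \<in> I"
      have l: "\<bar>\<sigma> i s\<bar> \<le> C" "\<bar>\<sigma>' i s\<bar> \<le> C" using e(2)[OF that(1)] i by (auto intro: less_imp_le)
      have "\<bar>\<sigma> i s * \<sigma>' i s\<bar> \<le> C * C" unfolding abs_mult using l by (intro mult_mono) auto
      then have "\<bar>2 * \<sigma> i s * \<sigma>' i s\<bar> \<le> 2 * C\<^sup>2" by (simp add: abs_mult power2_eq_square)
      then have "\<bar>2 * \<sigma> i s * \<sigma>' i s\<bar> * (2 * A\<^sup>2) \<le> 2 * C\<^sup>2 * (2 * A\<^sup>2)"
        by (intro mult_right_mono) auto
      moreover have "\<bar>\<sigma>' i s\<bar> * (\<bar>g i\<bar> * A) \<le> C * (\<bar>g i\<bar> * A)"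
        using l A0 by (intro mult_right_mono) auto
      ultimately show "\<bar>\<sigma>' i s * (g i * a i x) + 2 * \<sigma> i s * \<sigma>' i s * (c i y * a i x - (a i x)\<^sup>2 / 2)\<bar>
        \<le> C * (\<bar>g i\<bar> * A) + 2 * C\<^sup>2 * (2 * A\<^sup>2)"
        using term_bound[OF that(2,3), of "\<sigma>' i s" "g i" i "2 * \<sigma> i s * \<sigma>' i s"] by linarith
    qed
    then show ?thesis using A0 by linarith
  qed
  have bm_dH: "bounded_meas \<nu> (dH v v' y g)" for v v' y g
    unfolding dH_def by (intro bounded_meas_intros bounded_meas_cmult bm_a) 
      (use bounded_meas_cmult[OF bounded_meas_power[OF bm_a], of "1/2"] in simp)
  have Kint: "integrable (Q \<Otimes>\<^sub>M G) (\<lambda>p. ?K (snd p))"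
    by (intro Bochner_Integration.integrable_add Bochner_Integration.integrable_sum integrable_mult_right
          integrable_mult_left QG_comp_integrable) auto
  have der: "((\<lambda>s. L (?v s) y g) has_real_derivative m (?v s) y g (dH (?v s) (?v' s) y g)) (at s)"
    if s: "\<bar>s - s0\<bar> < e" and y: "y \<in> space Q" for s y g
  proof (rule nu.ln_pf_has_derivative[where e = "e - \<bar>s - s0\<bar>" and C = "?K g" and B' = "\<lambda>s. dH (?v s) (?v' s) y g"])
    fix u assume u: "\<bar>u - s\<bar> < e - \<bar>s - s0\<bar>"
    then have u': "\<bar>u - s0\<bar> < e" by linarith
    show "H (?v u) y g \<in> borel_measurable \<nu>" by (rule H_meas_x[OF y])
    fix x assume x: "x \<in> space \<nu>"
    show "\<bar>H (?v u) y g x\<bar> \<le> ?K g" "\<bar>dH (?v u) (?v' u) y g x\<bar> \<le> ?K g"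
      using H_le[OF u' y x] dH_le[OF u' y x] by auto
    show "((\<lambda>s. H (?v s) y g x) has_real_derivative dH (?v u) (?v' u) y g x) (at u)"
      unfolding obs_energy_def dH_def
      by (rule DERIV_cong[OF DERIV_add[OF DERIV_const DERIV_sum]])
        (use e(2)[OF u'] in \<open>auto intro!: derivative_eq_intros D simp: mult_ac\<close>)
  qed (use s bm_dH in \<open>auto intro: bounded_meas_measurable\<close>)
  have m_dH_meas: "(\<lambda>p. m (?v s0) (fst p) (snd p) (dH (?v s0) (?v' s0) (fst p) (snd p))) \<in> borel_measurable (Q \<Otimes>\<^sub>M G)"
  proof -
    have [measurable]: "(\<lambda>x. (a i x)\<^sup>2) \<in> borel_measurable \<nu>" for i by measurable
    have "(\<lambda>p. \<Sum>i\<in>I. \<sigma>' i s0 * (snd p i * m (?v s0) (fst p) (snd p) (a i)) +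
      2 * \<sigma> i s0 * \<sigma>' i s0 * (c i (fst p) * m (?v s0) (fst p) (snd p) (a i) - m (?v s0) (fst p) (snd p) (\<lambda>x. (a i x)\<^sup>2) / 2))
      \<in> borel_measurable (Q \<Otimes>\<^sub>M G)"
      by (intro borel_measurable_sum) measurable
    then show ?thesis
      by (rule measurable_cong[THEN iffD1, rotated]) (auto simp: gibbs_dH space_pair_measure)
  qed
  have "((\<lambda>s. free_energy (?v s)) has_real_derivative
      (\<integral>p. m (?v s0) (fst p) (snd p) (dH (?v s0) (?v' s0) (fst p) (snd p)) \<partial>(Q \<Otimes>\<^sub>M G))) (at s0)"
    unfolding free_energy_def
  proof (rule has_real_derivative_integral[OF e(1), where D = "\<lambda>p. ?K (snd p)"
        and F' = "\<lambda>s p. m (?v s) (fst p) (snd p) (dH (?v s) (?v' s) (fst p) (snd p))"])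
    fix s p assume s: "\<bar>s - s0\<bar> < e" and p: "p \<in> space (Q \<Otimes>\<^sub>M G)"
    then have y: "fst p \<in> space Q" by (auto simp: space_pair_measure)
    show "((\<lambda>s. L (?v s) (fst p) (snd p)) has_real_derivative
      m (?v s) (fst p) (snd p) (dH (?v s) (?v' s) (fst p) (snd p))) (at s)" by (rule der[OF s y])
    show "\<bar>m (?v s) (fst p) (snd p) (dH (?v s) (?v' s) (fst p) (snd p))\<bar> \<le> ?K (snd p)"
      by (rule m_abs_le[OF y bm_dH dH_le[OF s y]])
  qed (use L_integrable Kint m_dH_meas in auto)
  also have "(\<integral>p. m (?v s0) (fst p) (snd p) (dH (?v s0) (?v' s0) (fst p) (snd p)) \<partial>(Q \<Otimes>\<^sub>M G)) =
    (\<Sum>i\<in>I. \<sigma> i s0 * \<sigma>' i s0 * (\<integral>p. 2 * (c i (fst p) * m (?v s0) (fst p) (snd p) (a i)) -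
       (m (?v s0) (fst p) (snd p) (a i))\<^sup>2 \<partial>(Q \<Otimes>\<^sub>M G)))"
  proof -
    let ?m1 = "\<lambda>i p. m (?v s0) (fst p) (snd p) (a i)"
    let ?m2 = "\<lambda>i p. m (?v s0) (fst p) (snd p) (\<lambda>x. (a i x)\<^sup>2)"
    have bma2: "bounded_meas \<nu> (\<lambda>x. (a i x)\<^sup>2)" for i by (intro bounded_meas_power bm_a)
    note ints = m_integrable(1)[OF bma2 a2_bound] m_integrable(2)[OF bm_a a_bound]
      m_integrable(3)[OF bm_a a_bound] m_integrable(4)[OF bm_a a_bound]
    have "(\<integral>p. m (?v s0) (fst p) (snd p) (dH (?v s0) (?v' s0) (fst p) (snd p)) \<partial>(Q \<Otimes>\<^sub>M G)) =
      (\<integral>p. (\<Sum>i\<in>I. \<sigma>' i s0 * (snd p i * ?m1 i p) + 2 * \<sigma> i s0 * \<sigma>' i s0 * (c i (fst p) * ?m1 i p - ?m2 i p / 2)) \<partial>(Q \<Otimes>\<^sub>M G))"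
      by (intro Bochner_Integration.integral_cong) (auto simp: gibbs_dH space_pair_measure)
    also have "\<dots> = (\<Sum>i\<in>I. \<integral>p. \<sigma>' i s0 * (snd p i * ?m1 i p) + 2 * \<sigma> i s0 * \<sigma>' i s0 * (c i (fst p) * ?m1 i p - ?m2 i p / 2) \<partial>(Q \<Otimes>\<^sub>M G))"
      by (intro Bochner_Integration.integral_sum Bochner_Integration.integrable_add Bochner_Integration.integrable_diff
          integrable_mult_right integrable_divide ints)
    also have "\<dots> = (\<Sum>i\<in>I. \<sigma> i s0 * \<sigma>' i s0 * (\<integral>p. 2 * (c i (fst p) * ?m1 i p) - (?m1 i p)\<^sup>2 \<partial>(Q \<Otimes>\<^sub>M G)))"
    proof (rule sum.cong[OF refl])
      fix i assume i: "i \<in> I"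
      have "(\<integral>p. \<sigma>' i s0 * (snd p i * ?m1 i p) + 2 * \<sigma> i s0 * \<sigma>' i s0 * (c i (fst p) * ?m1 i p - ?m2 i p / 2) \<partial>(Q \<Otimes>\<^sub>M G)) =
        \<sigma>' i s0 * (\<integral>p. snd p i * ?m1 i p \<partial>(Q \<Otimes>\<^sub>M G)) +
        2 * \<sigma> i s0 * \<sigma>' i s0 * ((\<integral>p. c i (fst p) * ?m1 i p \<partial>(Q \<Otimes>\<^sub>M G)) - (\<integral>p. ?m2 i p \<partial>(Q \<Otimes>\<^sub>M G)) / 2)"
        using i by (simp add: ints)
      also have "\<dots> = \<sigma> i s0 * \<sigma>' i s0 * (2 * (\<integral>p. c i (fst p) * ?m1 i p \<partial>(Q \<Otimes>\<^sub>M G)) - (\<integral>p. (?m1 i p)\<^sup>2 \<partial>(Q \<Otimes>\<^sub>M G)))"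
        unfolding integral_component_gibbs[OF i] by (simp add: ints algebra_simps)
      finally show "(\<integral>p. \<sigma>' i s0 * (snd p i * ?m1 i p) + 2 * \<sigma> i s0 * \<sigma>' i s0 * (c i (fst p) * ?m1 i p - ?m2 i p / 2) \<partial>(Q \<Otimes>\<^sub>M G)) =
        \<sigma> i s0 * \<sigma>' i s0 * (\<integral>p. 2 * (c i (fst p) * ?m1 i p) - (?m1 i p)\<^sup>2 \<partial>(Q \<Otimes>\<^sub>M G))"
        by (simp add: ints)
    qed
    finally show ?thesis .
  qed
  finally show ?thesis .
qed

text \<open>The later estimates of the derivative hold at every point of the path, so its value at
  one intermediate \<open>s\<close> serves as well as the integral over the path.\<close>

lemma free_energy_mvt:
  fixes \<sigma> \<sigma>' :: "'i \<Rightarrow> real \<Rightarrow> real"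
  assumes cont: "\<And>i. i \<in> I \<Longrightarrow> continuous_on {0..1} (\<sigma> i)"
    and D: "\<And>i s. i \<in> I \<Longrightarrow> 0 < s \<Longrightarrow> s < 1 \<Longrightarrow> ((\<sigma> i) has_real_derivative \<sigma>' i s) (at s)"
    and \<sigma>': "\<And>i s. i \<in> I \<Longrightarrow> 0 < s \<Longrightarrow> s < 1 \<Longrightarrow> isCont (\<sigma>' i) s"
  obtains s where "0 < s" "s < 1"
    "free_energy (\<lambda>i. \<sigma> i 1) - free_energy (\<lambda>i. \<sigma> i 0) =
    (\<Sum>i\<in>I. \<sigma> i s * \<sigma>' i s * (\<integral>p. 2 * (c i (fst p) * m (\<lambda>i. \<sigma> i s) (fst p) (snd p) (a i)) -
       (m (\<lambda>i. \<sigma> i s) (fst p) (snd p) (a i))\<^sup>2 \<partial>(Q \<Otimes>\<^sub>M G)))"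
proof -
  note d = free_energy_has_derivative[where \<sigma> = \<sigma> and \<sigma>' = \<sigma>', OF _ _ D \<sigma>', simplified]
  have "\<exists>l s. 0 < s \<and> s < 1 \<and> ((\<lambda>s. free_energy (\<lambda>i. \<sigma> i s)) has_real_derivative l) (at s) \<and>
    free_energy (\<lambda>i. \<sigma> i 1) - free_energy (\<lambda>i. \<sigma> i 0) = (1 - 0) * l"
  proof (rule MVT)
    show "continuous_on {0..1} (\<lambda>s. free_energy (\<lambda>i. \<sigma> i s))" by (intro free_energy_continuous cont)
    show "(\<lambda>s. free_energy (\<lambda>i. \<sigma> i s)) differentiable at s" if "0 < s" "s < 1" for s
      using d[OF that] by (auto simp: real_differentiable_def)
  qed simp
  then obtain l s where s: "0 < s" "s < 1" and l: "((\<lambda>s. free_energy (\<lambda>i. \<sigma> i s)) has_real_derivative l) (at s)"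
    "free_energy (\<lambda>i. \<sigma> i 1) - free_energy (\<lambda>i. \<sigma> i 0) = l" by auto
  show thesis using that[OF s] DERIV_unique[OF l(1) d[OF s]] l(2) by simp
qed

end

text \<open>The planted model: the signal \<open>y\<close> is drawn from the same prior \<open>\<nu>\<close> as the Gibbs sample.\<close>

locale planted_observation = nu: prob_space \<nu>
  for \<nu> :: "'x measure" +
  fixes I :: "'i set" and a :: "'i \<Rightarrow> 'x \<Rightarrow> real" and A :: real
  assumes fin: "finite I" and A0: "A \<ge> 0"
    and a_meas [measurable]: "\<And>i. a i \<in> borel_measurable \<nu>"
    and a_bound: "\<And>i x. x \<in> space \<nu> \<Longrightarrow> \<bar>a i x\<bar> \<le> A"

sublocale planted_observation \<subseteq> gaussian_observation \<nu> \<nu> I a a "\<lambda>_ _. 0" A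
  using fin A0 a_bound by unfold_locales auto

context planted_observation
begin

text \<open>The energy as a function of the data \<open>g i + v i * a i y\<close> instead of the
  noise, see \<open>H_eq_E0\<close>. For fixed \<open>x\<close> its exponential is the
  Cameron--Martin density of data with signal \<open>x\<close>.\<close>

definition E0 :: "('i \<Rightarrow> real) \<Rightarrow> ('i \<Rightarrow> real) \<Rightarrow> 'x \<Rightarrow> real" where
  "E0 v g x = (\<Sum>i\<in>I. v i * (a i x * g i) - (v i * a i x)\<^sup>2 / 2)"

lemma H_eq_E0: "H v y g = E0 v (\<lambda>i\<in>I. g i + v i * a i y)"
  unfolding obs_energy_def E0_def
  by (auto intro!: ext sum.cong simp: power2_eq_square algebra_simps)

lemma E0_meas [measurable]: "(\<lambda>p. E0 v (snd p) (fst p)) \<in> borel_measurable (\<nu> \<Otimes>\<^sub>M G)"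
  unfolding E0_def by (intro borel_measurable_sum) measurable

lemma E0_meas' [measurable]: "(\<lambda>p. E0 v (fst p) (snd p)) \<in> borel_measurable (G \<Otimes>\<^sub>M \<nu>)"
  unfolding E0_def by (intro borel_measurable_sum) measurable

lemma exp_E0_nn_integral: "(\<integral>\<^sup>+g. ennreal (exp (E0 v g y)) \<partial>G) = 1"
proof -
  let ?w = "\<lambda>i. v i * a i y"
  have "prob_space (distr G G (\<lambda>g. \<lambda>i\<in>I. g i + ?w i))"
    by (intro G.prob_space_distr measurable_restrict) measurable
  then have "emeasure (density G (\<lambda>g. ennreal (exp (\<Sum>i\<in>I. ?w i * g i - (?w i)\<^sup>2 / 2)))) (space G) = 1"
    unfolding distr_gauss_vec_shift[OF fin] using prob_space.emeasure_space_1 by fastforce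
  moreover have "(\<Sum>i\<in>I. ?w i * g i - (?w i)\<^sup>2 / 2) = E0 v g y" for g
    unfolding E0_def by (auto intro!: sum.cong simp: algebra_simps)
  moreover have "(\<lambda>g. exp (\<Sum>i\<in>I. ?w i * g i - (?w i)\<^sup>2 / 2)) \<in> borel_measurable G"
    by (intro borel_measurable_exp borel_measurable_sum measurable_compose[OF _ borel_measurable_exp]) measurable
  ultimately show ?thesis by (subst (asm) emeasure_density) (auto cong: nn_integral_cong_simp)
qed

lemma exp_E0_integrable: "integrable (\<nu> \<Otimes>\<^sub>M G) (\<lambda>p. exp (E0 v (snd p) (fst p)))"
proof (rule integrableI_nonneg)
  have "(\<integral>\<^sup>+p. ennreal (exp (E0 v (snd p) (fst p))) \<partial>(\<nu> \<Otimes>\<^sub>M G)) =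
    (\<integral>\<^sup>+y. \<integral>\<^sup>+g. ennreal (exp (E0 v g y)) \<partial>G \<partial>\<nu>)"
    by (subst G.nn_integral_fst[symmetric]) auto
  then show "(\<integral>\<^sup>+p. ennreal (exp (E0 v (snd p) (fst p))) \<partial>(\<nu> \<Otimes>\<^sub>M G)) < \<infinity>"
    by (simp add: exp_E0_nn_integral nu.emeasure_space_1)
qed auto

text \<open>The law of the data under the planted model has density \<open>pf \<nu> (E0 v \<cdot>)\<close> with respect to
  the Gaussian measure, and the Gibbs measure is the posterior.\<close>

lemma planted_change_of_measure:
  assumes \<psi> [measurable]: "(\<lambda>p. \<psi> (fst p) (snd p)) \<in> borel_measurable (\<nu> \<Otimes>\<^sub>M G)"
    and bd: "\<And>y g. y \<in> space \<nu> \<Longrightarrow> \<bar>\<psi> y g\<bar> \<le> C"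
  shows "(\<integral>y. \<integral>g. \<psi> y (\<lambda>i\<in>I. g i + v i * a i y) \<partial>G \<partial>\<nu>) =
    (\<integral>g. \<integral>y. exp (E0 v g y) * \<psi> y g \<partial>\<nu> \<partial>G)"
proof -
  have "(\<integral>g. \<psi> y (\<lambda>i\<in>I. g i + v i * a i y) \<partial>G) = (\<integral>g. exp (E0 v g y) * \<psi> y g \<partial>G)"
    if y: "y \<in> space \<nu>" for y
  proof -
    have [measurable]: "\<psi> y \<in> borel_measurable G"
      using measurable_compose[OF measurable_Pair1'[OF y] \<psi>] by simp
    have "(\<Sum>i\<in>I. v i * a i y * g i - (v i * a i y)\<^sup>2 / 2) = E0 v g y" for g
      unfolding E0_def by (auto intro!: sum.cong simp: algebra_simps)
    then show ?thesis using integral_gauss_vec_shift[OF fin, of "\<psi> y" "\<lambda>i. v i * a i y"] by simp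
  qed
  then have "(\<integral>y. \<integral>g. \<psi> y (\<lambda>i\<in>I. g i + v i * a i y) \<partial>G \<partial>\<nu>) =
    (\<integral>y. \<integral>g. exp (E0 v g y) * \<psi> y g \<partial>G \<partial>\<nu>)"
    by (rule Bochner_Integration.integral_cong[OF refl])
  also have "\<dots> = (\<integral>g. \<integral>y. exp (E0 v g y) * \<psi> y g \<partial>\<nu> \<partial>G)"
  proof (rule QG.Fubini_integral[symmetric])
    have "integrable (\<nu> \<Otimes>\<^sub>M G) (\<lambda>p. exp (E0 v (snd p) (fst p)) * \<psi> (fst p) (snd p))"
    proof (rule Bochner_Integration.integrable_bound)
      show "integrable (\<nu> \<Otimes>\<^sub>M G) (\<lambda>p. C * exp (E0 v (snd p) (fst p)))"
        by (intro integrable_mult_right exp_E0_integrable)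
      have "exp x * \<bar>\<psi> y g\<bar> \<le> \<bar>C\<bar> * exp x" if "y \<in> space \<nu>" for x y g
      proof -
        have "\<bar>\<psi> y g\<bar> \<le> \<bar>C\<bar>" using bd[OF that, of g] by linarith
        then show ?thesis by (simp add: mult.commute)
      qed
      then show "AE p in \<nu> \<Otimes>\<^sub>M G. norm (exp (E0 v (snd p) (fst p)) * \<psi> (fst p) (snd p)) \<le>
          norm (C * exp (E0 v (snd p) (fst p)))"
        by (intro AE_I2) (auto simp: abs_mult space_pair_measure)
    qed measurable
    then show "integrable (\<nu> \<Otimes>\<^sub>M G) (\<lambda>(y, g). exp (E0 v g y) * \<psi> y g)"
      by (simp add: case_prod_beta')
  qed
  finally show ?thesis .
qed

text \<open>Given the data, signal and Gibbs sample have the same law. After the change of measure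
  the average \<open>?M\<close> depends on the data alone, so integrating the signal against
  \<open>exp (E0 v g y)\<close> replaces \<open>a i y\<close> by \<open>?M g\<close>.\<close>

lemma nishimori:
  "(\<integral>p. a i (fst p) * m v (fst p) (snd p) (a i) \<partial>(\<nu> \<Otimes>\<^sub>M G)) =
    (\<integral>p. (m v (fst p) (snd p) (a i))\<^sup>2 \<partial>(\<nu> \<Otimes>\<^sub>M G))"
proof -
  let ?M = "\<lambda>g. gibbs \<nu> (E0 v g) (a i)"
  have M_meas [measurable]: "?M \<in> borel_measurable G"
    unfolding gibbs_def pf_def using E0_meas'[of v] by measurable
  have M_le: "\<bar>?M g\<bar> \<le> A" for g
  proof (rule nu.gibbs_abs_le[OF _ bm_a a_bound])
    have *: "E0 v g = (\<lambda>x. \<Sum>i\<in>I. v i * g i * a i x - (v i)\<^sup>2 / 2 * (a i x)\<^sup>2)"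
      unfolding E0_def by (auto intro!: ext sum.cong simp: power_mult_distrib mult_ac)
    show "bounded_meas \<nu> (E0 v g)" unfolding * by (intro bounded_meas_intros bm_a)
  qed
  have A2: "(?M g)\<^sup>2 \<le> A\<^sup>2" for g using M_le[of g] A0 by (simp add: power2_le_iff_abs_le)
  have "(\<integral>p. a i (fst p) * m v (fst p) (snd p) (a i) \<partial>(\<nu> \<Otimes>\<^sub>M G)) =
    (\<integral>y. \<integral>g. a i y * ?M (\<lambda>i\<in>I. g i + v i * a i y) \<partial>G \<partial>\<nu>)"
    using QG.integral_fst'[OF m_integrable(3)[OF bm_a a_bound]] by (simp add: H_eq_E0)
  also have "\<dots> = (\<integral>g. \<integral>y. exp (E0 v g y) * (a i y * ?M g) \<partial>\<nu> \<partial>G)"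
  proof (rule planted_change_of_measure[where C = "A * A"])
    show "\<bar>a i y * ?M g\<bar> \<le> A * A" if "y \<in> space \<nu>" for y g
      unfolding abs_mult using a_bound[OF that] M_le A0 by (intro mult_mono) auto
  qed measurable
  also have "\<dots> = (\<integral>g. \<integral>y. exp (E0 v g y) * (?M g)\<^sup>2 \<partial>\<nu> \<partial>G)"
  proof (rule Bochner_Integration.integral_cong[OF refl])
    fix g
    have "bounded_meas \<nu> (E0 v g)"
    proof -
      have *: "E0 v g = (\<lambda>x. \<Sum>i\<in>I. v i * g i * a i x - (v i)\<^sup>2 / 2 * (a i x)\<^sup>2)"
        unfolding E0_def by (auto intro!: ext sum.cong simp: power_mult_distrib mult_ac)
      show ?thesis unfolding * by (intro bounded_meas_intros bm_a)
    qed
    from nu.pf_pos[OF this] have pos: "pf \<nu> (E0 v g) > 0" .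
    have "(\<integral>y. exp (E0 v g y) * (a i y * ?M g) \<partial>\<nu>) = ?M g * (\<integral>y. a i y * exp (E0 v g y) \<partial>\<nu>)"
      unfolding integral_mult_right_zero[symmetric] by (simp add: mult_ac)
    also have "(\<integral>y. a i y * exp (E0 v g y) \<partial>\<nu>) = ?M g * pf \<nu> (E0 v g)"
      using pos by (simp add: gibbs_def)
    finally show "(\<integral>y. exp (E0 v g y) * (a i y * ?M g) \<partial>\<nu>) = (\<integral>y. exp (E0 v g y) * (?M g)\<^sup>2 \<partial>\<nu>)"
      by (simp add: pf_def power2_eq_square)
  qed
  also have "\<dots> = (\<integral>y. \<integral>g. (?M (\<lambda>i\<in>I. g i + v i * a i y))\<^sup>2 \<partial>G \<partial>\<nu>)"
    by (rule planted_change_of_measure[where C = "A\<^sup>2", symmetric]) (use A2 in auto)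
  also have "\<dots> = (\<integral>p. (m v (fst p) (snd p) (a i))\<^sup>2 \<partial>(\<nu> \<Otimes>\<^sub>M G))"
    using QG.integral_fst'[OF m_integrable(2)[OF bm_a a_bound]] by (simp add: H_eq_E0)
  finally show ?thesis .
qed

text \<open>The Nishimori identity turns \<open>2 * a i * <a i> - <a i>^2\<close> into
  \<open><a i>^2\<close> under the expectation: every channel contributes with the sign of the
  change of its strength.\<close>

lemma planted_mvt:
  fixes \<sigma> \<sigma>' :: "'i \<Rightarrow> real \<Rightarrow> real"
  assumes cont: "\<And>i. i \<in> I \<Longrightarrow> continuous_on {0..1} (\<sigma> i)"
    and D: "\<And>i s. i \<in> I \<Longrightarrow> 0 < s \<Longrightarrow> s < 1 \<Longrightarrow> ((\<sigma> i) has_real_derivative \<sigma>' i s) (at s)"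
    and \<sigma>': "\<And>i s. i \<in> I \<Longrightarrow> 0 < s \<Longrightarrow> s < 1 \<Longrightarrow> isCont (\<sigma>' i) s"
  obtains s where "0 < s" "s < 1"
    "free_energy (\<lambda>i. \<sigma> i 1) - free_energy (\<lambda>i. \<sigma> i 0) =
    (\<integral>p. (\<Sum>i\<in>I. \<sigma> i s * \<sigma>' i s * (m (\<lambda>i. \<sigma> i s) (fst p) (snd p) (a i))\<^sup>2) \<partial>(\<nu> \<Otimes>\<^sub>M G))"
proof -
  obtain s where s: "0 < s" "s < 1" and eq: "free_energy (\<lambda>i. \<sigma> i 1) - free_energy (\<lambda>i. \<sigma> i 0) =
    (\<Sum>i\<in>I. \<sigma> i s * \<sigma>' i s * (\<integral>p. 2 * (a i (fst p) * m (\<lambda>i. \<sigma> i s) (fst p) (snd p) (a i)) -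
       (m (\<lambda>i. \<sigma> i s) (fst p) (snd p) (a i))\<^sup>2 \<partial>(\<nu> \<Otimes>\<^sub>M G)))"
    using free_energy_mvt[of \<sigma> \<sigma>', OF cont D \<sigma>'] by blast
  have "(\<integral>p. 2 * (a i (fst p) * m (\<lambda>i. \<sigma> i s) (fst p) (snd p) (a i)) -
       (m (\<lambda>i. \<sigma> i s) (fst p) (snd p) (a i))\<^sup>2 \<partial>(\<nu> \<Otimes>\<^sub>M G)) =
     (\<integral>p. (m (\<lambda>i. \<sigma> i s) (fst p) (snd p) (a i))\<^sup>2 \<partial>(\<nu> \<Otimes>\<^sub>M G))" for i
    using m_integrable(2)[OF bm_a a_bound] m_integrable(3)[OF bm_a a_bound]
    by (simp add: nishimori)
  with eq show thesis using m_integrable(2)[OF bm_a a_bound]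
    by (intro that[OF s]) simp
qed

end

text \<open>With \<open>c = 0\<close> only \<open>- <a i>^2\<close> survives, the opposite sign to
  \<open>planted_mvt\<close>; this is what makes an upper bound possible.\<close>

lemma (in gaussian_observation) unplanted_mvt:
  fixes \<sigma> \<sigma>' :: "'i \<Rightarrow> real \<Rightarrow> real"
  assumes c0: "\<And>i y. c i y = 0"
    and cont: "\<And>i. i \<in> I \<Longrightarrow> continuous_on {0..1} (\<sigma> i)"
    and D: "\<And>i s. i \<in> I \<Longrightarrow> 0 < s \<Longrightarrow> s < 1 \<Longrightarrow> ((\<sigma> i) has_real_derivative \<sigma>' i s) (at s)"
    and \<sigma>': "\<And>i s. i \<in> I \<Longrightarrow> 0 < s \<Longrightarrow> s < 1 \<Longrightarrow> isCont (\<sigma>' i) s"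
  obtains s where "0 < s" "s < 1"
    "free_energy (\<lambda>i. \<sigma> i 1) - free_energy (\<lambda>i. \<sigma> i 0) =
    - (\<integral>p. (\<Sum>i\<in>I. \<sigma> i s * \<sigma>' i s * (m (\<lambda>i. \<sigma> i s) (fst p) (snd p) (a i))\<^sup>2) \<partial>(Q \<Otimes>\<^sub>M G))"
proof -
  obtain s where s: "0 < s" "s < 1" and eq: "free_energy (\<lambda>i. \<sigma> i 1) - free_energy (\<lambda>i. \<sigma> i 0) =
    (\<Sum>i\<in>I. \<sigma> i s * \<sigma>' i s * (\<integral>p. 2 * (c i (fst p) * m (\<lambda>i. \<sigma> i s) (fst p) (snd p) (a i)) -
       (m (\<lambda>i. \<sigma> i s) (fst p) (snd p) (a i))\<^sup>2 \<partial>(Q \<Otimes>\<^sub>M G)))"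
    using free_energy_mvt[of \<sigma> \<sigma>', OF cont D \<sigma>'] by blast
  then show thesis using m_integrable(2)[OF bm_a a_bound]
    by (intro that[OF s]) (simp add: c0 sum_negf)
qed

section \<open>Variance bounds\<close>

definition var :: "'a measure \<Rightarrow> ('a \<Rightarrow> real) \<Rightarrow> real" where
  "var M f = (\<integral>x. (f x)\<^sup>2 \<partial>M) - (\<integral>x. f x \<partial>M)\<^sup>2"

lemma (in prob_space) integrable_of_square:
  fixes f :: "'a \<Rightarrow> real"
  assumes [measurable]: "f \<in> borel_measurable M" and "integrable M (\<lambda>x. (f x)\<^sup>2)"
  shows "integrable M f"
proof (rule Bochner_Integration.integrable_bound)
  show "integrable M (\<lambda>x. 1 + (f x)\<^sup>2)" using assms by (intro Bochner_Integration.integrable_add) auto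
  have "\<bar>y\<bar> \<le> 1 + y\<^sup>2" for y :: real
  proof -
    have "0 \<le> (\<bar>y\<bar> - 1)\<^sup>2" "0 \<le> y\<^sup>2" by simp_all
    then show ?thesis unfolding power2_diff power2_abs by simp
  qed
  then show "AE x in M. norm (f x) \<le> norm (1 + (f x)\<^sup>2)" by (auto simp: abs_of_nonneg)
qed simp

lemma (in prob_space) integral_square_shift:
  fixes f :: "'a \<Rightarrow> real"
  assumes f: "f \<in> borel_measurable M" "integrable M (\<lambda>x. (f x)\<^sup>2)"
  shows "(\<integral>x. (f x - c)\<^sup>2 \<partial>M) = var M f + ((\<integral>x. f x \<partial>M) - c)\<^sup>2"
    and "integrable M (\<lambda>x. (f x - c)\<^sup>2)"
proof -
  note i = integrable_of_square[OF f] f(2)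
  have e: "(\<lambda>x. (f x - c)\<^sup>2) = (\<lambda>x. (f x)\<^sup>2 - 2 * c * f x + c\<^sup>2)"
    by (auto simp: power2_diff mult.commute)
  show "integrable M (\<lambda>x. (f x - c)\<^sup>2)" unfolding e using i by simp
  have "(\<integral>x. (f x - c)\<^sup>2 \<partial>M) = (\<integral>x. (f x)\<^sup>2 \<partial>M) - 2 * c * (\<integral>x. f x \<partial>M) + c\<^sup>2"
    unfolding e using i by (simp add: prob_space)
  then show "(\<integral>x. (f x - c)\<^sup>2 \<partial>M) = var M f + ((\<integral>x. f x \<partial>M) - c)\<^sup>2"
    by (simp add: var_def power2_diff)
qed

lemma (in prob_space) var_le:
  fixes f :: "'a \<Rightarrow> real"
  assumes "f \<in> borel_measurable M" "integrable M (\<lambda>x. (f x)\<^sup>2)"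
  shows "var M f \<le> (\<integral>x. (f x - c)\<^sup>2 \<partial>M)"
  using integral_square_shift[OF assms, of c] by simp

lemma (in prob_space) var_nonneg:
  fixes f :: "'a \<Rightarrow> real"
  assumes "f \<in> borel_measurable M" "integrable M (\<lambda>x. (f x)\<^sup>2)"
  shows "var M f \<ge> 0"
proof -
  have "0 \<le> (\<integral>x. (f x - (\<integral>x. f x \<partial>M))\<^sup>2 \<partial>M)" by simp
  then show ?thesis unfolding integral_square_shift(1)[OF assms] by simp
qed

lemma (in prob_space) abs_deviation_le:
  fixes f :: "'a \<Rightarrow> real"
  assumes f: "f \<in> borel_measurable M" "integrable M (\<lambda>x. (f x)\<^sup>2)"
  shows "(\<integral>x. \<bar>f x - (\<integral>x. f x \<partial>M)\<bar> \<partial>M) \<le> sqrt (var M f)"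
proof -
  define \<mu> where "\<mu> = (\<integral>x. f x \<partial>M)"
  note i = integral_square_shift[OF f, of \<mu>]
  have [measurable]: "f \<in> borel_measurable M" by fact
  have sq: "integrable M (\<lambda>x. (\<bar>f x - \<mu>\<bar>)\<^sup>2)" using i(2) by simp
  have "0 \<le> var M (\<lambda>x. \<bar>f x - \<mu>\<bar>)" by (rule var_nonneg) (use sq in auto)
  then have "(\<integral>x. \<bar>f x - \<mu>\<bar> \<partial>M)\<^sup>2 \<le> (\<integral>x. (f x - \<mu>)\<^sup>2 \<partial>M)" by (simp add: var_def)
  also have "\<dots> = var M f" using i(1) by (simp add: \<mu>_def)
  finally show ?thesis unfolding \<mu>_def[symmetric] by (simp add: real_le_rsqrt)
qed

text \<open>The law of total variance, with the conditional variance bounded uniformly by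
  \<open>v2\<close>.\<close>

lemma (in pair_prob_space) var_pair_le:
  fixes f :: "'a \<Rightarrow> 'b \<Rightarrow> real"
  assumes f_meas: "(\<lambda>p. f (fst p) (snd p)) \<in> borel_measurable (M1 \<Otimes>\<^sub>M M2)"
    and f2: "integrable (M1 \<Otimes>\<^sub>M M2) (\<lambda>p. (f (fst p) (snd p))\<^sup>2)"
    and h2: "integrable M1 (\<lambda>x. (\<integral>y. f x y \<partial>M2)\<^sup>2)"
    and v2: "\<And>x. x \<in> space M1 \<Longrightarrow> var M2 (f x) \<le> v2"
    and v1: "var M1 (\<lambda>x. \<integral>y. f x y \<partial>M2) \<le> v1"
  shows "var (M1 \<Otimes>\<^sub>M M2) (\<lambda>p. f (fst p) (snd p)) \<le> v1 + v2"
proof -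
  have f1: "integrable (M1 \<Otimes>\<^sub>M M2) (\<lambda>p. f (fst p) (snd p))"
    by (rule P.integrable_of_square[OF f_meas f2])
  have i2: "integrable M1 (\<lambda>x. \<integral>y. (f x y)\<^sup>2 \<partial>M2)" using integrable_fst'[OF f2] by simp
  have "(\<integral>x. (\<integral>y. (f x y)\<^sup>2 \<partial>M2) - (\<integral>y. f x y \<partial>M2)\<^sup>2 \<partial>M1) \<le> (\<integral>x. v2 \<partial>M1)"
    using v2 i2 h2 by (intro integral_mono) (auto simp: var_def)
  then have "(\<integral>x. \<integral>y. (f x y)\<^sup>2 \<partial>M2 \<partial>M1) - (\<integral>x. (\<integral>y. f x y \<partial>M2)\<^sup>2 \<partial>M1) \<le> v2"
    using i2 h2 by (simp add: M1.prob_space)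
  then show ?thesis
    using v1 integral_fst'[OF f2] integral_fst'[OF f1] by (simp add: var_def)
qed

text \<open>An Efron--Stein bound, with the variance of each coordinate replaced by its second moment.\<close>

lemma var_PiM_lipschitz:
  fixes M :: "real measure" and f :: "('i \<Rightarrow> real) \<Rightarrow> real"
  assumes M: "prob_space M" and sets_M: "sets M = sets borel"
    and x2: "integrable M (\<lambda>x. x\<^sup>2)" and I: "finite I"
    and f: "f \<in> borel_measurable (PiM I (\<lambda>_. M))"
    and lip: "\<And>i \<zeta> a b. i \<in> I \<Longrightarrow> \<zeta> \<in> space (PiM I (\<lambda>_. M)) \<Longrightarrow>
       \<bar>f (\<zeta>(i := a)) - f (\<zeta>(i := b))\<bar> \<le> l i * \<bar>a - b\<bar>"
  shows "integrable (PiM I (\<lambda>_. M)) (\<lambda>\<zeta>. (f \<zeta>)\<^sup>2)"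
    and "var (PiM I (\<lambda>_. M)) f \<le> (\<Sum>i\<in>I. (l i)\<^sup>2 * (\<integral>x. x\<^sup>2 \<partial>M))"
proof -
  interpret M: prob_space M by (rule M)
  interpret PM: product_sigma_finite "\<lambda>_::'i. M"
    by (rule product_sigma_finite.intro) (rule prob_space_imp_sigma_finite[OF M])
  define S where "S = (\<integral>x. x\<^sup>2 \<partial>M)"
  have S0: "S \<ge> 0" by (simp add: S_def)
  have space_M: "space M = UNIV" using sets_eq_imp_space_eq[OF sets_M] by simp
  note [measurable_cong] = sets_M
  have "integrable (PiM I (\<lambda>_. M)) (\<lambda>\<zeta>. (f \<zeta>)\<^sup>2) \<and> var (PiM I (\<lambda>_. M)) f \<le> (\<Sum>i\<in>I. (l i)\<^sup>2 * S)"
    using I f lip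
  proof (induction I arbitrary: f)
    case empty
    interpret E: prob_space "PiM {} (\<lambda>_::'i. M)" by (intro prob_space_PiM M)
    define c where "c = f (\<lambda>_. undefined)"
    have c: "f \<zeta> = c" if "\<zeta> \<in> space (PiM {} (\<lambda>_::'i. M))" for \<zeta>
      using that by (simp add: space_PiM c_def)
    have "integrable (PiM {} (\<lambda>_. M)) (\<lambda>\<zeta>. (f \<zeta>)\<^sup>2) = integrable (PiM {} (\<lambda>_::'i. M)) (\<lambda>_. c\<^sup>2)"
      by (rule Bochner_Integration.integrable_cong[OF refl]) (simp only: c)
    moreover have "(\<integral>\<zeta>. (f \<zeta>)\<^sup>2 \<partial>PiM {} (\<lambda>_. M)) = (\<integral>_. c\<^sup>2 \<partial>PiM {} (\<lambda>_::'i. M))"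
      by (rule Bochner_Integration.integral_cong[OF refl]) (simp only: c)
    moreover have "(\<integral>\<zeta>. f \<zeta> \<partial>PiM {} (\<lambda>_. M)) = (\<integral>_. c \<partial>PiM {} (\<lambda>_::'i. M))"
      by (rule Bochner_Integration.integral_cong[OF refl]) (simp only: c)
    ultimately show ?case by (simp add: var_def E.prob_space)
  next
    case (insert i I)
    let ?P = "PiM I (\<lambda>_::'i. M)" and ?P' = "PiM (insert i I) (\<lambda>_::'i. M)"
    interpret P: prob_space ?P by (intro prob_space_PiM M)
    interpret P': prob_space ?P' by (intro prob_space_PiM M)
    note [measurable] = insert.prems(1)
    have upd [measurable]: "(\<lambda>p. (fst p)(i := snd p)) \<in> measurable (?P \<Otimes>\<^sub>M M) ?P'"
      using measurable_add_dim[of i I "\<lambda>_. M"] by (simp add: case_prod_beta')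
    have fj [measurable]: "(\<lambda>p. f ((fst p)(i := snd p))) \<in> borel_measurable (?P \<Otimes>\<^sub>M M)"
      using measurable_compose[OF upd insert.prems(1)] .
    have fsec [measurable]: "(\<lambda>y. f (\<zeta>(i := y))) \<in> borel_measurable M" if "\<zeta> \<in> space ?P" for \<zeta>
      using measurable_compose[OF measurable_Pair1'[OF that] fj] by simp
    have sp: "\<zeta>(i := y) \<in> space ?P'" if "\<zeta> \<in> space ?P" for \<zeta> y
      using that by (auto simp: space_PiM space_M PiE_iff extensional_def)
    have lip_i: "\<bar>f (\<zeta>(i := a)) - f (\<zeta>(i := b))\<bar> \<le> l i * \<bar>a - b\<bar>" if "\<zeta> \<in> space ?P" for \<zeta> a b
      using insert.prems(2)[OF insertI1 sp[OF that, of a], of a b] by (simp only: fun_upd_upd)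
    have lip_j: "\<bar>f (\<zeta>(j := a, i := y)) - f (\<zeta>(j := b, i := y))\<bar> \<le> l j * \<bar>a - b\<bar>"
      if "\<zeta> \<in> space ?P" "j \<in> I" for \<zeta> a b y j
    proof -
      have "i \<noteq> j" using that insert.hyps by auto
      then show ?thesis
        using insert.prems(2)[OF insertI2[OF that(2)] sp[OF that(1), of y], of a b]
        by (simp only: fun_upd_twist[OF \<open>i \<noteq> j\<close>])
    qed
    \<comment> \<open>Freezing coordinate \<open>i\<close> at \<open>0\<close> gives a function of
      the others, square integrable by induction; the Lipschitz bound in coordinate \<open>i\<close>
      then transfers square integrability to \<open>f\<close>.\<close>
    define f0 where "f0 = (\<lambda>\<zeta>. f (\<zeta>(i := 0)))"
    have f0_meas [measurable]: "f0 \<in> borel_measurable ?P"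
    proof -
      have "(\<lambda>\<zeta>. (\<zeta>, 0::real)) \<in> measurable ?P (?P \<Otimes>\<^sub>M M)"
        by (intro measurable_Pair measurable_ident measurable_const) (simp_all add: space_M)
      from measurable_compose[OF this fj] show ?thesis by (simp add: f0_def)
    qed
    have f0_lip: "\<bar>f0 (\<zeta>(j := a)) - f0 (\<zeta>(j := b))\<bar> \<le> l j * \<bar>a - b\<bar>"
      if "j \<in> I" "\<zeta> \<in> space ?P" for \<zeta> a b j
      unfolding f0_def by (rule lip_j[OF that(2,1)])
    have f0_sq: "integrable ?P (\<lambda>\<zeta>. (f0 \<zeta>)\<^sup>2)"
      by (rule insert.IH[OF f0_meas f0_lip, THEN conjunct1])
    have bound: "(f (\<zeta>(i := y)))\<^sup>2 \<le> 2 * (f0 \<zeta>)\<^sup>2 + 2 * (l i)\<^sup>2 * y\<^sup>2" if "\<zeta> \<in> space ?P" for \<zeta> y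
    proof -
      define d where "d = f (\<zeta>(i := y)) - f0 \<zeta>"
      have "\<bar>d\<bar> \<le> l i * \<bar>y\<bar>" using lip_i[OF that, of y 0] by (simp add: d_def f0_def)
      then have "\<bar>d\<bar>\<^sup>2 \<le> (l i * \<bar>y\<bar>)\<^sup>2" by (intro power_mono) auto
      then have "d\<^sup>2 \<le> (l i)\<^sup>2 * y\<^sup>2" by (simp add: power_mult_distrib)
      moreover have "(f0 \<zeta> + d)\<^sup>2 \<le> 2 * (f0 \<zeta>)\<^sup>2 + 2 * d\<^sup>2"
        using zero_le_power2[of "f0 \<zeta> - d"] by (simp add: power2_eq_square algebra_simps)
      ultimately show ?thesis by (simp add: d_def)
    qed
    have f_sq: "integrable ?P' (\<lambda>\<zeta>. (f \<zeta>)\<^sup>2)"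
    proof (rule integrableI_nonneg)
      have "(\<integral>\<^sup>+\<zeta>. ennreal ((f \<zeta>)\<^sup>2) \<partial>?P') = (\<integral>\<^sup>+\<zeta>. \<integral>\<^sup>+y. ennreal ((f (\<zeta>(i := y)))\<^sup>2) \<partial>M \<partial>?P)"
        by (rule PM.product_nn_integral_insert[OF insert.hyps]) measurable
      also have "\<dots> \<le> (\<integral>\<^sup>+\<zeta>. ennreal (2 * (f0 \<zeta>)\<^sup>2 + 2 * (l i)\<^sup>2 * S) \<partial>?P)"
      proof (rule nn_integral_mono)
        fix \<zeta> assume \<zeta>: "\<zeta> \<in> space ?P"
        have "(\<integral>\<^sup>+y. ennreal ((f (\<zeta>(i := y)))\<^sup>2) \<partial>M) \<le> (\<integral>\<^sup>+y. ennreal (2 * (f0 \<zeta>)\<^sup>2 + 2 * (l i)\<^sup>2 * y\<^sup>2) \<partial>M)"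
          using bound[OF \<zeta>] by (intro nn_integral_mono ennreal_leI)
        also have "\<dots> = ennreal (\<integral>y. 2 * (f0 \<zeta>)\<^sup>2 + 2 * (l i)\<^sup>2 * y\<^sup>2 \<partial>M)"
          using x2 by (intro nn_integral_eq_integral) auto
        also have "(\<integral>y. 2 * (f0 \<zeta>)\<^sup>2 + 2 * (l i)\<^sup>2 * y\<^sup>2 \<partial>M) = 2 * (f0 \<zeta>)\<^sup>2 + 2 * (l i)\<^sup>2 * S"
          using x2 by (simp add: S_def M.prob_space)
        finally show "(\<integral>\<^sup>+y. ennreal ((f (\<zeta>(i := y)))\<^sup>2) \<partial>M) \<le> ennreal (2 * (f0 \<zeta>)\<^sup>2 + 2 * (l i)\<^sup>2 * S)" .
      qed
      also have "\<dots> = ennreal (\<integral>\<zeta>. 2 * (f0 \<zeta>)\<^sup>2 + 2 * (l i)\<^sup>2 * S \<partial>?P)"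
        using f0_sq S0 by (intro nn_integral_eq_integral) auto
      finally show "(\<integral>\<^sup>+\<zeta>. ennreal ((f \<zeta>)\<^sup>2) \<partial>?P') < \<infinity>" by (rule le_less_trans) simp
    qed auto
    have f_int: "integrable ?P' f" by (rule P'.integrable_of_square[OF insert.prems(1) f_sq])
    \<comment> \<open>Averaging over coordinate \<open>i\<close> preserves the Lipschitz constants
      in the other coordinates, so the induction hypothesis bounds the variance of \<open>h\<close>.
      What remains is the conditional variance in coordinate \<open>i\<close>, at most
      \<open>(l i)^2 * S\<close>.\<close>
    define h where "h = (\<lambda>\<zeta>. \<integral>y. f (\<zeta>(i := y)) \<partial>M)"
    have h_meas [measurable]: "h \<in> borel_measurable ?P" unfolding h_def
      by (rule M.borel_measurable_lebesgue_integral) (simp only: case_prod_beta' fj)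
    have sec_sq: "integrable M (\<lambda>y. (f (\<zeta>(i := y)))\<^sup>2)" if \<zeta>: "\<zeta> \<in> space ?P" for \<zeta>
    proof (rule Bochner_Integration.integrable_bound)
      show "integrable M (\<lambda>y. 2 * (f0 \<zeta>)\<^sup>2 + 2 * (l i)\<^sup>2 * y\<^sup>2)" using x2 by auto
      show "AE y in M. norm ((f (\<zeta>(i := y)))\<^sup>2) \<le> norm (2 * (f0 \<zeta>)\<^sup>2 + 2 * (l i)\<^sup>2 * y\<^sup>2)"
        using bound[OF \<zeta>] by (auto simp: abs_of_nonneg)
    qed (use \<zeta> in measurable)
    have sec_int: "integrable M (\<lambda>y. f (\<zeta>(i := y)))" if \<zeta>: "\<zeta> \<in> space ?P" for \<zeta>
      by (rule M.integrable_of_square[OF fsec[OF \<zeta>] sec_sq[OF \<zeta>]])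
    have h_lip: "\<bar>h (\<zeta>(j := a)) - h (\<zeta>(j := b))\<bar> \<le> l j * \<bar>a - b\<bar>"
      if j: "j \<in> I" and \<zeta>: "\<zeta> \<in> space ?P" for \<zeta> j a b
    proof -
      have u: "\<zeta>(j := a) \<in> space ?P" for a
        using \<zeta> j by (auto simp: space_PiM space_M PiE_iff extensional_def)
      have "\<bar>h (\<zeta>(j := a)) - h (\<zeta>(j := b))\<bar> = \<bar>\<integral>y. f (\<zeta>(j := a, i := y)) - f (\<zeta>(j := b, i := y)) \<partial>M\<bar>"
        unfolding h_def using sec_int[OF u] by simp
      also have "\<dots> \<le> (\<integral>y. \<bar>f (\<zeta>(j := a, i := y)) - f (\<zeta>(j := b, i := y))\<bar> \<partial>M)"
        by (rule integral_abs_bound)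
      also have "\<dots> \<le> (\<integral>y. l j * \<bar>a - b\<bar> \<partial>M)"
        using lip_j[OF \<zeta> j] sec_int[OF u] by (intro integral_mono) auto
      finally show ?thesis by (simp add: M.prob_space)
    qed
    have h1: "integrable ?P (\<lambda>\<zeta>. (h \<zeta>)\<^sup>2)"
      by (rule insert.IH[OF h_meas h_lip, THEN conjunct1])
    have h2: "var ?P h \<le> (\<Sum>i\<in>I. (l i)\<^sup>2 * S)"
      by (rule insert.IH[OF h_meas h_lip, THEN conjunct2])
    note h = h1 h2
    have sec_var: "(\<integral>y. (f (\<zeta>(i := y)))\<^sup>2 \<partial>M) \<le> (l i)\<^sup>2 * S + (h \<zeta>)\<^sup>2" if \<zeta>: "\<zeta> \<in> space ?P" for \<zeta>
    proof -
      have "var M (\<lambda>y. f (\<zeta>(i := y))) \<le> (\<integral>y. (f (\<zeta>(i := y)) - f0 \<zeta>)\<^sup>2 \<partial>M)"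
        by (rule M.var_le[OF fsec[OF \<zeta>] sec_sq[OF \<zeta>]])
      also have "\<dots> \<le> (\<integral>y. (l i)\<^sup>2 * y\<^sup>2 \<partial>M)"
      proof (rule integral_mono)
        show "integrable M (\<lambda>y. (f (\<zeta>(i := y)) - f0 \<zeta>)\<^sup>2)"
          by (rule M.integral_square_shift(2)[OF fsec[OF \<zeta>] sec_sq[OF \<zeta>]])
        fix y
        have "\<bar>f (\<zeta>(i := y)) - f0 \<zeta>\<bar>\<^sup>2 \<le> (l i * \<bar>y\<bar>)\<^sup>2"
          using lip_i[OF \<zeta>, of y 0] by (intro power_mono) (auto simp: f0_def)
        then show "(f (\<zeta>(i := y)) - f0 \<zeta>)\<^sup>2 \<le> (l i)\<^sup>2 * y\<^sup>2" by (simp add: power_mult_distrib)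
      qed (use x2 in auto)
      finally show ?thesis by (simp add: var_def h_def S_def)
    qed
    have "(\<integral>\<zeta>. (f \<zeta>)\<^sup>2 \<partial>?P') = (\<integral>\<zeta>. \<integral>y. (f (\<zeta>(i := y)))\<^sup>2 \<partial>M \<partial>?P)"
      by (rule PM.product_integral_insert[OF insert.hyps f_sq])
    also have "\<dots> \<le> (\<integral>\<zeta>. (l i)\<^sup>2 * S + (h \<zeta>)\<^sup>2 \<partial>?P)"
    proof (rule integral_mono_AE)
      have [measurable]: "(\<lambda>\<zeta>. \<integral>y. (f (\<zeta>(i := y)))\<^sup>2 \<partial>M) \<in> borel_measurable ?P"
        by (rule M.borel_measurable_lebesgue_integral) (simp only: case_prod_beta' borel_measurable_power[OF fj])
      show "integrable ?P (\<lambda>\<zeta>. \<integral>y. (f (\<zeta>(i := y)))\<^sup>2 \<partial>M)"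
      proof (rule Bochner_Integration.integrable_bound)
        show "integrable ?P (\<lambda>\<zeta>. (l i)\<^sup>2 * S + (h \<zeta>)\<^sup>2)" using h by auto
        have "\<bar>\<integral>y. (f (\<zeta>(i := y)))\<^sup>2 \<partial>M\<bar> \<le> \<bar>(l i)\<^sup>2 * S + (h \<zeta>)\<^sup>2\<bar>" if "\<zeta> \<in> space ?P" for \<zeta>
        proof -
          have "0 \<le> (\<integral>y. (f (\<zeta>(i := y)))\<^sup>2 \<partial>M)" by simp
          then show ?thesis using sec_var[OF that] by linarith
        qed
        then show "AE \<zeta> in ?P. norm (\<integral>y. (f (\<zeta>(i := y)))\<^sup>2 \<partial>M) \<le> norm ((l i)\<^sup>2 * S + (h \<zeta>)\<^sup>2)"
          by (intro AE_I2) simp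
      qed measurable
      show "integrable ?P (\<lambda>\<zeta>. (l i)\<^sup>2 * S + (h \<zeta>)\<^sup>2)" using h by auto
      show "AE \<zeta> in ?P. (\<integral>y. (f (\<zeta>(i := y)))\<^sup>2 \<partial>M) \<le> (l i)\<^sup>2 * S + (h \<zeta>)\<^sup>2"
        using sec_var by (intro AE_I2)
    qed
    also have "\<dots> = (l i)\<^sup>2 * S + (\<integral>\<zeta>. (h \<zeta>)\<^sup>2 \<partial>?P)" using h by (simp add: P.prob_space)
    finally have 1: "(\<integral>\<zeta>. (f \<zeta>)\<^sup>2 \<partial>?P') \<le> (l i)\<^sup>2 * S + (\<integral>\<zeta>. (h \<zeta>)\<^sup>2 \<partial>?P)" .
    have 2: "(\<integral>\<zeta>. f \<zeta> \<partial>?P') = (\<integral>\<zeta>. h \<zeta> \<partial>?P)"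
      unfolding h_def by (rule PM.product_integral_insert[OF insert.hyps f_int])
    show ?case using f_sq 1 h(2) insert.hyps by (simp add: var_def 2)
  qed
  then show "integrable (PiM I (\<lambda>_. M)) (\<lambda>\<zeta>. (f \<zeta>)\<^sup>2)"
    "var (PiM I (\<lambda>_. M)) f \<le> (\<Sum>i\<in>I. (l i)\<^sup>2 * (\<integral>x. x\<^sup>2 \<partial>M))"
    by (auto simp: S_def)
qed

section \<open>The free energy of the matrix model\<close>

text \<open>Let \<open>m i\<close> be the Gibbs means, \<open>c i j\<close> the second moments and
  \<open>S\<close> the sum of the \<open>(m i)^2\<close>. Positivity of the covariance matrix,
  tested on the vector \<open>m\<close>, shows that \<open>S^2\<close> is at most the sum of the
  \<open>(c i j)^2\<close>. The claim is then the completed square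
  \<open>(S - N * q)^2 / N \<ge> 0\<close>, whose leftover \<open>N * q^2\<close> becomes the
  Hopf--Lax cost.\<close>

lemma (in prob_space) gibbs_overlap_bound:
  fixes x :: "nat \<Rightarrow> 'a \<Rightarrow> real"
  assumes B: "bounded_meas M B" and x: "\<And>i. i < N \<Longrightarrow> bounded_meas M (x i)" and N: "N > 0"
  shows "(\<Sum>i<N. (\<Sum>j<N. (gibbs M B (\<lambda>\<xi>. x i \<xi> * x j \<xi>))\<^sup>2) / N - 2 * q * (gibbs M B (x i))\<^sup>2) \<ge> - (N * q\<^sup>2)"
proof -
  define m where "m = (\<lambda>i. gibbs M B (x i))"
  define c where "c = (\<lambda>i j. gibbs M B (\<lambda>\<xi>. x i \<xi> * x j \<xi>))"
  define S where "S = (\<Sum>i<N. (m i)\<^sup>2)"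
  have "gibbs M B (\<lambda>\<xi>. \<Sum>i<N. m i * x i \<xi>) = S"
    unfolding S_def by (subst gibbs_sum[OF B])
      (auto intro!: bounded_meas_cmult x simp: gibbs_cmult m_def power2_eq_square)
  moreover have "gibbs M B (\<lambda>\<xi>. (\<Sum>i<N. m i * x i \<xi>)\<^sup>2) = (\<Sum>i<N. \<Sum>j<N. m i * m j * c i j)"
  proof -
    have "gibbs M B (\<lambda>\<xi>. (\<Sum>i<N. m i * x i \<xi>)\<^sup>2) =
      gibbs M B (\<lambda>\<xi>. \<Sum>i<N. \<Sum>j<N. (m i * m j) * (x i \<xi> * x j \<xi>))"
      by (simp add: power2_eq_square sum_product mult_ac)
    also have "\<dots> = (\<Sum>i<N. \<Sum>j<N. gibbs M B (\<lambda>\<xi>. (m i * m j) * (x i \<xi> * x j \<xi>)))"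
      by (subst gibbs_sum[OF B], (intro bounded_meas_intros x, simp, simp))
        (intro sum.cong refl gibbs_sum[OF B] bounded_meas_intros x, auto)
    finally show ?thesis by (simp add: gibbs_cmult c_def)
  qed
  moreover have "(gibbs M B (\<lambda>\<xi>. \<Sum>i<N. m i * x i \<xi>))\<^sup>2 \<le> gibbs M B (\<lambda>\<xi>. (\<Sum>i<N. m i * x i \<xi>)\<^sup>2)"
    by (intro gibbs_square B bounded_meas_sum bounded_meas_cmult x) auto
  ultimately have 1: "S\<^sup>2 \<le> (\<Sum>i<N. \<Sum>j<N. m i * m j * c i j)" by simp
  have "0 \<le> (\<Sum>i<N. \<Sum>j<N. (c i j - m i * m j)\<^sup>2)" by (intro sum_nonneg) auto
  also have "\<dots> = (\<Sum>i<N. \<Sum>j<N. (c i j)\<^sup>2) - 2 * (\<Sum>i<N. \<Sum>j<N. m i * m j * c i j) + (\<Sum>i<N. \<Sum>j<N. (m i)\<^sup>2 * (m j)\<^sup>2)"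
    by (simp add: power2_diff sum.distrib sum_subtractf sum_distrib_left power_mult_distrib mult_ac)
  also have "(\<Sum>i<N. \<Sum>j<N. (m i)\<^sup>2 * (m j)\<^sup>2) = S\<^sup>2"
    unfolding S_def by (simp add: sum_product[symmetric] power2_eq_square)
  finally have 2: "S\<^sup>2 \<le> (\<Sum>i<N. \<Sum>j<N. (c i j)\<^sup>2)" using 1 by linarith
  have "0 \<le> (S - N * q)\<^sup>2 / N" by simp
  also have "\<dots> = S\<^sup>2 / N - 2 * q * S + N * q\<^sup>2"
    using N by (simp add: power2_eq_square field_simps)
  also have "\<dots> \<le> (\<Sum>i<N. \<Sum>j<N. (c i j)\<^sup>2) / N - 2 * q * S + N * q\<^sup>2"
    using 2 by (simp add: divide_right_mono)
  also have "\<dots> = (\<Sum>i<N. (\<Sum>j<N. (c i j)\<^sup>2) / N - 2 * q * (m i)\<^sup>2) + N * q\<^sup>2"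
    by (simp add: S_def sum_subtractf sum_divide_distrib sum_distrib_left)
  finally show ?thesis by (simp add: m_def c_def)
qed

context gaussian_observation
begin

lemma L_component_lip:
  assumes y: "y \<in> space Q" and k: "k \<in> I" and D: "\<And>x. x \<in> space \<nu> \<Longrightarrow> \<bar>a k x\<bar> \<le> D"
  shows "\<bar>L v y (g(k := s)) - L v y (g(k := r))\<bar> \<le> \<bar>v k\<bar> * D * \<bar>s - r\<bar>"
proof (rule nu.ln_pf_lip[OF bm_H[OF y] bm_H[OF y]])
  fix x assume x: "x \<in> space \<nu>"
  have "H v y (g(k := s)) x - H v y (g(k := r)) x =
    (\<Sum>i\<in>I. v i * ((if i = k then s else g i) * a i x) - v i * ((if i = k then r else g i) * a i x))"
    unfolding obs_energy_def by (simp add: sum.distrib sum_subtractf)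
  also have "\<dots> = (\<Sum>i\<in>I. if i = k then v k * a k x * (s - r) else 0)"
    by (intro sum.cong) (auto simp: algebra_simps)
  also have "\<dots> = v k * a k x * (s - r)" using k fin by simp
  finally show "\<bar>H v y (g(k := s)) x - H v y (g(k := r)) x\<bar> \<le> \<bar>v k\<bar> * D * \<bar>s - r\<bar>"
    using D[OF x] by (simp add: abs_mult mult_left_mono mult_right_mono)
qed

lemma L_sec_meas [measurable]: "y \<in> space Q \<Longrightarrow> L v y \<in> borel_measurable G"
proof -
  assume y: "y \<in> space Q"
  have "(\<lambda>p. L v (fst p) (snd p)) \<in> borel_measurable (Q \<Otimes>\<^sub>M G)" by measurable
  from measurable_compose[OF measurable_Pair1'[OF y] this] show ?thesis by simp
qed

text \<open>Conditionally on the signal, the Gaussian coordinates contribute through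
  \<open>var_PiM_lipschitz\<close>. The feature bound \<open>D\<close> is kept apart from
  \<open>A\<close>, which also bounds the side information and in the application grows with
  \<open>N\<close>.\<close>

lemma
  assumes D: "\<And>k x. k \<in> I \<Longrightarrow> x \<in> space \<nu> \<Longrightarrow> \<bar>a k x\<bar> \<le> D"
    and v1: "var Q (\<lambda>y. \<integral>g. L v y g \<partial>G) \<le> v1"
  shows L_square_integrable: "integrable (Q \<Otimes>\<^sub>M G) (\<lambda>p. (L v (fst p) (snd p))\<^sup>2)"
    and var_L_le: "var (Q \<Otimes>\<^sub>M G) (\<lambda>p. L v (fst p) (snd p)) \<le> v1 + (\<Sum>k\<in>I. (v k)\<^sup>2 * D\<^sup>2)"
proof -
  have Lm [measurable]: "(\<lambda>p. L v (fst p) (snd p)) \<in> borel_measurable (Q \<Otimes>\<^sub>M G)" by measurable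
  define V where "V = (\<Sum>k\<in>I. (v k)\<^sup>2 * D\<^sup>2)"
  note ES = var_PiM_lipschitz[OF prob_space_gauss sets_gauss integrable_gauss_power fin L_sec_meas
      L_component_lip[OF _ _ D]]
  have sq: "integrable G (\<lambda>g. (L v y g)\<^sup>2)" "var G (L v y) \<le> V" if y: "y \<in> space Q" for y
    using ES[OF y y] by (auto simp: V_def gauss_second_moment power_mult_distrib)
  define B where "B = (\<integral>g. Hbd v g \<partial>G)"
  have Hbd_int: "integrable G (Hbd v)" unfolding Hbd_def
    by (intro Bochner_Integration.integrable_add Bochner_Integration.integrable_sum integrable_mult_right
          integrable_mult_left G_comp_integrable) auto
  have mean: "\<bar>\<integral>g. L v y g \<partial>G\<bar> \<le> B" if y: "y \<in> space Q" for y
  proof -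
    have "\<bar>\<integral>g. L v y g \<partial>G\<bar> \<le> (\<integral>g. \<bar>L v y g\<bar> \<partial>G)" by (rule integral_abs_bound)
    also have "\<dots> \<le> B" unfolding B_def
      using L_abs_le[OF y] G.integrable_of_square[OF L_sec_meas[OF y] sq(1)[OF y]] Hbd_int
      by (intro integral_mono) auto
    finally show ?thesis .
  qed
  have B2: "(\<integral>g. L v y g \<partial>G)\<^sup>2 \<le> B\<^sup>2" if "y \<in> space Q" for y
    using mean[OF that] power_mono[of "\<bar>\<integral>g. L v y g \<partial>G\<bar>" B 2] by simp
  have nn: "(\<integral>\<^sup>+p. ennreal ((L v (fst p) (snd p))\<^sup>2) \<partial>(Q \<Otimes>\<^sub>M G)) < \<infinity>"
  proof -
    have "(\<integral>\<^sup>+p. ennreal ((L v (fst p) (snd p))\<^sup>2) \<partial>(Q \<Otimes>\<^sub>M G)) =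
      (\<integral>\<^sup>+y. \<integral>\<^sup>+g. ennreal ((L v y g)\<^sup>2) \<partial>G \<partial>Q)"
      by (subst G.nn_integral_fst[symmetric]) auto
    also have "\<dots> \<le> (\<integral>\<^sup>+y. ennreal (V + B\<^sup>2) \<partial>Q)"
    proof (rule nn_integral_mono)
      fix y assume y: "y \<in> space Q"
      have "(\<integral>\<^sup>+g. ennreal ((L v y g)\<^sup>2) \<partial>G) = ennreal (\<integral>g. (L v y g)\<^sup>2 \<partial>G)"
        using sq(1)[OF y] by (intro nn_integral_eq_integral) auto
      also have "\<dots> \<le> ennreal (V + B\<^sup>2)"
        using sq(2)[OF y] B2[OF y] by (intro ennreal_leI) (simp add: var_def)
      finally show "(\<integral>\<^sup>+g. ennreal ((L v y g)\<^sup>2) \<partial>G) \<le> ennreal (V + B\<^sup>2)" .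
    qed
    also have "\<dots> < \<infinity>" by (simp add: Q.emeasure_space_1)
    finally show ?thesis .
  qed
  show f2: "integrable (Q \<Otimes>\<^sub>M G) (\<lambda>p. (L v (fst p) (snd p))\<^sup>2)"
    using nn by (intro integrableI_nonneg) auto
  have hm: "(\<lambda>y. \<integral>g. L v y g \<partial>G) \<in> borel_measurable Q"
    using Lm by (intro G.borel_measurable_lebesgue_integral) (simp add: case_prod_beta')
  have "integrable Q (\<lambda>y. (\<integral>g. L v y g \<partial>G)\<^sup>2)"
    using hm B2 by (intro Q.integrable_const_bound[of _ "B\<^sup>2"] AE_I2) auto
  from QG.var_pair_le[OF Lm f2 this sq(2) v1]
  show "var (Q \<Otimes>\<^sub>M G) (\<lambda>p. L v (fst p) (snd p)) \<le> v1 + (\<Sum>k\<in>I. (v k)\<^sup>2 * D\<^sup>2)"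
    by (simp add: V_def)
qed

end

text \<open>When \<open>K\<close> bounds the prior almost surely, this leaves almost every
  configuration unchanged, while energies of truncated coordinates are bounded at every
  point.\<close>

definition clip :: "real \<Rightarrow> real \<Rightarrow> real" where
  "clip K x = max (- K) (min K x)"

lemma clip_measurable [measurable]: "clip K \<in> borel_measurable borel"
  unfolding clip_def by measurable

lemma clip_abs_le: "K \<ge> 0 \<Longrightarrow> \<bar>clip K x\<bar> \<le> K"
  by (auto simp: clip_def)

lemma clip_lip: "\<bar>clip K x - clip K y\<bar> \<le> \<bar>x - y\<bar>"
  by (auto simp: clip_def max_def min_def)

lemma clip_id: "\<bar>x\<bar> \<le> K \<Longrightarrow> clip K x = x"
  by (auto simp: clip_def)

section \<open>Channels, overlaps and side information of the matrix model\<close>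

definition obs_idx :: "nat \<Rightarrow> (nat \<times> nat) set" where
  "obs_idx N = {..<N} \<times> {..N}"

text \<open>The index \<open>(i, j)\<close> with \<open>j < N\<close> stands for \<open>W\<^sub>i\<^sub>j\<close>, the index \<open>(i, N)\<close> for \<open>z\<^sub>i\<close>.\<close>

definition spin :: "real \<Rightarrow> nat \<Rightarrow> nat \<times> nat \<Rightarrow> (nat \<Rightarrow> real) \<Rightarrow> real" where
  "spin K N k x = (if fst k < N then clip K (x (fst k)) * (if snd k < N then clip K (x (snd k)) else 1) else 0)"

definition coef :: "nat \<Rightarrow> real \<Rightarrow> real \<Rightarrow> nat \<times> nat \<Rightarrow> real" where
  "coef N t r k = (if snd k < N then sqrt (t / N) else sqrt r)"

definition ovl :: "real \<Rightarrow> nat \<Rightarrow> (nat \<Rightarrow> real) \<Rightarrow> (nat \<Rightarrow> real) \<Rightarrow> real" where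
  "ovl K N y x = (\<Sum>i<N. clip K (y i) * clip K (x i))"

text \<open>The part of the log-likelihood that sees the signal \<open>y\<close>, with coefficients
  independent of the channel strengths. Taking \<open>u = t\<close> and \<open>\<rho> = r\<close>
  gives the planted model; \<open>u = 0\<close> leaves a purely linear tilt.\<close>

definition side :: "real \<Rightarrow> nat \<Rightarrow> real \<Rightarrow> real \<Rightarrow> (nat \<Rightarrow> real) \<Rightarrow> (nat \<Rightarrow> real) \<Rightarrow> real" where
  "side K N u \<rho> y x = u / N * (ovl K N y x)\<^sup>2 + \<rho> * ovl K N y x"

lemma sum_obs_idx: "(\<Sum>k\<in>obs_idx N. f k) = (\<Sum>i<N. (\<Sum>j<N. f (i, j)) + f (i, N))"
proof -
  have "(\<Sum>k\<in>obs_idx N. f k) = (\<Sum>i<N. \<Sum>j\<le>N. f (i, j))"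
    unfolding obs_idx_def by (simp add: sum.cartesian_product)
  then show ?thesis by (simp add: lessThan_Suc_atMost[symmetric])
qed

text \<open>Summed over all channels, the planted terms see the signal only through the overlap,
  since the sum over \<open>i, j\<close> of \<open>y i * y j * x i * x j\<close> is a square. So the
  planted model is also an unplanted one with side information.\<close>

lemma planted_energy_eq:
  assumes "t \<ge> 0" "r \<ge> 0"
  shows "obs_energy (obs_idx N) (spin K N) (spin K N) (\<lambda>_ _. 0) (coef N t r) y g x =
    obs_energy (obs_idx N) (spin K N) (\<lambda>_ _. 0) (side K N t r) (coef N t r) y g x"
proof -
  have "(\<Sum>k\<in>obs_idx N. (coef N t r k)\<^sup>2 * (spin K N k y * spin K N k x)) = side K N t r y x"
    using assms unfolding sum_obs_idx
    by (simp add: coef_def spin_def side_def ovl_def sum.distrib power2_eq_square sum_product sum_distrib_left mult_ac)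
  then show ?thesis unfolding obs_energy_def
    by (simp add: right_diff_distrib sum.distrib sum_subtractf)
qed

lemma energy_explicit:
  assumes "t \<ge> 0" "r \<ge> 0"
  shows "obs_energy (obs_idx N) (spin K N) (\<lambda>_ _. 0) (side K N u \<rho>) (coef N t r) y g x =
    side K N u \<rho> y x + sqrt (t / N) * (\<Sum>i<N. \<Sum>j<N. clip K (x i) * g (i, j) * clip K (x j))
    - t / (2 * N) * (ovl K N x x)\<^sup>2 + sqrt r * (\<Sum>i<N. g (i, N) * clip K (x i)) - r / 2 * ovl K N x x"
proof -
  have 1: "(\<Sum>k\<in>obs_idx N. coef N t r k * (g k * spin K N k x)) =
    sqrt (t / N) * (\<Sum>i<N. \<Sum>j<N. clip K (x i) * g (i, j) * clip K (x j)) + sqrt r * (\<Sum>i<N. g (i, N) * clip K (x i))"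
    unfolding sum_obs_idx by (simp add: coef_def spin_def sum.distrib sum_distrib_left mult_ac)
  have 2: "(\<Sum>k\<in>obs_idx N. (coef N t r k)\<^sup>2 * ((spin K N k x)\<^sup>2 / 2)) =
    t / (2 * N) * (ovl K N x x)\<^sup>2 + r / 2 * ovl K N x x"
    using assms unfolding sum_obs_idx
    by (simp add: coef_def spin_def ovl_def sum.distrib power2_eq_square sum_product sum_distrib_left mult_ac)
  have 3: "(\<Sum>k\<in>obs_idx N. coef N t r k * (g k * spin K N k x) + (coef N t r k)\<^sup>2 * (0 * spin K N k x - (spin K N k x)\<^sup>2 / 2)) =
    (\<Sum>k\<in>obs_idx N. coef N t r k * (g k * spin K N k x)) - (\<Sum>k\<in>obs_idx N. (coef N t r k)\<^sup>2 * ((spin K N k x)\<^sup>2 / 2))"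
    unfolding sum_subtractf[symmetric] by (intro sum.cong) auto
  show ?thesis unfolding obs_energy_def 3 1 2 by simp
qed

locale bounded_prior = prob_space P for P :: "real measure" +
  fixes K :: real
  assumes sets_P [measurable_cong]: "sets P = sets borel"
    and K1: "K \<ge> 1" and bdd: "AE x in P. \<bar>x\<bar> \<le> K"
begin

abbreviation PN :: "nat \<Rightarrow> (nat \<Rightarrow> real) measure" where "PN N \<equiv> PiM {..<N} (\<lambda>_. P)"
abbreviation GN :: "nat \<Rightarrow> (nat \<times> nat \<Rightarrow> real) measure" where "GN N \<equiv> gauss_vec (obs_idx N)"

lemma prob_PN: "prob_space (PN N)"
  by (intro prob_space_PiM prob_space_axioms)

lemma space_P: "space P = UNIV"
  using sets_eq_imp_space_eq[OF sets_P] by simp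

lemma clip_le: "\<bar>clip K x\<bar> \<le> K"
  using K1 by (intro clip_abs_le) simp

lemma clip_comp_meas [measurable]: "i < N \<Longrightarrow> (\<lambda>x. clip K (x i)) \<in> borel_measurable (PN N)"
  by measurable

lemma K_le_sq: "K \<le> K\<^sup>2"
  using K1 mult_left_mono[of 1 K K] by (simp add: power2_eq_square)

lemma clip_mult_le: "\<bar>clip K x * clip K y\<bar> \<le> K\<^sup>2"
  unfolding abs_mult power2_eq_square using clip_le K1 by (intro mult_mono) auto

lemma spin_le: "\<bar>spin K N k x\<bar> \<le> K\<^sup>2"
  using clip_mult_le clip_le[of "x (fst k)"] K_le_sq by (auto simp: spin_def)

lemma spin_meas [measurable]: "spin K N k \<in> borel_measurable (PN N)"
proof -
  consider "\<not> fst k < N" | "fst k < N" "snd k < N" | "fst k < N" "\<not> snd k < N" by blast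
  then show ?thesis
  proof cases
    case 1
    then have "spin K N k = (\<lambda>x. 0)" by (auto simp: spin_def)
    then show ?thesis by simp
  next
    case 2
    then have "spin K N k = (\<lambda>x. clip K (x (fst k)) * clip K (x (snd k)))" by (auto simp: spin_def)
    then show ?thesis using 2 by simp
  next
    case 3
    then have "spin K N k = (\<lambda>x. clip K (x (fst k)))" by (auto simp: spin_def)
    then show ?thesis using 3 by simp
  qed
qed

lemma planted: "planted_observation (PN N) (obs_idx N) (spin K N) (K\<^sup>2)"
  by (intro planted_observation.intro planted_observation_axioms.intro prob_PN spin_meas spin_le)
    (auto simp: obs_idx_def)

lemma ovl_le: "\<bar>ovl K N y x\<bar> \<le> N * K\<^sup>2"
proof -
  have "\<bar>ovl K N y x\<bar> \<le> (\<Sum>i<N. K\<^sup>2)" unfolding ovl_def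
    by (intro order_trans[OF sum_abs] sum_mono clip_mult_le)
  then show ?thesis by simp
qed

definition side_bd :: "nat \<Rightarrow> real \<Rightarrow> real \<Rightarrow> real" where
  "side_bd N u \<rho> = \<bar>u / N\<bar> * (N * K\<^sup>2)\<^sup>2 + \<bar>\<rho>\<bar> * (N * K\<^sup>2)"

lemma side_le: "\<bar>side K N u \<rho> y x\<bar> \<le> side_bd N u \<rho>"
proof -
  have "\<bar>u / N * (ovl K N y x)\<^sup>2\<bar> \<le> \<bar>u / N\<bar> * (N * K\<^sup>2)\<^sup>2"
    unfolding abs_mult using ovl_le[of N y x] K1
    by (intro mult_left_mono) (auto simp: power2_le_iff_abs_le)
  moreover have "\<bar>\<rho> * ovl K N y x\<bar> \<le> \<bar>\<rho>\<bar> * (N * K\<^sup>2)"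
    unfolding abs_mult using ovl_le by (intro mult_left_mono) auto
  ultimately show ?thesis unfolding side_def side_bd_def by linarith
qed

lemma ovl_meas [measurable]: "(\<lambda>p. ovl K N (fst p) (snd p)) \<in> borel_measurable (PN N \<Otimes>\<^sub>M PN N)"
  unfolding ovl_def by (intro borel_measurable_sum) measurable

lemma side_bd_nonneg: "0 \<le> side_bd N u \<rho>"
  unfolding side_bd_def using K1 by simp

lemma unplanted: "gaussian_observation (PN N) (PN N) (obs_idx N) (spin K N) (\<lambda>_ _. 0)
    (side K N u \<rho>) (K\<^sup>2 + side_bd N u \<rho>)"
proof (intro gaussian_observation.intro gaussian_observation_axioms.intro prob_PN)
  show "finite (obs_idx N)" by (simp add: obs_idx_def)
  show "0 \<le> K\<^sup>2 + side_bd N u \<rho>" using side_bd_nonneg by simp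
  show "(\<lambda>p. side K N u \<rho> (fst p) (snd p)) \<in> borel_measurable (PN N \<Otimes>\<^sub>M PN N)"
    unfolding side_def by measurable
  show "\<bar>spin K N k x\<bar> \<le> K\<^sup>2 + side_bd N u \<rho>" for k x
    using spin_le[of N k x] side_bd_nonneg[of N u \<rho>] by linarith
  show "\<bar>side K N u \<rho> y x\<bar> \<le> K\<^sup>2 + side_bd N u \<rho>" for y x
    using side_le[of N u \<rho> y x] by (simp add: add_increasing)
qed (use side_bd_nonneg in auto)

definition logZ :: "nat \<Rightarrow> real \<Rightarrow> real \<Rightarrow> real \<Rightarrow> real \<Rightarrow> (nat \<Rightarrow> real) \<Rightarrow> (nat \<times> nat \<Rightarrow> real) \<Rightarrow> real" where
  "logZ N t r u \<rho> y g =
    ln (pf (PN N) (obs_energy (obs_idx N) (spin K N) (\<lambda>_ _. 0) (side K N u \<rho>) (coef N t r) y g))"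

definition meanZ :: "nat \<Rightarrow> real \<Rightarrow> real \<Rightarrow> real \<Rightarrow> real \<Rightarrow> real" where
  "meanZ N t r u \<rho> = (\<integral>p. logZ N t r u \<rho> (fst p) (snd p) \<partial>(PN N \<Otimes>\<^sub>M GN N))"

text \<open>Strengths enter the energy squared, and here the squares are affine in \<open>s\<close>:
  from \<open>0\<close> to \<open>t / N\<close> for the matrix, from \<open>r0\<close> to
  \<open>r1\<close> for the vector. So \<open>interp * interp'\<close>, half the derivative of the
  square, does not depend on \<open>s\<close>.\<close>

definition interp :: "nat \<Rightarrow> real \<Rightarrow> real \<Rightarrow> real \<Rightarrow> nat \<times> nat \<Rightarrow> real \<Rightarrow> real" where
  "interp N t r0 r1 k s = (if snd k < N then sqrt (t / N) * sqrt s else sqrt ((1 - s) * r0 + s * r1))"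

definition interp' :: "nat \<Rightarrow> real \<Rightarrow> real \<Rightarrow> real \<Rightarrow> nat \<times> nat \<Rightarrow> real \<Rightarrow> real" where
  "interp' N t r0 r1 k s = (if snd k < N then sqrt (t / N) * (inverse (sqrt s) / 2)
     else if r0 = 0 \<and> r1 = 0 then 0 else (r1 - r0) * (inverse (sqrt ((1 - s) * r0 + s * r1)) / 2))"

lemma interp_ends: "(\<lambda>k. interp N t r0 r1 k 1) = coef N t r1" "(\<lambda>k. interp N t r0 r1 k 0) = coef N 0 r0"
  by (auto simp: interp_def coef_def)

lemma interp_continuous: "continuous_on {0..1} (interp N t r0 r1 k)"
proof (cases "snd k < N")
  case True
  then show ?thesis unfolding interp_def by (auto intro!: continuous_intros)
next
  case False
  then show ?thesis unfolding interp_def by (auto intro!: continuous_intros)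
qed

lemma interp_arg_pos:
  assumes "r0 \<ge> 0" "r1 \<ge> 0" "\<not> (r0 = 0 \<and> r1 = 0)" "0 < s" "s < (1::real)"
  shows "(1 - s) * r0 + s * r1 > 0"
  using assms by (cases "r0 = 0") (auto intro: add_pos_nonneg)

lemma interp_deriv:
  assumes r: "r0 \<ge> 0" "r1 \<ge> 0" and s: "0 < s" "s < 1"
  shows "(interp N t r0 r1 k has_real_derivative interp' N t r0 r1 k s) (at s)"
    "isCont (interp' N t r0 r1 k) s"
    "interp N t r0 r1 k s * interp' N t r0 r1 k s = (if snd k < N then sqrt (t / N) * sqrt (t / N) / 2 else (r1 - r0) / 2)"
proof -
  have sq: "sqrt s * inverse (sqrt s) = 1" using s by simp
  consider (W) "snd k < N" | (zero) "\<not> snd k < N" "r0 = 0 \<and> r1 = 0" | (z) "\<not> snd k < N" "\<not> (r0 = 0 \<and> r1 = 0)"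
    by blast
  then have "(interp N t r0 r1 k has_real_derivative interp' N t r0 r1 k s) (at s) \<and> isCont (interp' N t r0 r1 k) s \<and>
    interp N t r0 r1 k s * interp' N t r0 r1 k s = (if snd k < N then sqrt (t / N) * sqrt (t / N) / 2 else (r1 - r0) / 2)"
  proof cases
    case W
    have e: "interp N t r0 r1 k = (\<lambda>s. sqrt (t / N) * sqrt s)"
      "interp' N t r0 r1 k = (\<lambda>s. sqrt (t / N) * (inverse (sqrt s) / 2))"
      using W by (auto simp: interp_def interp'_def)
    have "((\<lambda>s. sqrt (t / N) * sqrt s) has_real_derivative sqrt (t / N) * (inverse (sqrt s) / 2)) (at s)"
      by (rule DERIV_cmult[OF DERIV_real_sqrt]) (rule s)
    moreover have "isCont (\<lambda>s. sqrt (t / N) * (inverse (sqrt s) / 2)) s"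
      using s by (intro continuous_intros) auto
    moreover have "sqrt (t / N) * sqrt s * (sqrt (t / N) * (inverse (sqrt s) / 2)) =
      sqrt (t / N) * sqrt (t / N) / 2 * (sqrt s * inverse (sqrt s))" by (simp add: mult_ac)
    ultimately show ?thesis using W sq unfolding e by simp
  next
    case zero
    then have "interp N t r0 r1 k = (\<lambda>s. 0)" "interp' N t r0 r1 k = (\<lambda>s. 0)"
      by (auto simp: interp_def interp'_def)
    then show ?thesis using zero by simp
  next
    case z
    have e: "interp N t r0 r1 k = (\<lambda>s. sqrt ((1 - s) * r0 + s * r1))"
      "interp' N t r0 r1 k = (\<lambda>s. (r1 - r0) * (inverse (sqrt ((1 - s) * r0 + s * r1)) / 2))"
      using z by (auto simp: interp_def interp'_def)
    have pos: "(1 - s) * r0 + s * r1 > 0" using interp_arg_pos[OF r z(2) s] .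
    have "((\<lambda>s. (1 - s) * r0 + s * r1) has_real_derivative r1 - r0) (at s)"
      by (auto intro!: derivative_eq_intros)
    from DERIV_chain2[OF DERIV_real_sqrt[OF pos] this]
    have "((\<lambda>s. sqrt ((1 - s) * r0 + s * r1)) has_real_derivative (r1 - r0) * (inverse (sqrt ((1 - s) * r0 + s * r1)) / 2)) (at s)"
      by (simp add: mult.commute)
    moreover have "isCont (\<lambda>s. (r1 - r0) * (inverse (sqrt ((1 - s) * r0 + s * r1)) / 2)) s"
      using pos by (intro continuous_intros) auto
    moreover have "sqrt ((1 - s) * r0 + s * r1) * inverse (sqrt ((1 - s) * r0 + s * r1)) = 1" using pos by simp
    then have "sqrt ((1 - s) * r0 + s * r1) * ((r1 - r0) * (inverse (sqrt ((1 - s) * r0 + s * r1)) / 2)) = (r1 - r0) / 2"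
      by (simp add: mult.left_commute)
    ultimately show ?thesis using z unfolding e by simp
  qed
  then show "(interp N t r0 r1 k has_real_derivative interp' N t r0 r1 k s) (at s)" "isCont (interp' N t r0 r1 k) s"
    "interp N t r0 r1 k s * interp' N t r0 r1 k s = (if snd k < N then sqrt (t / N) * sqrt (t / N) / 2 else (r1 - r0) / 2)"
    by auto
qed

lemma interp_sum:
  assumes "t \<ge> 0" "r0 \<ge> 0" "r1 \<ge> 0" "0 < s" "s < 1"
  shows "(\<Sum>k\<in>obs_idx N. interp N t r0 r1 k s * interp' N t r0 r1 k s * (F k)\<^sup>2) =
    (\<Sum>i<N. (\<Sum>j<N. t / (2 * real N) * (F (i, j))\<^sup>2) + (r1 - r0) / 2 * (F (i, N))\<^sup>2)"
  using assms unfolding sum_obs_idx interp_deriv(3)[OF assms(2-5)] by (simp add: mult.commute)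

text \<open>The vector channel loses \<open>2 * t * q\<close> while the matrix channel gains
  \<open>t\<close>. With these rates the sum is \<open>t / 2\<close> times the expression in
  \<open>gibbs_overlap_bound\<close>.\<close>

lemma overlap_sum_ge:
  assumes N: "N > 0" and t: "t \<ge> 0" and B: "bounded_meas (PN N) B" and r: "r1 - r0 = - 2 * t * q"
  shows "(\<Sum>i<N. (\<Sum>j<N. t / (2 * real N) * (gibbs (PN N) B (spin K N (i, j)))\<^sup>2) +
    (r1 - r0) / 2 * (gibbs (PN N) B (spin K N (i, N)))\<^sup>2) \<ge> - (N * t * q\<^sup>2 / 2)"
proof -
  interpret PN: prob_space "PN N" by (rule prob_PN)
  let ?x = "\<lambda>i x. clip K (x i)"
  have bm: "bounded_meas (PN N) (?x i)" if "i < N" for i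
    using that clip_le by (intro bounded_measI[of _ _ K]) auto
  have sp: "spin K N (i, j) = (\<lambda>x. clip K (x i) * clip K (x j))" "spin K N (i, N) = ?x i" if "i < N" "j < N" for i j
    using that by (auto simp: spin_def)
  have spN: "spin K N (i, N) = ?x i" if "i < N" for i using that by (auto simp: spin_def)
  have "t / 2 * - (N * q\<^sup>2) \<le> t / 2 * (\<Sum>i<N. (\<Sum>j<N. (gibbs (PN N) B (\<lambda>\<xi>. ?x i \<xi> * ?x j \<xi>))\<^sup>2) / N - 2 * q * (gibbs (PN N) B (?x i))\<^sup>2)"
    using t by (intro mult_left_mono PN.gibbs_overlap_bound B bm N) auto
  also have "\<dots> = (\<Sum>i<N. (\<Sum>j<N. t / (2 * real N) * (gibbs (PN N) B (spin K N (i, j)))\<^sup>2) +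
    (r1 - r0) / 2 * (gibbs (PN N) B (spin K N (i, N)))\<^sup>2)"
    unfolding r by (simp add: sum_distrib_left right_diff_distrib sum_divide_distrib sp spN mult.assoc)
  finally show ?thesis by (simp add: mult_ac)
qed

lemma free_energy_planted:
  assumes "t \<ge> 0" "r \<ge> 0"
  shows "gaussian_observation.free_energy (PN N) (PN N) (obs_idx N) (spin K N) (spin K N) (\<lambda>_ _. 0) (coef N t r) =
    meanZ N t r t r"
proof -
  interpret planted_observation "PN N" "obs_idx N" "spin K N" "K\<^sup>2" by (rule planted)
  have "obs_energy (obs_idx N) (spin K N) (spin K N) (\<lambda>_ _. 0) (coef N t r) y g =
    obs_energy (obs_idx N) (spin K N) (\<lambda>_ _. 0) (side K N t r) (coef N t r) y g" for y g
    by (rule ext) (rule planted_energy_eq[OF assms])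
  then show ?thesis unfolding free_energy_def meanZ_def logZ_def by simp
qed

text \<open>Interpolation from the vector channel of strength \<open>r + 2 * t * q\<close>, with no
  matrix, to the strengths \<open>(t, r)\<close>. The parameter \<open>q\<close> is free, so the
  supremum over it will give Hopf--Lax.\<close>

lemma meanZ_planted_ge:
  assumes N: "N > 0" and t: "t \<ge> 0" and r: "r \<ge> 0" "r + 2 * t * q \<ge> 0"
  shows "meanZ N t r t r \<ge> meanZ N 0 (r + 2 * t * q) 0 (r + 2 * t * q) - N * t * q\<^sup>2 / 2"
proof -
  interpret planted_observation "PN N" "obs_idx N" "spin K N" "K\<^sup>2" by (rule planted)
  let ?r0 = "r + 2 * t * q"
  obtain s where s: "0 < s" "s < 1" and eq:
    "free_energy (\<lambda>k. interp N t ?r0 r k 1) - free_energy (\<lambda>k. interp N t ?r0 r k 0) =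
    (\<integral>p. (\<Sum>k\<in>obs_idx N. interp N t ?r0 r k s * interp' N t ?r0 r k s *
      (m (\<lambda>k. interp N t ?r0 r k s) (fst p) (snd p) (spin K N k))\<^sup>2) \<partial>(PN N \<Otimes>\<^sub>M GN N))"
    using planted_mvt[of "interp N t ?r0 r" "interp' N t ?r0 r", OF interp_continuous interp_deriv(1) interp_deriv(2)] r by blast
  have "- (N * t * q\<^sup>2 / 2) = (\<integral>p. - (N * t * q\<^sup>2 / 2) \<partial>(PN N \<Otimes>\<^sub>M GN N))"
    using QG.P.prob_space by simp
  also have "\<dots> \<le> (\<integral>p. (\<Sum>k\<in>obs_idx N. interp N t ?r0 r k s * interp' N t ?r0 r k s *
      (m (\<lambda>k. interp N t ?r0 r k s) (fst p) (snd p) (spin K N k))\<^sup>2) \<partial>(PN N \<Otimes>\<^sub>M GN N))"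
  proof (rule integral_mono)
    show "integrable (PN N \<Otimes>\<^sub>M GN N) (\<lambda>p. \<Sum>k\<in>obs_idx N. interp N t ?r0 r k s * interp' N t ?r0 r k s *
      (m (\<lambda>k. interp N t ?r0 r k s) (fst p) (snd p) (spin K N k))\<^sup>2)"
      by (intro Bochner_Integration.integrable_sum integrable_mult_right m_integrable(2)[OF bm_a a_bound])
    fix p assume "p \<in> space (PN N \<Otimes>\<^sub>M GN N)"
    then have y: "fst p \<in> space (PN N)" by (auto simp: space_pair_measure)
    show "- (N * t * q\<^sup>2 / 2) \<le> (\<Sum>k\<in>obs_idx N. interp N t ?r0 r k s * interp' N t ?r0 r k s *
      (m (\<lambda>k. interp N t ?r0 r k s) (fst p) (snd p) (spin K N k))\<^sup>2)"
      unfolding interp_sum[OF t r(2,1) s] by (rule overlap_sum_ge[OF N t bm_H[OF y]]) simp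
  qed (auto simp: QG.P.emeasure_space_1)
  finally have "- (N * t * q\<^sup>2 / 2) \<le> free_energy (\<lambda>k. interp N t ?r0 r k 1) - free_energy (\<lambda>k. interp N t ?r0 r k 0)"
    unfolding eq .
  then show ?thesis using free_energy_planted[OF t r(1), of N] free_energy_planted[OF order_refl r(2), of N]
    unfolding interp_ends by simp
qed

text \<open>The same path with the tilt \<rho> held fixed. The sign of the derivative is reversed,
  so the same lower bound on the sum of squares now yields an upper bound.\<close>

lemma meanZ_unplanted_le:
  assumes N: "N > 0" and t: "t \<ge> 0" and r: "r \<ge> 0" "r + 2 * t * q \<ge> 0"
  shows "meanZ N t r 0 \<rho> \<le> meanZ N 0 (r + 2 * t * q) 0 \<rho> + N * t * q\<^sup>2 / 2"
proof -
  interpret gaussian_observation "PN N" "PN N" "obs_idx N" "spin K N" "\<lambda>_ _. 0" "side K N 0 \<rho>" "K\<^sup>2 + side_bd N 0 \<rho>"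
    by (rule unplanted)
  let ?r0 = "r + 2 * t * q"
  obtain s where s: "0 < s" "s < 1" and eq:
    "free_energy (\<lambda>k. interp N t ?r0 r k 1) - free_energy (\<lambda>k. interp N t ?r0 r k 0) =
    - (\<integral>p. (\<Sum>k\<in>obs_idx N. interp N t ?r0 r k s * interp' N t ?r0 r k s *
      (m (\<lambda>k. interp N t ?r0 r k s) (fst p) (snd p) (spin K N k))\<^sup>2) \<partial>(PN N \<Otimes>\<^sub>M GN N))"
    using unplanted_mvt[of "interp N t ?r0 r" "interp' N t ?r0 r", OF refl interp_continuous interp_deriv(1) interp_deriv(2)] r by blast
  have "- (N * t * q\<^sup>2 / 2) = (\<integral>p. - (N * t * q\<^sup>2 / 2) \<partial>(PN N \<Otimes>\<^sub>M GN N))"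
    using QG.P.prob_space by simp
  also have "\<dots> \<le> (\<integral>p. (\<Sum>k\<in>obs_idx N. interp N t ?r0 r k s * interp' N t ?r0 r k s *
      (m (\<lambda>k. interp N t ?r0 r k s) (fst p) (snd p) (spin K N k))\<^sup>2) \<partial>(PN N \<Otimes>\<^sub>M GN N))"
  proof (rule integral_mono)
    show "integrable (PN N \<Otimes>\<^sub>M GN N) (\<lambda>p. \<Sum>k\<in>obs_idx N. interp N t ?r0 r k s * interp' N t ?r0 r k s *
      (m (\<lambda>k. interp N t ?r0 r k s) (fst p) (snd p) (spin K N k))\<^sup>2)"
      by (intro Bochner_Integration.integrable_sum integrable_mult_right m_integrable(2)[OF bm_a a_bound])
    fix p assume "p \<in> space (PN N \<Otimes>\<^sub>M GN N)"
    then have y: "fst p \<in> space (PN N)" by (auto simp: space_pair_measure)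
    show "- (N * t * q\<^sup>2 / 2) \<le> (\<Sum>k\<in>obs_idx N. interp N t ?r0 r k s * interp' N t ?r0 r k s *
      (m (\<lambda>k. interp N t ?r0 r k s) (fst p) (snd p) (spin K N k))\<^sup>2)"
      unfolding interp_sum[OF t r(2,1) s] by (rule overlap_sum_ge[OF N t bm_H[OF y]]) simp
  qed (auto simp: QG.P.emeasure_space_1)
  finally have "free_energy (\<lambda>k. interp N t ?r0 r k 1) - free_energy (\<lambda>k. interp N t ?r0 r k 0) \<le> N * t * q\<^sup>2 / 2"
    unfolding eq by linarith
  then show ?thesis unfolding interp_ends free_energy_def meanZ_def logZ_def by simp
qed

text \<open>Without a matrix channel the derivative in the strength is half the sum over sites of
  mean squared Gibbs averages, hence between \<open>0\<close> and a multiple of \<open>N\<close>.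
  Used with \<open>N = 1\<close>, this is the Lipschitz bound for \<open>psi\<close>.\<close>

lemma meanZ_planted_lip:
  assumes r: "0 \<le> r0" "r0 \<le> r1"
  shows "0 \<le> meanZ N 0 r1 0 r1 - meanZ N 0 r0 0 r0"
    "meanZ N 0 r1 0 r1 - meanZ N 0 r0 0 r0 \<le> N * (r1 - r0) / 2 * (K\<^sup>2)\<^sup>2"
proof -
  interpret planted_observation "PN N" "obs_idx N" "spin K N" "K\<^sup>2" by (rule planted)
  have r1: "r1 \<ge> 0" using r by simp
  obtain s where s: "0 < s" "s < 1" and eq:
    "free_energy (\<lambda>k. interp N 0 r0 r1 k 1) - free_energy (\<lambda>k. interp N 0 r0 r1 k 0) =
    (\<integral>p. (\<Sum>k\<in>obs_idx N. interp N 0 r0 r1 k s * interp' N 0 r0 r1 k s *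
      (m (\<lambda>k. interp N 0 r0 r1 k s) (fst p) (snd p) (spin K N k))\<^sup>2) \<partial>(PN N \<Otimes>\<^sub>M GN N))"
    using planted_mvt[of "interp N 0 r0 r1" "interp' N 0 r0 r1", OF interp_continuous interp_deriv(1) interp_deriv(2)] r r1 by blast
  have eq': "meanZ N 0 r1 0 r1 - meanZ N 0 r0 0 r0 =
    (\<integral>p. (\<Sum>i<N. (r1 - r0) / 2 * (m (\<lambda>k. interp N 0 r0 r1 k s) (fst p) (snd p) (spin K N (i, N)))\<^sup>2) \<partial>(PN N \<Otimes>\<^sub>M GN N))"
    using eq free_energy_planted[OF order_refl r1, of N] free_energy_planted[OF order_refl r(1), of N]
    unfolding interp_ends interp_sum[OF order_refl r(1) r1 s] by simp
  show "0 \<le> meanZ N 0 r1 0 r1 - meanZ N 0 r0 0 r0"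
    unfolding eq' using r by (intro Bochner_Integration.integral_nonneg sum_nonneg) auto
  have "meanZ N 0 r1 0 r1 - meanZ N 0 r0 0 r0 \<le> (\<integral>p. N * (r1 - r0) / 2 * (K\<^sup>2)\<^sup>2 \<partial>(PN N \<Otimes>\<^sub>M GN N))"
    unfolding eq'
  proof (rule integral_mono)
    show "integrable (PN N \<Otimes>\<^sub>M GN N) (\<lambda>p. \<Sum>i<N. (r1 - r0) / 2 * (m (\<lambda>k. interp N 0 r0 r1 k s) (fst p) (snd p) (spin K N (i, N)))\<^sup>2)"
      by (intro Bochner_Integration.integrable_sum integrable_mult_right m_integrable(2)[OF bm_a a_bound])
    fix p assume "p \<in> space (PN N \<Otimes>\<^sub>M GN N)"
    then have y: "fst p \<in> space (PN N)" by (auto simp: space_pair_measure)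
    have "(m v (fst p) (snd p) (spin K N k))\<^sup>2 \<le> (K\<^sup>2)\<^sup>2" for v k
      using m_abs_le[OF y bm_a a_bound, of v "snd p" k] by (subst power2_le_iff_abs_le) auto
    then have "(\<Sum>i<N. (r1 - r0) / 2 * (m (\<lambda>k. interp N 0 r0 r1 k s) (fst p) (snd p) (spin K N (i, N)))\<^sup>2) \<le>
      (\<Sum>i<N. (r1 - r0) / 2 * (K\<^sup>2)\<^sup>2)"
      using r by (intro sum_mono mult_left_mono) auto
    then show "(\<Sum>i<N. (r1 - r0) / 2 * (m (\<lambda>k. interp N 0 r0 r1 k s) (fst p) (snd p) (spin K N (i, N)))\<^sup>2) \<le>
      N * (r1 - r0) / 2 * (K\<^sup>2)\<^sup>2" by simp
  qed (auto simp: QG.P.emeasure_space_1)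
  then show "meanZ N 0 r1 0 r1 - meanZ N 0 r0 0 r0 \<le> N * (r1 - r0) / 2 * (K\<^sup>2)\<^sup>2"
    by (simp add: QG.P.prob_space)
qed

end

section \<open>The scalar model and negative tilts\<close>

lemma distr_pair_components:
  assumes "prob_space M" "prob_space M'" "i \<in> I" "j \<in> J"
  shows "distr (PiM I (\<lambda>_. M) \<Otimes>\<^sub>M PiM J (\<lambda>_. M')) (M \<Otimes>\<^sub>M M') (\<lambda>p. (fst p i, snd p j)) = M \<Otimes>\<^sub>M M'"
proof -
  have 1: "distr (PiM I (\<lambda>_. M)) M (\<lambda>x. x i) = M" "distr (PiM J (\<lambda>_. M')) M' (\<lambda>x. x j) = M'"
    using assms by (auto intro!: distr_PiM_component)
  have "distr (PiM I (\<lambda>_. M)) M (\<lambda>x. x i) \<Otimes>\<^sub>M distr (PiM J (\<lambda>_. M')) M' (\<lambda>x. x j) =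
    distr (PiM I (\<lambda>_. M) \<Otimes>\<^sub>M PiM J (\<lambda>_. M')) (M \<Otimes>\<^sub>M M') (\<lambda>(x, y). (x i, y j))"
    using assms by (intro pair_measure_distr) (auto simp: 1 intro: prob_space_imp_sigma_finite)
  then show ?thesis unfolding 1 by (simp add: case_prod_beta')
qed

context bounded_prior
begin

sublocale PG: pair_prob_space P gauss
  by (intro pair_prob_space.intro pair_sigma_finite.intro prob_space_imp_sigma_finite prob_space_axioms prob_space_gauss)

definition site_energy :: "real \<Rightarrow> real \<Rightarrow> real \<Rightarrow> real \<Rightarrow> real \<Rightarrow> real" where
  "site_energy \<rho> r y z x = sqrt r * z * clip K x + \<rho> * clip K y * clip K x - r / 2 * (clip K x)\<^sup>2"

definition site :: "real \<Rightarrow> real \<Rightarrow> real \<Rightarrow> real \<Rightarrow> real" where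
  "site \<rho> r y z = ln (pf P (site_energy \<rho> r y z))"

definition site_mean :: "real \<Rightarrow> real \<Rightarrow> real" where
  "site_mean \<rho> r = (\<integral>p. site \<rho> r (fst p) (snd p) \<partial>(P \<Otimes>\<^sub>M gauss))"

lemma bm_clip: "bounded_meas P (clip K)"
  using clip_le by (intro bounded_measI[of _ _ K]) auto

lemma bm_site_energy: "bounded_meas P (site_energy \<rho> r y z)"
  unfolding site_energy_def by (intro bounded_meas_intros bm_clip)

lemma site_energy_le:
  "r \<ge> 0 \<Longrightarrow> \<bar>site_energy \<rho> r y z x\<bar> \<le> sqrt r * K * \<bar>z\<bar> + (\<bar>\<rho>\<bar> * K\<^sup>2 + r / 2 * K\<^sup>2)"
proof -
  assume r: "r \<ge> 0"
  have "\<bar>sqrt r * z * clip K x\<bar> \<le> sqrt r * \<bar>z\<bar> * K"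
    unfolding abs_mult using clip_le r by (intro mult_mono) auto
  moreover have "\<bar>\<rho> * (clip K y * clip K x)\<bar> \<le> \<bar>\<rho>\<bar> * K\<^sup>2"
    unfolding abs_mult[of \<rho>] by (intro mult_left_mono clip_mult_le) auto
  moreover have "\<bar>r / 2 * (clip K x)\<^sup>2\<bar> \<le> r / 2 * K\<^sup>2"
    unfolding abs_mult using r clip_mult_le[of x x] by (intro mult_mono) (auto simp: power2_eq_square)
  ultimately show ?thesis unfolding site_energy_def by (simp add: mult_ac)
qed

lemma site_energy_meas [measurable]:
  "(\<lambda>p. site_energy \<rho> r (fst (fst p)) (snd (fst p)) (snd p)) \<in> borel_measurable ((P \<Otimes>\<^sub>M gauss) \<Otimes>\<^sub>M P)"
  unfolding site_energy_def by measurable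

lemma site_meas [measurable]: "(\<lambda>p. site \<rho> r (fst p) (snd p)) \<in> borel_measurable (P \<Otimes>\<^sub>M gauss)"
  unfolding site_def pf_def by measurable

lemma gauss_abs_integrable: "integrable (P \<Otimes>\<^sub>M gauss) (\<lambda>p. \<bar>snd p\<bar>)"
proof -
  have "integrable (distr (P \<Otimes>\<^sub>M gauss) gauss snd) (\<lambda>z. \<bar>z\<bar>)"
    unfolding PG.distr_pair_snd by simp
  then show ?thesis by (subst (asm) integrable_distr_eq) auto
qed

lemma site_abs_le: "r \<ge> 0 \<Longrightarrow> \<bar>site \<rho> r y z\<bar> \<le> sqrt r * K * \<bar>z\<bar> + (\<bar>\<rho>\<bar> * K\<^sup>2 + r / 2 * K\<^sup>2)"
  unfolding site_def by (intro ln_pf_abs_le bm_site_energy site_energy_le)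

lemma site_integrable: "r \<ge> 0 \<Longrightarrow> integrable (P \<Otimes>\<^sub>M gauss) (\<lambda>p. site \<rho> r (fst p) (snd p))"
proof (rule Bochner_Integration.integrable_bound)
  assume r: "r \<ge> 0"
  show "integrable (P \<Otimes>\<^sub>M gauss) (\<lambda>p. sqrt r * K * \<bar>snd p\<bar> + (\<bar>\<rho>\<bar> * K\<^sup>2 + r / 2 * K\<^sup>2))"
    by (intro Bochner_Integration.integrable_add integrable_mult_right gauss_abs_integrable) auto
  show "AE p in P \<Otimes>\<^sub>M gauss. norm (site \<rho> r (fst p) (snd p)) \<le>
    norm (sqrt r * K * \<bar>snd p\<bar> + (\<bar>\<rho>\<bar> * K\<^sup>2 + r / 2 * K\<^sup>2))"
    using site_abs_le[OF r] by (intro AE_I2) (simp add: order_trans[OF _ abs_ge_self])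
qed simp

text \<open>Without a matrix channel and with a linear tilt the energy is a sum over sites and the
  prior is a product, so the partition function factorises.\<close>

lemma logZ_zero_eq:
  assumes r: "r \<ge> 0"
  shows "logZ N 0 r 0 \<rho> y g = (\<Sum>i<N. site \<rho> r (y i) (g (i, N)))"
proof -
  interpret PM: product_sigma_finite "\<lambda>_::nat. P"
    by (rule product_sigma_finite.intro) (rule prob_space_imp_sigma_finite[OF prob_space_axioms])
  have e: "obs_energy (obs_idx N) (spin K N) (\<lambda>_ _. 0) (side K N 0 \<rho>) (coef N 0 r) y g x =
    (\<Sum>i<N. site_energy \<rho> r (y i) (g (i, N)) (x i))" for x
    unfolding energy_explicit[OF order_refl r] site_energy_def side_def ovl_def
    by (simp add: sum.distrib sum_subtractf sum_distrib_left power2_eq_square mult_ac)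
  have "pf (PN N) (obs_energy (obs_idx N) (spin K N) (\<lambda>_ _. 0) (side K N 0 \<rho>) (coef N 0 r) y g) =
    (\<integral>x. (\<Prod>i<N. exp (site_energy \<rho> r (y i) (g (i, N)) (x i))) \<partial>PN N)"
    unfolding pf_def e by (simp add: exp_sum)
  also have "\<dots> = (\<Prod>i<N. pf P (site_energy \<rho> r (y i) (g (i, N))))"
    unfolding pf_def by (intro PM.product_integral_prod)
      (auto intro!: bounded_meas_integrable bounded_meas_exp bm_site_energy)
  finally show ?thesis unfolding logZ_def site_def
    using pf_pos[OF bm_site_energy] by (simp add: ln_prod less_imp_neq[symmetric])
qed

lemma meanZ_zero:
  assumes r: "r \<ge> 0"
  shows "meanZ N 0 r 0 \<rho> = N * site_mean \<rho> r"
proof -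
  have d: "distr (PN N \<Otimes>\<^sub>M GN N) (P \<Otimes>\<^sub>M gauss) (\<lambda>p. (fst p i, snd p (i, N))) = P \<Otimes>\<^sub>M gauss" if "i < N" for i
    using that by (intro distr_pair_components prob_space_axioms prob_space_gauss) (auto simp: obs_idx_def)
  have m [measurable]: "(\<lambda>p. (fst p i, snd p (i, N))) \<in> measurable (PN N \<Otimes>\<^sub>M GN N) (P \<Otimes>\<^sub>M gauss)" if "i < N" for i
  proof -
    have "(i, N) \<in> obs_idx N" "i \<in> {..<N}" using that by (auto simp: obs_idx_def)
    then show ?thesis by measurable
  qed
  have i1: "integrable (PN N \<Otimes>\<^sub>M GN N) (\<lambda>p. site \<rho> r (fst p i) (snd p (i, N)))" if i: "i < N" for i
  proof -
    have "integrable (distr (PN N \<Otimes>\<^sub>M GN N) (P \<Otimes>\<^sub>M gauss) (\<lambda>p. (fst p i, snd p (i, N)))) (\<lambda>p. site \<rho> r (fst p) (snd p))"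
      unfolding d[OF i] by (rule site_integrable[OF r])
    from this[unfolded integrable_distr_eq[OF m[OF i] site_meas]] show ?thesis by simp
  qed
  have i2: "(\<integral>p. site \<rho> r (fst p i) (snd p (i, N)) \<partial>(PN N \<Otimes>\<^sub>M GN N)) = site_mean \<rho> r" if i: "i < N" for i
  proof -
    have "site_mean \<rho> r = (\<integral>p. site \<rho> r (fst p) (snd p) \<partial>distr (PN N \<Otimes>\<^sub>M GN N) (P \<Otimes>\<^sub>M gauss) (\<lambda>p. (fst p i, snd p (i, N))))"
      unfolding d[OF i] site_mean_def ..
    also have "\<dots> = (\<integral>p. site \<rho> r (fst p i) (snd p (i, N)) \<partial>(PN N \<Otimes>\<^sub>M GN N))"
      using integral_distr[OF m[OF i] site_meas] by simp
    finally show ?thesis by simp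
  qed
  show ?thesis unfolding meanZ_def logZ_zero_eq[OF r]
    by (simp add: Bochner_Integration.integral_sum i1 i2)
qed

lemma psi_eq:
  assumes h: "h \<ge> 0"
  shows "psi P h = site_mean h h"
proof -
  have aeP: "AE x in P. clip K x = x" using bdd by eventually_elim (rule clip_id)
  have "AE p in P \<Otimes>\<^sub>M gauss. clip K (fst p) = fst p"
  proof (rule PG.AE_pair_measure)
    show "{p \<in> space (P \<Otimes>\<^sub>M gauss). clip K (fst p) = fst p} \<in> sets (P \<Otimes>\<^sub>M gauss)" by measurable
  qed (use aeP in simp)
  then have ae: "AE p in P \<Otimes>\<^sub>M gauss.
    ln (\<integral>x. exp (sqrt h * snd p * x + h * x * fst p - h / 2 * x\<^sup>2) \<partial>P) = site h h (fst p) (snd p)"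
  proof eventually_elim
    case (elim p)
    have "(\<integral>x. exp (sqrt h * snd p * x + h * x * fst p - h / 2 * x\<^sup>2) \<partial>P) = pf P (site_energy h h (fst p) (snd p))"
      unfolding pf_def
    proof (rule integral_cong_AE)
      show "AE x in P. exp (sqrt h * snd p * x + h * x * fst p - h / 2 * x\<^sup>2) = exp (site_energy h h (fst p) (snd p) x)"
        using aeP by eventually_elim (simp add: site_energy_def elim mult_ac)
      show "(\<lambda>x. exp (site_energy h h (fst p) (snd p) x)) \<in> borel_measurable P"
        using bounded_meas_measurable[OF bm_site_energy, of h h "fst p" "snd p"] by measurable
    qed measurable
    then show ?case by (simp add: site_def)
  qed
  show ?thesis unfolding psi_def site_mean_def case_prod_beta'
    by (rule integral_cong_AE[OF _ _ ae]) measurable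
qed

text \<open>The density, relative to the standard Gaussian, of \<open>w = z + sqrt r * x\<close>
  with \<open>x\<close> of truncated prior law. Reversing the tilt amounts to evaluating it at data
  that carry the signal with the opposite sign.\<close>

definition lik :: "real \<Rightarrow> real \<Rightarrow> real" where
  "lik r w = pf P (\<lambda>x. sqrt r * clip K x * w - (sqrt r * clip K x)\<^sup>2 / 2)"

lemma bm_lik: "bounded_meas P (\<lambda>x. sqrt r * clip K x * w - (sqrt r * clip K x)\<^sup>2 / 2)"
  using bounded_meas_diff[OF bounded_meas_mult[OF bounded_meas_cmult[OF bm_clip] bounded_meas_const]
    bounded_meas_mult[OF bounded_meas_power[OF bounded_meas_cmult[OF bm_clip]] bounded_meas_const[of _ "1/2"]]]
  by simp

lemma lik_pos: "lik r w > 0"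
  unfolding lik_def by (intro pf_pos bm_lik)

lemma lik_meas [measurable]: "lik r \<in> borel_measurable borel"
  unfolding lik_def pf_def by measurable

lemma site_eq_lik:
  assumes "r \<ge> 0"
  shows "site r r y z = ln (lik r (z + sqrt r * clip K y))" "site (- r) r y z = ln (lik r (z - sqrt r * clip K y))"
proof -
  define s where "s = sqrt r"
  have r: "r = s * s" using assms by (simp add: s_def)
  have "site_energy r r y z x = s * clip K x * (z + s * clip K y) - (s * clip K x)\<^sup>2 / 2"
    "site_energy (- r) r y z x = s * clip K x * (z - s * clip K y) - (s * clip K x)\<^sup>2 / 2" for x
    unfolding site_energy_def s_def[symmetric] unfolding r by (simp_all add: algebra_simps power2_eq_square)
  then show "site r r y z = ln (lik r (z + sqrt r * clip K y))" "site (- r) r y z = ln (lik r (z - sqrt r * clip K y))"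
    unfolding site_def lik_def pf_def s_def[symmetric] by simp_all
qed

lemma lik_nn_integral: "(\<integral>\<^sup>+w. ennreal (lik r w) \<partial>gauss) = 1"
proof -
  let ?e = "\<lambda>w x. exp (sqrt r * clip K x * w - (sqrt r * clip K x)\<^sup>2 / 2)"
  have "(\<integral>\<^sup>+w. ennreal (lik r w) \<partial>gauss) = (\<integral>\<^sup>+w. \<integral>\<^sup>+x. ennreal (?e w x) \<partial>P \<partial>gauss)"
    unfolding lik_def pf_def
    by (intro nn_integral_cong nn_integral_eq_integral[symmetric] bounded_meas_integrable bounded_meas_exp bm_lik) auto
  also have "\<dots> = (\<integral>\<^sup>+x. \<integral>\<^sup>+w. ennreal (?e w x) \<partial>gauss \<partial>P)"
    using PG.Fubini'[of "\<lambda>x w. ennreal (?e w x)"] by simp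
  also have "\<dots> = (\<integral>\<^sup>+x. 1 \<partial>P)"
  proof (rule nn_integral_cong)
    fix x
    let ?v = "sqrt r * clip K x"
    have "emeasure (density gauss (\<lambda>x. ennreal (exp (?v * x - ?v\<^sup>2 / 2)))) UNIV = 1"
      unfolding distr_gauss_shift[symmetric]
      using prob_space.prob_space_distr[OF prob_space_gauss, of "\<lambda>x. x + ?v" borel]
      by (simp add: prob_space.emeasure_space_1[where M = "distr gauss borel _", simplified])
    then show "(\<integral>\<^sup>+w. ennreal (?e w x) \<partial>gauss) = 1"
      by (subst (asm) emeasure_density) auto
  qed
  also have "\<dots> = 1" by (simp add: emeasure_space_1)
  finally show ?thesis .
qed

lemma distr_gauss_uminus: "distr gauss borel uminus = gauss"
proof (rule measure_eqI)
  fix A assume "A \<in> sets (distr gauss borel uminus)"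
  then have [measurable]: "A \<in> sets borel" by simp
  have "emeasure (distr gauss borel uminus) A = (\<integral>\<^sup>+x. indicator A (- x) \<partial>gauss)"
    by (simp add: nn_integral_distr flip: nn_integral_indicator)
  also have "\<dots> = (\<integral>\<^sup>+x. ennreal (std_normal_density x) * indicator A (- x) \<partial>lborel)"
    unfolding gauss_def by (subst nn_integral_density) auto
  also have "\<dots> = (\<integral>\<^sup>+x. ennreal (std_normal_density x) * indicator A x \<partial>lborel)"
    using nn_integral_real_affine[of "\<lambda>x. ennreal (std_normal_density x) * indicator A x" "-1" 0]
    by (simp add: std_normal_density_def)
  also have "\<dots> = emeasure gauss A"
    unfolding gauss_def by (subst emeasure_density) auto
  finally show "emeasure (distr gauss borel uminus) A = emeasure gauss A" .
qed simp

text \<open>Gibbs' inequality between the laws of \<open>z + \<surd>r x\<close> and \<open>z - \<surd>r x\<close>.\<close>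

lemma site_mean_neg_le:
  assumes r: "r \<ge> 0"
  shows "site_mean (- r) r \<le> site_mean r r"
proof -
  let ?c = "\<lambda>y. sqrt r * clip K y"
  \<comment> \<open>The likelihood ratio of the two laws at \<open>w = z - ?c y\<close>. The law of
    this \<open>w\<close> has density \<open>lik r (- w)\<close> relative to the standard Gaussian,
    so the ratio has mean \<open>1\<close>.\<close>
  let ?f = "\<lambda>y z. lik r (z - ?c y) / lik r (- (z - ?c y))"
  \<comment> \<open>The symmetry of \<open>z\<close> brings both expectations to the same point
    \<open>z - ?c y\<close>, so that their difference is the mean of the logarithm of
    \<open>?f\<close>.\<close>
  have flip: "site_mean r r = (\<integral>p. ln (lik r (- (snd p - ?c (fst p)))) \<partial>(P \<Otimes>\<^sub>M gauss))"
  proof -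
    have "site_mean r r = (\<integral>y. \<integral>z. site r r y z \<partial>gauss \<partial>P)"
      unfolding site_mean_def using PG.integral_fst'[OF site_integrable[OF r, of r]] by simp
    also have "\<dots> = (\<integral>y. \<integral>z. site r r y (- z) \<partial>gauss \<partial>P)"
    proof (rule Bochner_Integration.integral_cong[OF refl])
      fix y
      have "(\<integral>z. site r r y z \<partial>gauss) = (\<integral>z. site r r y z \<partial>distr gauss borel uminus)"
        unfolding distr_gauss_uminus ..
      also have "\<dots> = (\<integral>z. site r r y (- z) \<partial>gauss)"
        unfolding site_eq_lik(1)[OF r] by (subst integral_distr) auto
      finally show "(\<integral>z. site r r y z \<partial>gauss) = (\<integral>z. site r r y (- z) \<partial>gauss)" .
    qed
    also have "\<dots> = (\<integral>p. site r r (fst p) (- snd p) \<partial>(P \<Otimes>\<^sub>M gauss))"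
    proof -
      have "integrable (P \<Otimes>\<^sub>M gauss) (\<lambda>p. site r r (fst p) (- snd p))"
      proof (rule Bochner_Integration.integrable_bound)
        show "integrable (P \<Otimes>\<^sub>M gauss) (\<lambda>p. sqrt r * K * \<bar>snd p\<bar> + (\<bar>r\<bar> * K\<^sup>2 + r / 2 * K\<^sup>2))"
          by (intro Bochner_Integration.integrable_add integrable_mult_right gauss_abs_integrable) auto
        show "AE p in P \<Otimes>\<^sub>M gauss. norm (site r r (fst p) (- snd p)) \<le>
            norm (sqrt r * K * \<bar>snd p\<bar> + (\<bar>r\<bar> * K\<^sup>2 + r / 2 * K\<^sup>2))"
          using site_abs_le[OF r, of r _ "- _"] by (intro AE_I2) (simp add: order_trans[OF _ abs_ge_self])
        show "(\<lambda>p. site r r (fst p) (- snd p)) \<in> borel_measurable (P \<Otimes>\<^sub>M gauss)"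
          unfolding site_eq_lik(1)[OF r] by measurable
      qed
      from PG.integral_fst'[OF this] show ?thesis by simp
    qed
    finally show ?thesis unfolding site_eq_lik(1)[OF r] by (simp add: algebra_simps)
  qed
  have int1: "integrable (P \<Otimes>\<^sub>M gauss) (\<lambda>p. ln (lik r (snd p - ?c (fst p))))"
    using site_integrable[OF r, of "- r"] unfolding site_eq_lik(2)[OF r] .
  have int2: "integrable (P \<Otimes>\<^sub>M gauss) (\<lambda>p. ln (lik r (- (snd p - ?c (fst p)))))"
  proof (rule Bochner_Integration.integrable_bound)
    show "integrable (P \<Otimes>\<^sub>M gauss) (\<lambda>p. sqrt r * K * \<bar>snd p\<bar> + (\<bar>r\<bar> * K\<^sup>2 + r / 2 * K\<^sup>2))"
      by (intro Bochner_Integration.integrable_add integrable_mult_right gauss_abs_integrable) auto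
    have "- (z - ?c y) = - z + ?c y" for y z by simp
    then show "AE p in P \<Otimes>\<^sub>M gauss. norm (ln (lik r (- (snd p - ?c (fst p))))) \<le>
        norm (sqrt r * K * \<bar>snd p\<bar> + (\<bar>r\<bar> * K\<^sup>2 + r / 2 * K\<^sup>2))"
      using site_abs_le[OF r, of r _ "- _"] unfolding site_eq_lik(1)[OF r]
      by (intro AE_I2) (simp add: order_trans[OF _ abs_ge_self])
  qed measurable
  have nn: "(\<integral>\<^sup>+p. ennreal (?f (fst p) (snd p)) \<partial>(P \<Otimes>\<^sub>M gauss)) = 1"
  proof -
    let ?e = "\<lambda>w y. exp (- ?c y * w - (?c y)\<^sup>2 / 2)"
    let ?F = "\<lambda>w. ennreal (lik r w / lik r (- w))"
    have "(\<integral>\<^sup>+p. ennreal (?f (fst p) (snd p)) \<partial>(P \<Otimes>\<^sub>M gauss)) =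
      (\<integral>\<^sup>+y. \<integral>\<^sup>+z. ?F (z - ?c y) \<partial>gauss \<partial>P)"
      by (subst sigma_finite_measure.nn_integral_fst[OF prob_space_imp_sigma_finite[OF prob_space_gauss], symmetric]) auto
    also have "\<dots> = (\<integral>\<^sup>+y. \<integral>\<^sup>+w. ennreal (?e w y) * ?F w \<partial>gauss \<partial>P)"
    proof (rule nn_integral_cong)
      fix y
      have "(\<integral>\<^sup>+z. ?F (z - ?c y) \<partial>gauss) = (\<integral>\<^sup>+w. ?F w \<partial>distr gauss borel (\<lambda>x. x + - ?c y))"
        by (subst nn_integral_distr) auto
      also have "\<dots> = (\<integral>\<^sup>+w. ennreal (?e w y) * ?F w \<partial>gauss)"
        unfolding distr_gauss_shift by (subst nn_integral_density) auto
      finally show "(\<integral>\<^sup>+z. ?F (z - ?c y) \<partial>gauss) = (\<integral>\<^sup>+w. ennreal (?e w y) * ?F w \<partial>gauss)" .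
    qed
    also have "\<dots> = (\<integral>\<^sup>+w. \<integral>\<^sup>+y. ennreal (?e w y) * ?F w \<partial>P \<partial>gauss)"
      using PG.Fubini'[of "\<lambda>y w. ennreal (?e w y) * ?F w"] by simp
    also have "\<dots> = (\<integral>\<^sup>+w. ennreal (lik r w) \<partial>gauss)"
    proof (rule nn_integral_cong)
      fix w
      have "(\<integral>\<^sup>+y. ennreal (?e w y) \<partial>P) = ennreal (lik r (- w))"
        unfolding lik_def pf_def using bm_lik[of r "- w"]
        by (subst nn_integral_eq_integral) (auto intro!: bounded_meas_integrable bounded_meas_exp)
      then have "(\<integral>\<^sup>+y. ennreal (?e w y) * ?F w \<partial>P) = ennreal (lik r (- w)) * ?F w"
        by (subst nn_integral_multc) auto
      also have "\<dots> = ennreal (lik r w)"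
        using lik_pos[of r "- w"] by (simp add: less_imp_le less_imp_neq[symmetric] flip: ennreal_mult')
      finally show "(\<integral>\<^sup>+y. ennreal (?e w y) * ?F w \<partial>P) = ennreal (lik r w)" .
    qed
    finally show ?thesis by (simp add: lik_nn_integral)
  qed
  have f_pos: "?f y z > 0" for y z using lik_pos by simp
  have f_int: "integrable (P \<Otimes>\<^sub>M gauss) (\<lambda>p. ?f (fst p) (snd p))"
    using nn f_pos by (intro integrableI_nonneg) (auto intro: less_imp_le)
  have f1: "(\<integral>p. ?f (fst p) (snd p) \<partial>(P \<Otimes>\<^sub>M gauss)) = 1"
    using nn f_pos by (subst integral_eq_nn_integral) (auto intro: less_imp_le)
  have "site_mean (- r) r - site_mean r r =
    (\<integral>p. ln (lik r (snd p - ?c (fst p))) - ln (lik r (- (snd p - ?c (fst p)))) \<partial>(P \<Otimes>\<^sub>M gauss))"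
    unfolding flip unfolding site_mean_def site_eq_lik(2)[OF r] using int1 int2 by simp
  also have "\<dots> \<le> (\<integral>p. ?f (fst p) (snd p) - 1 \<partial>(P \<Otimes>\<^sub>M gauss))"
  proof (rule integral_mono)
    have *: "ln a - ln b \<le> a / b - 1" if "a > 0" "b > 0" for a b :: real
      using ln_le_minus_one[of "a / b"] that by (simp add: ln_div)
    fix p
    show "ln (lik r (snd p - ?c (fst p))) - ln (lik r (- (snd p - ?c (fst p)))) \<le> ?f (fst p) (snd p) - 1"
      by (rule *[OF lik_pos lik_pos])
  qed (use int1 int2 f_int in auto)
  also have "\<dots> = 0" using f_int f1 by (simp add: PG.P.prob_space)
  finally show ?thesis by simp
qed

lemma psi_lipschitz: "half_line_lipschitz (psi P) ((K\<^sup>2)\<^sup>2 / 2)"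
proof
  have *: "\<bar>psi P k - psi P h\<bar> \<le> (K\<^sup>2)\<^sup>2 / 2 * \<bar>k - h\<bar>" if "0 \<le> h" "h \<le> k" for h k
    using meanZ_planted_lip[of h k 1] that meanZ_zero[of h 1 h] meanZ_zero[of k 1 k]
    by (simp add: psi_eq mult.commute)
  show "\<bar>psi P h - psi P k\<bar> \<le> (K\<^sup>2)\<^sup>2 / 2 * \<bar>h - k\<bar>" if "h \<ge> 0" "k \<ge> 0" for h k
    using *[of h k] *[of k h] that by (cases "h \<le> k") (auto simp: abs_minus_commute)
qed simp

end

section \<open>Concentration and convergence of the free energy\<close>

context bounded_prior
begin

sublocale psi: half_line_lipschitz "psi P" "(K\<^sup>2)\<^sup>2 / 2"
  by (rule psi_lipschitz)

lemma square_integrable_P: "integrable P (\<lambda>x. x\<^sup>2)"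
proof (rule integrable_const_bound[of _ "K\<^sup>2"])
  show "AE x in P. norm (x\<^sup>2) \<le> K\<^sup>2"
    using bdd by eventually_elim (use K1 in \<open>simp add: power2_le_iff_abs_le\<close>)
qed measurable

lemma ovl_update_le:
  assumes i: "i < N"
  shows "\<bar>ovl K N (y(i := a)) x - ovl K N (y(i := b)) x\<bar> \<le> K * \<bar>a - b\<bar>"
proof -
  have "ovl K N (y(i := a)) x - ovl K N (y(i := b)) x =
    (\<Sum>j<N. if j = i then (clip K a - clip K b) * clip K (x i) else 0)"
    unfolding ovl_def sum_subtractf[symmetric] by (intro sum.cong) (auto simp: algebra_simps)
  also have "\<dots> = (clip K a - clip K b) * clip K (x i)" using i by simp
  also have "\<bar>\<dots>\<bar> \<le> \<bar>a - b\<bar> * K"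
    unfolding abs_mult by (intro mult_mono clip_lip clip_le) auto
  finally show ?thesis by (simp add: mult.commute)
qed

definition side_lip :: "real \<Rightarrow> real \<Rightarrow> real" where
  "side_lip u \<rho> = 2 * \<bar>u\<bar> * K ^ 3 + \<bar>\<rho>\<bar> * K"

text \<open>Changing one coordinate of the signal by a bounded amount moves the overlap by
  \<open>O(1)\<close>, while the overlap itself is \<open>O(N)\<close>; the factor
  \<open>u / N\<close> in front of its square makes the Lipschitz constant independent of
  \<open>N\<close>.\<close>

lemma side_update_le:
  assumes i: "i < N"
  shows "\<bar>side K N u \<rho> (y(i := a)) x - side K N u \<rho> (y(i := b)) x\<bar> \<le> side_lip u \<rho> * \<bar>a - b\<bar>"
proof -
  define p where "p = ovl K N (y(i := a)) x"
  define q where "q = ovl K N (y(i := b)) x"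
  have N: "real N > 0" using i by simp
  have pq: "\<bar>p - q\<bar> \<le> K * \<bar>a - b\<bar>" unfolding p_def q_def by (rule ovl_update_le[OF i])
  have "\<bar>p + q\<bar> \<le> 2 * (N * K\<^sup>2)"
    using ovl_le[of N "y(i := a)" x] ovl_le[of N "y(i := b)" x] unfolding p_def q_def by linarith
  then have "\<bar>u / N\<bar> * (\<bar>p + q\<bar> * \<bar>p - q\<bar>) \<le> \<bar>u / N\<bar> * (2 * (N * K\<^sup>2) * (K * \<bar>a - b\<bar>))"
    using pq K1 by (intro mult_left_mono mult_mono) auto
  also have "\<dots> = 2 * \<bar>u\<bar> * K ^ 3 * \<bar>a - b\<bar>" using N by (simp add: power3_eq_cube power2_eq_square)
  finally have 1: "\<bar>u / N * (p\<^sup>2 - q\<^sup>2)\<bar> \<le> 2 * \<bar>u\<bar> * K ^ 3 * \<bar>a - b\<bar>"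
    by (simp add: abs_mult power2_eq_square square_diff_square_factored)
  have 2: "\<bar>\<rho> * (p - q)\<bar> \<le> \<bar>\<rho>\<bar> * K * \<bar>a - b\<bar>"
    unfolding abs_mult using pq mult_left_mono[OF pq, of "\<bar>\<rho>\<bar>"] by (simp add: mult.assoc)
  have eq: "side K N u \<rho> (y(i := a)) x - side K N u \<rho> (y(i := b)) x = u / N * (p\<^sup>2 - q\<^sup>2) + \<rho> * (p - q)"
    unfolding side_def p_def q_def by (simp add: right_diff_distrib)
  show ?thesis unfolding eq side_lip_def distrib_right
    by (rule order_trans[OF abs_triangle_ineq add_mono[OF 1 2]])
qed

text \<open>A bound on the variance per site: \<open>N\<close> signal coordinates with Lipschitz
  constant \<open>side_lip\<close>, \<open>N^2\<close> matrix entries contributing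
  \<open>t / N * K^4\<close> each, and \<open>N\<close> vector entries contributing
  \<open>r * K^4\<close> each.\<close>

definition var_const :: "real \<Rightarrow> real \<Rightarrow> real \<Rightarrow> real \<Rightarrow> real" where
  "var_const t r u \<rho> = (side_lip u \<rho>)\<^sup>2 * (\<integral>x. x\<^sup>2 \<partial>P) + (t + r) * (K\<^sup>2)\<^sup>2"

lemma
  assumes N: "N > 0" and t: "t \<ge> 0" and r: "r \<ge> 0"
  shows logZ_meas: "(\<lambda>p. logZ N t r u \<rho> (fst p) (snd p)) \<in> borel_measurable (PN N \<Otimes>\<^sub>M GN N)"
    and logZ_square_integrable: "integrable (PN N \<Otimes>\<^sub>M GN N) (\<lambda>p. (logZ N t r u \<rho> (fst p) (snd p))\<^sup>2)"
    and logZ_var: "var (PN N \<Otimes>\<^sub>M GN N) (\<lambda>p. logZ N t r u \<rho> (fst p) (snd p)) \<le> N * var_const t r u \<rho>"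
proof -
  interpret gaussian_observation "PN N" "PN N" "obs_idx N" "spin K N" "\<lambda>_ _. 0" "side K N u \<rho>" "K\<^sup>2 + side_bd N u \<rho>"
    by (rule unplanted)
  let ?v = "coef N t r"
  show Lm: "(\<lambda>p. logZ N t r u \<rho> (fst p) (snd p)) \<in> borel_measurable (PN N \<Otimes>\<^sub>M GN N)"
    unfolding logZ_def by measurable
  have sp: "y \<in> space (PN N) \<Longrightarrow> i < N \<Longrightarrow> y(i := a) \<in> space (PN N)" for y i a
    by (auto simp: space_PiM space_P PiE_iff extensional_def)
  have int: "integrable G (L ?v y)" if y: "y \<in> space (PN N)" for y
  proof (rule Bochner_Integration.integrable_bound)
    show "integrable G (Hbd ?v)" unfolding Hbd_def
      by (intro Bochner_Integration.integrable_add Bochner_Integration.integrable_sum integrable_mult_right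
          integrable_mult_left G_comp_integrable) auto
    show "AE g in G. norm (L ?v y g) \<le> norm (Hbd ?v g)"
      using L_abs_le[OF y] by (intro AE_I2) (simp add: order_trans[OF _ abs_ge_self])
  qed (rule L_sec_meas[OF y])
  have lip: "\<bar>(\<integral>g. L ?v (y(i := a)) g \<partial>G) - (\<integral>g. L ?v (y(i := b)) g \<partial>G)\<bar> \<le> side_lip u \<rho> * \<bar>a - b\<bar>"
    if i: "i \<in> {..<N}" and y: "y \<in> space (PN N)" for i y a b
  proof -
    have i': "i < N" using i by simp
    have le: "\<bar>L ?v (y(i := a)) g - L ?v (y(i := b)) g\<bar> \<le> side_lip u \<rho> * \<bar>a - b\<bar>" for g
    proof (rule Q.ln_pf_lip[OF bm_H[OF sp[OF y i']] bm_H[OF sp[OF y i']]])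
      fix x
      show "\<bar>H ?v (y(i := a)) g x - H ?v (y(i := b)) g x\<bar> \<le> side_lip u \<rho> * \<bar>a - b\<bar>"
        using side_update_le[OF i'] unfolding obs_energy_def by simp
    qed
    have "\<bar>(\<integral>g. L ?v (y(i := a)) g \<partial>G) - (\<integral>g. L ?v (y(i := b)) g \<partial>G)\<bar> =
      \<bar>\<integral>g. L ?v (y(i := a)) g - L ?v (y(i := b)) g \<partial>G\<bar>"
      using int[OF sp[OF y i']] by (subst Bochner_Integration.integral_diff) auto
    also have "\<dots> \<le> (\<integral>g. \<bar>L ?v (y(i := a)) g - L ?v (y(i := b)) g\<bar> \<partial>G)" by (rule integral_abs_bound)
    also have "\<dots> \<le> (\<integral>g. side_lip u \<rho> * \<bar>a - b\<bar> \<partial>G)"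
      using le int[OF sp[OF y i']] by (intro integral_mono) auto
    finally show ?thesis by (simp add: G.prob_space)
  qed
  have hm: "(\<lambda>y. \<integral>g. L ?v y g \<partial>G) \<in> borel_measurable (PN N)"
    using Lm unfolding logZ_def by (intro G.borel_measurable_lebesgue_integral) (simp add: case_prod_beta')
  have v1: "var (PN N) (\<lambda>y. \<integral>g. L ?v y g \<partial>G) \<le> (\<Sum>i<N. (side_lip u \<rho>)\<^sup>2 * (\<integral>x. x\<^sup>2 \<partial>P))"
    by (rule var_PiM_lipschitz(2)[OF prob_space_axioms sets_P square_integrable_P finite_lessThan hm lip])
  show "integrable (PN N \<Otimes>\<^sub>M GN N) (\<lambda>p. (logZ N t r u \<rho> (fst p) (snd p))\<^sup>2)"
    unfolding logZ_def by (rule L_square_integrable[OF spin_le v1])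
  have "(\<Sum>k\<in>obs_idx N. (?v k)\<^sup>2 * (K\<^sup>2)\<^sup>2) = N * ((t + r) * (K\<^sup>2)\<^sup>2)"
    using N t r by (simp add: sum_obs_idx coef_def distrib_right)
  then show "var (PN N \<Otimes>\<^sub>M GN N) (\<lambda>p. logZ N t r u \<rho> (fst p) (snd p)) \<le> N * var_const t r u \<rho>"
    using var_L_le[OF spin_le v1] unfolding logZ_def var_const_def by (simp add: distrib_left)
qed

lemma prob_PG: "prob_space (PN N \<Otimes>\<^sub>M GN N)"
  by (intro prob_space_pair prob_PN prob_space_gauss_vec)

lemma meanZ_ge_hopf_lax:
  assumes N: "N > 0" and t: "t \<ge> 0" and r: "r \<ge> 0"
  shows "N * hopf_lax (psi P) t r \<le> meanZ N t r t r"
proof -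
  have "hopf_lax (psi P) t r \<le> meanZ N t r t r / N"
  proof (rule psi.hl_le[OF r])
    fix q assume q: "0 \<le> r + 2 * t * q"
    have "N * (psi P (r + 2 * t * q) - t * q\<^sup>2 / 2) \<le> meanZ N t r t r"
      using meanZ_planted_ge[OF N t r q] meanZ_zero[OF q, of N] psi_eq[OF q] by (simp add: right_diff_distrib mult.assoc)
    then show "psi P (r + 2 * t * q) - t * q\<^sup>2 / 2 \<le> meanZ N t r t r / N"
      using N by (simp add: le_divide_eq mult.commute)
  qed
  then show ?thesis using N by (simp add: le_divide_eq mult.commute)
qed

text \<open>The end of the interpolation is placed where the scalar model is known. For a tilt
  \<open>r + 2 * t * \<mu> \<ge> 0\<close> the channel strength is taken equal to the tilt, which is
  the planted scalar model \<open>psi\<close>; half of \<open>N * t * \<mu>^2\<close> pays for the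
  interpolation and the other half is the Hopf--Lax cost. For a negative tilt the strength is its
  absolute value, and \<open>site_mean_neg_le\<close> reduces to the planted case.\<close>

lemma meanZ_linear_le:
  assumes N: "N > 0" and t: "t \<ge> 0" and r: "r \<ge> 0"
  shows "meanZ N t r 0 (r + 2 * t * \<mu>) - N * t * \<mu>\<^sup>2 \<le> N * hopf_lax (psi P) t r"
proof (cases "r + 2 * t * \<mu> \<ge> 0")
  case True
  have "meanZ N t r 0 (r + 2 * t * \<mu>) \<le> N * psi P (r + 2 * t * \<mu>) + N * t * \<mu>\<^sup>2 / 2"
    using meanZ_unplanted_le[OF N t r True, of "r + 2 * t * \<mu>"] meanZ_zero[OF True, of N] psi_eq[OF True] by simp
  moreover have "N * (psi P (r + 2 * t * \<mu>) - t * \<mu>\<^sup>2 / 2) \<le> N * hopf_lax (psi P) t r"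
    using psi.hl_ge[OF t r True] by (intro mult_left_mono) auto
  ultimately show ?thesis by (simp add: right_diff_distrib mult.assoc)
next
  case False
  then have t0: "t > 0" using t r by (cases "t = 0") auto
  define y where "y = - (r + 2 * t * \<mu>)"
  have y: "y \<ge> 0" using False by (simp add: y_def)
  \<comment> \<open>The parameter that leads to strength \<open>y\<close>. It satisfies
    \<open>|q| \<le> |\<mu>|\<close>, so the interpolation is no more expensive than for a
    nonnegative tilt.\<close>
  define q where "q = - \<mu> - r / t"
  have q: "r + 2 * t * q = y" using t0 by (simp add: q_def y_def right_diff_distrib)
  have q': "r + 2 * t * q \<ge> 0" using q y by simp
  have "\<bar>q\<bar> \<le> \<bar>\<mu>\<bar>"
  proof -
    have d: "r / t \<ge> 0" using t r by simp
    have "r / t + 2 * \<mu> < 0" using False t0 by (simp add: field_simps)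
    then show ?thesis using d unfolding q_def by linarith
  qed
  then have "q\<^sup>2 \<le> \<mu>\<^sup>2" by (simp add: abs_le_square_iff)
  then have sq: "N * t * q\<^sup>2 \<le> N * t * \<mu>\<^sup>2" using t by (intro mult_left_mono) auto
  have "site_mean (- y) y \<le> psi P y" using site_mean_neg_le[OF y] psi_eq[OF y] by simp
  then have "N * site_mean (- y) y \<le> N * psi P y" by (intro mult_left_mono) auto
  moreover have "r + 2 * t * \<mu> = - y" by (simp add: y_def)
  ultimately have "meanZ N t r 0 (r + 2 * t * \<mu>) \<le> N * psi P y + N * t * q\<^sup>2 / 2"
    using meanZ_unplanted_le[OF N t r q', of "r + 2 * t * \<mu>"] meanZ_zero[OF y, of N "- y"] unfolding q by simp
  moreover have "N * (psi P y - t * q\<^sup>2 / 2) \<le> N * hopf_lax (psi P) t r"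
    using psi.hl_ge[OF t r q'] unfolding q by (intro mult_left_mono) auto
  ultimately show ?thesis using sq by (simp add: right_diff_distrib mult.assoc)
qed

text \<open>The quadratic side information is linearised by \<open>R\<^sup>2 \<le> 2\<mu>R - \<mu>\<^sup>2 + \<epsilon>\<^sup>2\<close> for a \<open>\<mu>\<close> in a finite
  \<open>\<epsilon>\<close>-net of the range of the overlap \<open>R\<close>.\<close>

lemma logZ_le_linearised:
  assumes N: "N > 0" and t: "t \<ge> 0" and r: "r \<ge> 0" and S: "finite S"
    and net: "\<And>R. \<bar>R\<bar> \<le> K\<^sup>2 \<Longrightarrow> \<exists>\<mu>\<in>S. \<bar>R - \<mu>\<bar> \<le> \<epsilon>"
    and y: "y \<in> space (PN N)"
  shows "logZ N t r t r y g \<le> N * hopf_lax (psi P) t r + N * t * \<epsilon>\<^sup>2 + ln (card S) +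
    (\<Sum>\<mu>\<in>S. \<bar>logZ N t r 0 (r + 2 * t * \<mu>) y g - meanZ N t r 0 (r + 2 * t * \<mu>)\<bar>)"
proof -
  interpret PN: prob_space "PN N" by (rule prob_PN)
  let ?g = "N * hopf_lax (psi P) t r"
  define D where "D = (\<Sum>\<mu>\<in>S. \<bar>logZ N t r 0 (r + 2 * t * \<mu>) y g - meanZ N t r 0 (r + 2 * t * \<mu>)\<bar>)"
  define E where "E = (\<lambda>u \<rho>. obs_energy (obs_idx N) (spin K N) (\<lambda>_ _. 0) (side K N u \<rho>) (coef N t r) y g)"
  have bm: "bounded_meas (PN N) (E u \<rho>)" for u \<rho>
    unfolding E_def by (rule gaussian_observation.bm_H[OF unplanted y])
  have lz: "logZ N t r u \<rho> y g = ln (pf (PN N) (E u \<rho>))" for u \<rho>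
    unfolding logZ_def E_def ..
  have S0: "S \<noteq> {}" using net[of 0] by auto
  \<comment> \<open>The good \<mu> depends on \<open>x\<close>; summing over the whole net removes
    this dependence at the price of the factor \<open>card S\<close>.\<close>
  have pt: "exp (E t r x) \<le> (\<Sum>\<mu>\<in>S. exp (N * t * (\<epsilon>\<^sup>2 - \<mu>\<^sup>2)) * exp (E 0 (r + 2 * t * \<mu>) x))" for x
  proof -
    define R where "R = ovl K N y x / N"
    have "\<bar>R\<bar> \<le> K\<^sup>2" using ovl_le[of N y x] N by (simp add: R_def divide_le_eq mult.commute)
    then obtain \<mu> where \<mu>: "\<mu> \<in> S" "\<bar>R - \<mu>\<bar> \<le> \<epsilon>" using net by blast
    have "(R - \<mu>)\<^sup>2 \<le> \<epsilon>\<^sup>2" using power_mono[OF \<mu>(2), of 2] by simp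
    then have "N * t * R\<^sup>2 \<le> N * t * (2 * \<mu> * R - \<mu>\<^sup>2 + \<epsilon>\<^sup>2)"
      using t by (intro mult_left_mono) (auto simp: power2_diff mult_ac)
    moreover have o: "ovl K N y x = N * R" using N by (simp add: R_def)
    have "side K N t r y x = N * t * R\<^sup>2 + r * N * R"
      using N unfolding side_def o by (simp add: power2_eq_square)
    moreover have "side K N 0 (r + 2 * t * \<mu>) y x = r * N * R + N * t * (2 * \<mu> * R)"
      unfolding side_def o by (simp add: algebra_simps)
    ultimately have "side K N t r y x \<le> N * t * (\<epsilon>\<^sup>2 - \<mu>\<^sup>2) + side K N 0 (r + 2 * t * \<mu>) y x"
      by (simp add: right_diff_distrib distrib_left)
    then have "E t r x \<le> N * t * (\<epsilon>\<^sup>2 - \<mu>\<^sup>2) + E 0 (r + 2 * t * \<mu>) x"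
      unfolding E_def obs_energy_def by simp
    then have "exp (E t r x) \<le> exp (N * t * (\<epsilon>\<^sup>2 - \<mu>\<^sup>2)) * exp (E 0 (r + 2 * t * \<mu>) x)"
      unfolding exp_add[symmetric] by simp
    also have "\<dots> \<le> (\<Sum>\<mu>\<in>S. exp (N * t * (\<epsilon>\<^sup>2 - \<mu>\<^sup>2)) * exp (E 0 (r + 2 * t * \<mu>) x))"
      by (rule member_le_sum[OF \<mu>(1) _ S, of "\<lambda>\<mu>. exp (N * t * (\<epsilon>\<^sup>2 - \<mu>\<^sup>2)) * exp (E 0 (r + 2 * t * \<mu>) x)"]) simp
    finally show ?thesis .
  qed
  have ints: "integrable (PN N) (\<lambda>x. c * exp (E u \<rho> x))" for c u \<rho>
    by (intro PN.bounded_meas_integrable bounded_meas_cmult bounded_meas_exp bm)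
  have "pf (PN N) (E t r) \<le> (\<integral>x. (\<Sum>\<mu>\<in>S. exp (N * t * (\<epsilon>\<^sup>2 - \<mu>\<^sup>2)) * exp (E 0 (r + 2 * t * \<mu>) x)) \<partial>PN N)"
    unfolding pf_def using pt ints[of 1] ints by (intro integral_mono Bochner_Integration.integrable_sum) auto
  also have "\<dots> = (\<Sum>\<mu>\<in>S. exp (N * t * (\<epsilon>\<^sup>2 - \<mu>\<^sup>2)) * pf (PN N) (E 0 (r + 2 * t * \<mu>)))"
    unfolding pf_def by (subst Bochner_Integration.integral_sum) (use ints in auto)
  also have "\<dots> \<le> (\<Sum>\<mu>\<in>S. exp (N * t * \<epsilon>\<^sup>2 + ?g + D))"
  proof (rule sum_mono)
    fix \<mu> assume \<mu>: "\<mu> \<in> S"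
    have "\<bar>logZ N t r 0 (r + 2 * t * \<mu>) y g - meanZ N t r 0 (r + 2 * t * \<mu>)\<bar> \<le> D"
      unfolding D_def by (rule member_le_sum[OF \<mu> _ S]) simp
    then have "logZ N t r 0 (r + 2 * t * \<mu>) y g \<le> ?g + N * t * \<mu>\<^sup>2 + D"
      using meanZ_linear_le[OF N t r, of \<mu>] by linarith
    then have "exp (N * t * (\<epsilon>\<^sup>2 - \<mu>\<^sup>2)) * exp (logZ N t r 0 (r + 2 * t * \<mu>) y g) \<le>
      exp (N * t * (\<epsilon>\<^sup>2 - \<mu>\<^sup>2)) * exp (?g + N * t * \<mu>\<^sup>2 + D)" by simp
    also have "\<dots> = exp (N * t * \<epsilon>\<^sup>2 + ?g + D)"
      unfolding exp_add[symmetric] by (simp add: right_diff_distrib)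
    finally show "exp (N * t * (\<epsilon>\<^sup>2 - \<mu>\<^sup>2)) * pf (PN N) (E 0 (r + 2 * t * \<mu>)) \<le> exp (N * t * \<epsilon>\<^sup>2 + ?g + D)"
      unfolding lz using PN.pf_pos[OF bm] by simp
  qed
  also have "\<dots> = card S * exp (N * t * \<epsilon>\<^sup>2 + ?g + D)" by simp
  finally have le: "pf (PN N) (E t r) \<le> card S * exp (N * t * \<epsilon>\<^sup>2 + ?g + D)" .
  have pos: "pf (PN N) (E t r) > 0" by (rule PN.pf_pos[OF bm])
  have "ln (pf (PN N) (E t r)) \<le> ln (card S * exp (N * t * \<epsilon>\<^sup>2 + ?g + D))"
    by (rule ln_le_cancel_iff[THEN iffD2, OF pos less_le_trans[OF pos le] le])
  also have "\<dots> = ln (card S) + (N * t * \<epsilon>\<^sup>2 + ?g + D)"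
    using S S0 by (simp add: ln_mult card_gt_0_iff)
  finally show ?thesis unfolding lz[symmetric] D_def by simp
qed

text \<open>Besides \<open>N * t * \<epsilon>^2\<close>, the errors are a constant and finitely many
  deviations of order \<open>sqrt N\<close>, so for a fixed net they vanish after division by
  \<open>N\<close>.\<close>

lemma meanZ_le_hopf_lax:
  assumes N: "N > 0" and t: "t \<ge> 0" and r: "r \<ge> 0" and S: "finite S"
    and net: "\<And>R. \<bar>R\<bar> \<le> K\<^sup>2 \<Longrightarrow> \<exists>\<mu>\<in>S. \<bar>R - \<mu>\<bar> \<le> \<epsilon>"
  shows "meanZ N t r t r \<le> N * hopf_lax (psi P) t r + N * t * \<epsilon>\<^sup>2 + ln (card S) +
    (\<Sum>\<mu>\<in>S. sqrt (N * var_const t r 0 (r + 2 * t * \<mu>)))"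
proof -
  interpret M: prob_space "PN N \<Otimes>\<^sub>M GN N" by (rule prob_PG)
  note m = logZ_meas[OF N t r] and sq = logZ_square_integrable[OF N t r]
  note int = M.integrable_of_square[OF m sq]
  let ?c = "N * hopf_lax (psi P) t r + N * t * \<epsilon>\<^sup>2 + ln (card S)"
  let ?d = "\<lambda>\<mu> p. \<bar>logZ N t r 0 (r + 2 * t * \<mu>) (fst p) (snd p) - meanZ N t r 0 (r + 2 * t * \<mu>)\<bar>"
  have di: "integrable (PN N \<Otimes>\<^sub>M GN N) (?d \<mu>)" for \<mu>
    using int by (intro integrable_abs Bochner_Integration.integrable_diff) auto
  have "meanZ N t r t r \<le> (\<integral>p. ?c + (\<Sum>\<mu>\<in>S. ?d \<mu> p) \<partial>(PN N \<Otimes>\<^sub>M GN N))"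
    unfolding meanZ_def[of N t r t r]
  proof (rule integral_mono)
    show "integrable (PN N \<Otimes>\<^sub>M GN N) (\<lambda>p. ?c + (\<Sum>\<mu>\<in>S. ?d \<mu> p))"
      using di by (intro Bochner_Integration.integrable_add Bochner_Integration.integrable_sum) auto
    fix p assume "p \<in> space (PN N \<Otimes>\<^sub>M GN N)"
    then have "fst p \<in> space (PN N)" by (auto simp: space_pair_measure)
    from logZ_le_linearised[OF N t r S net this]
    show "logZ N t r t r (fst p) (snd p) \<le> ?c + (\<Sum>\<mu>\<in>S. ?d \<mu> p)" .
  qed (rule int)
  also have "\<dots> = ?c + (\<Sum>\<mu>\<in>S. \<integral>p. ?d \<mu> p \<partial>(PN N \<Otimes>\<^sub>M GN N))"
    using di by (subst Bochner_Integration.integral_add)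
      (auto simp: M.prob_space intro!: Bochner_Integration.integral_sum Bochner_Integration.integrable_sum)
  also have "(\<Sum>\<mu>\<in>S. \<integral>p. ?d \<mu> p \<partial>(PN N \<Otimes>\<^sub>M GN N)) \<le> (\<Sum>\<mu>\<in>S. sqrt (N * var_const t r 0 (r + 2 * t * \<mu>)))"
  proof (rule sum_mono)
    fix \<mu>
    have "(\<integral>p. ?d \<mu> p \<partial>(PN N \<Otimes>\<^sub>M GN N)) \<le> sqrt (var (PN N \<Otimes>\<^sub>M GN N) (\<lambda>p. logZ N t r 0 (r + 2 * t * \<mu>) (fst p) (snd p)))"
      using M.abs_deviation_le[OF m sq] unfolding meanZ_def .
    also have "\<dots> \<le> sqrt (N * var_const t r 0 (r + 2 * t * \<mu>))"
      by (intro real_sqrt_le_mono logZ_var[OF N t r])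
    finally show "(\<integral>p. ?d \<mu> p \<partial>(PN N \<Otimes>\<^sub>M GN N)) \<le> sqrt (N * var_const t r 0 (r + 2 * t * \<mu>))" .
  qed
  finally show ?thesis by simp
qed

lemma meanZ_limit:
  assumes t: "t \<ge> 0" and r: "r \<ge> 0"
  shows "(\<lambda>N. meanZ N t r t r / N) \<longlonglongrightarrow> hopf_lax (psi P) t r"
proof (rule LIMSEQ_I)
  fix e :: real assume e: "e > 0"
  \<comment> \<open>The mesh is fixed before \<open>N\<close> grows: it costs at most
    \<open>e / 2\<close>, and \<open>N\<close> is then taken large for the resulting net.\<close>
  obtain \<epsilon> where \<epsilon>: "\<epsilon> > 0" "t * \<epsilon>\<^sup>2 \<le> e / 2"
  proof -
    obtain x where x: "x > 0" "t * x \<le> e / 2" "1 * x \<le> 1" "1 * x \<le> 1"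
      using ex_pos_mult_le3[of "e / 2" 1 1] e by (metis half_gt_zero zero_less_one)
    have "x\<^sup>2 \<le> x" using x mult_right_mono[of x 1 x] by (simp add: power2_eq_square)
    then have "t * x\<^sup>2 \<le> t * x" using t by (intro mult_left_mono)
    then show thesis using that[of x] x by linarith
  qed
  obtain S where S: "finite S" "\<And>R. \<bar>R\<bar> \<le> K\<^sup>2 \<Longrightarrow> \<exists>\<mu>\<in>S. \<bar>R - \<mu>\<bar> \<le> \<epsilon>"
  proof -
    have "seq_compact {- K\<^sup>2..K\<^sup>2}" by (simp add: compact_imp_seq_compact)
    from seq_compact_imp_totally_bounded[OF this] \<epsilon>(1) obtain S where
      "finite S" "{- K\<^sup>2..K\<^sup>2} \<subseteq> (\<Union>x\<in>S. ball x \<epsilon>)" by blast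
    show thesis
    proof (rule that[OF \<open>finite S\<close>])
      fix R assume "\<bar>R\<bar> \<le> K\<^sup>2"
      then have "R \<in> {- K\<^sup>2..K\<^sup>2}" by (auto simp: abs_le_iff)
      then obtain x where "x \<in> S" "R \<in> ball x \<epsilon>"
        using \<open>{- K\<^sup>2..K\<^sup>2} \<subseteq> _\<close> by blast
      then show "\<exists>\<mu>\<in>S. \<bar>R - \<mu>\<bar> \<le> \<epsilon>"
        by (intro bexI[of _ x]) (auto simp: dist_real_def abs_minus_commute)
    qed
  qed
  let ?u = "\<lambda>N. ln (card S) * inverse (real N) + (\<Sum>\<mu>\<in>S. sqrt (inverse (real N) * var_const t r 0 (r + 2 * t * \<mu>)))"
  have "?u \<longlonglongrightarrow> ln (card S) * 0 + (\<Sum>\<mu>\<in>S. sqrt (0 * var_const t r 0 (r + 2 * t * \<mu>)))"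
    by (intro tendsto_intros lim_inverse_n)
  then have "?u \<longlonglongrightarrow> 0" by simp
  then have "eventually (\<lambda>N. ?u N < e / 2) sequentially" using e by (intro order_tendstoD(2)) auto
  then have "eventually (\<lambda>N. norm (meanZ N t r t r / N - hopf_lax (psi P) t r) < e) sequentially"
    using eventually_gt_at_top[of 0]
  proof eventually_elim
    case (elim N)
    have N: "real N > 0" using elim by simp
    have sq: "sqrt (N * c) = N * sqrt (inverse (real N) * c)" for c :: real
    proof -
      have "N * c = (real N)\<^sup>2 * (inverse (real N) * c)" using N by (simp add: power2_eq_square)
      then have "sqrt (N * c) = sqrt ((real N)\<^sup>2 * (inverse (real N) * c))" by (rule arg_cong)
      also have "\<dots> = N * sqrt (inverse (real N) * c)" unfolding real_sqrt_mult[of "(real N)\<^sup>2"] by simp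
      finally show ?thesis .
    qed
    have "N * ?u N = ln (card S) + (\<Sum>\<mu>\<in>S. sqrt (N * var_const t r 0 (r + 2 * t * \<mu>)))"
      unfolding distrib_left sum_distrib_left sq using N by simp
    then have "meanZ N t r t r \<le> N * (hopf_lax (psi P) t r + t * \<epsilon>\<^sup>2 + ?u N)"
      using meanZ_le_hopf_lax[OF elim(2) t r S] unfolding distrib_left[of "real N"] mult.assoc[of "real N"] by linarith
    then have "meanZ N t r t r / N \<le> hopf_lax (psi P) t r + t * \<epsilon>\<^sup>2 + ?u N"
      using N by (simp add: divide_le_eq mult.commute)
    moreover have "hopf_lax (psi P) t r \<le> meanZ N t r t r / N"
      using meanZ_ge_hopf_lax[OF elim(2) t r] N by (simp add: le_divide_eq mult.commute)
    ultimately show ?case using elim(1) \<epsilon>(2) by (simp add: abs_less_iff)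
  qed
  then show "\<exists>no. \<forall>N\<ge>no. norm (meanZ N t r t r / N - hopf_lax (psi P) t r) < e"
    by (simp add: eventually_sequentially)
qed

text \<open>Bias and variance: the variance of \<open>logZ\<close> is \<open>O(N)\<close>, hence
  \<open>O(1 / N)\<close> after scaling, and the bias vanishes by
  \<open>meanZ_limit\<close>.\<close>

lemma logZ_L2_limit:
  assumes t: "t \<ge> 0" and r: "r \<ge> 0"
  shows "(\<lambda>N. \<integral>p. (logZ N t r t r (fst p) (snd p) / N - hopf_lax (psi P) t r)\<^sup>2 \<partial>(PN N \<Otimes>\<^sub>M GN N)) \<longlonglongrightarrow> 0"
proof -
  let ?g = "hopf_lax (psi P) t r"
  have "(\<lambda>N. var_const t r t r * inverse (real N) + (meanZ N t r t r / N - ?g)\<^sup>2) \<longlonglongrightarrow> var_const t r t r * 0 + (?g - ?g)\<^sup>2"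
    by (intro tendsto_intros lim_inverse_n meanZ_limit t r)
  then have lim: "(\<lambda>N. var_const t r t r * inverse (real N) + (meanZ N t r t r / N - ?g)\<^sup>2) \<longlonglongrightarrow> 0" by simp
  show ?thesis
  proof (rule tendsto_sandwich[OF _ _ tendsto_const lim])
    show "\<forall>\<^sub>F N in sequentially. 0 \<le> (\<integral>p. (logZ N t r t r (fst p) (snd p) / N - ?g)\<^sup>2 \<partial>(PN N \<Otimes>\<^sub>M GN N))" by simp
    show "\<forall>\<^sub>F N in sequentially. (\<integral>p. (logZ N t r t r (fst p) (snd p) / N - ?g)\<^sup>2 \<partial>(PN N \<Otimes>\<^sub>M GN N)) \<le>
      var_const t r t r * inverse (real N) + (meanZ N t r t r / N - ?g)\<^sup>2"
      using eventually_gt_at_top[of 0]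
    proof eventually_elim
      case (elim N)
      interpret M: prob_space "PN N \<Otimes>\<^sub>M GN N" by (rule prob_PG)
      note m = logZ_meas[OF elim t r] and sq = logZ_square_integrable[OF elim t r]
      let ?Z = "\<lambda>p. logZ N t r t r (fst p) (snd p)"
      have N: "real N > 0" using elim by simp
      have "(?Z p / N - ?g)\<^sup>2 = (?Z p - N * ?g)\<^sup>2 / N\<^sup>2" for p
        using N by (simp add: field_simps flip: power_divide)
      then have "(\<integral>p. (?Z p / N - ?g)\<^sup>2 \<partial>(PN N \<Otimes>\<^sub>M GN N)) = (\<integral>p. (?Z p - N * ?g)\<^sup>2 \<partial>(PN N \<Otimes>\<^sub>M GN N)) / N\<^sup>2"
        by simp
      also have "\<dots> = (var (PN N \<Otimes>\<^sub>M GN N) ?Z + (meanZ N t r t r - N * ?g)\<^sup>2) / N\<^sup>2"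
        unfolding M.integral_square_shift(1)[OF m sq] meanZ_def ..
      also have "\<dots> \<le> (N * var_const t r t r + (meanZ N t r t r - N * ?g)\<^sup>2) / N\<^sup>2"
        using logZ_var[OF elim t r] by (intro divide_right_mono add_right_mono) auto
      also have "\<dots> = var_const t r t r * inverse (real N) + ((meanZ N t r t r - N * ?g) / N)\<^sup>2"
        using N by (simp add: add_divide_distrib power_divide power2_eq_square field_simps)
      also have "(meanZ N t r t r - N * ?g) / N = meanZ N t r t r / N - ?g"
        using N by (simp add: diff_divide_distrib)
      finally show ?case .
    qed
  qed
qed

end

section \<open>From pointwise to locally uniform convergence\<close>

text \<open>Hoelder's inequality. Subtracting \<open>a\<close> and \<open>b\<close> from the
  energies normalises both partition functions to \<open>1\<close>, after which convexity of
  \<open>exp\<close> can be integrated.\<close>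

lemma (in prob_space) ln_pf_convex:
  assumes bm: "bounded_meas M B" "bounded_meas M B0" "bounded_meas M B1" and u: "0 \<le> u" "u \<le> (1::real)"
    and le: "\<And>x. x \<in> space M \<Longrightarrow> B x \<le> (1 - u) * B0 x + u * B1 x"
  shows "ln (pf M B) \<le> (1 - u) * ln (pf M B0) + u * ln (pf M B1)"
proof -
  define a where "a = ln (pf M B0)"
  define b where "b = ln (pf M B1)"
  define c where "c = (1 - u) * a + u * b"
  have ea: "pf M B0 = exp a" and eb: "pf M B1 = exp b" using pf_pos bm by (simp_all add: a_def b_def)
  have pt: "exp (B x) \<le> exp c * ((1 - u) * (exp (- a) * exp (B0 x)) + u * (exp (- b) * exp (B1 x)))"
    if "x \<in> space M" for x
  proof -
    have "exp (B x) \<le> exp (c + ((1 - u) * (B0 x - a) + u * (B1 x - b)))"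
      using le[OF that] by (simp add: c_def algebra_simps)
    also have "\<dots> = exp c * exp ((1 - u) *\<^sub>R (B0 x - a) + u *\<^sub>R (B1 x - b))" by (simp add: exp_add)
    also have "exp ((1 - u) *\<^sub>R (B0 x - a) + u *\<^sub>R (B1 x - b)) \<le> (1 - u) * exp (B0 x - a) + u * exp (B1 x - b)"
      using convex_onD[OF exp_convex, of u "B0 x - a" "B1 x - b"] u by auto
    finally show ?thesis by (simp add: exp_diff exp_minus field_simps)
  qed
  have "pf M B \<le> (\<integral>x. exp c * ((1 - u) * (exp (- a) * exp (B0 x)) + u * (exp (- b) * exp (B1 x))) \<partial>M)"
    unfolding pf_def using pt bm
    by (intro integral_mono bounded_meas_integrable bounded_meas_intros) auto
  also have "\<dots> = exp c * ((1 - u) * (exp (- a) * pf M B0) + u * (exp (- b) * pf M B1))"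
    unfolding pf_def using bm
    by (simp add: bounded_meas_integrable bounded_meas_intros)
  also have "\<dots> = exp c" unfolding ea eb by (simp flip: exp_add)
  finally have "ln (pf M B) \<le> ln (exp c)" using pf_pos[OF bm(1)] by (subst ln_le_cancel_iff) auto
  then show ?thesis by (simp add: c_def a_def b_def)
qed

lemma convex_on_le_max:
  fixes G :: "'a::real_vector \<Rightarrow> real"
  assumes "convex_on S G" "a \<in> S" "b \<in> S" "0 \<le> u" "u \<le> 1"
  shows "G ((1 - u) *\<^sub>R a + u *\<^sub>R b) \<le> max (G a) (G b)"
proof -
  have "G ((1 - u) *\<^sub>R a + u *\<^sub>R b) \<le> (1 - u) * G a + u * G b"
    using assms by (intro convex_onD) auto
  also have "\<dots> \<le> (1 - u) * max (G a) (G b) + u * max (G a) (G b)"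
    using assms by (intro add_mono mult_left_mono) auto
  finally show ?thesis by (simp add: left_diff_distrib)
qed

text \<open>Convexity along one coordinate and then along the other bounds the value by that at one
  of the four corners.\<close>

lemma convex_on_cell_le:
  fixes G :: "real \<times> real \<Rightarrow> real"
  assumes G: "convex_on quadrant G" and d: "d > 0"
    and s: "0 \<le> i" "i \<le> s" "s \<le> i + d" and t: "0 \<le> j" "j \<le> t" "t \<le> j + d"
  shows "\<exists>a\<in>{i, i + d}. \<exists>b\<in>{j, j + d}. G (s, t) \<le> G (a, b)"
proof -
  have *: "\<exists>u. 0 \<le> u \<and> u \<le> 1 \<and> x = (1 - u) * k + u * (k + d)" if "k \<le> x" "x \<le> k + d" for x k
    using that d by (intro exI[of _ "(x - k) / d"]) (auto simp: field_simps)
  obtain u where u: "0 \<le> u" "u \<le> 1" "s = (1 - u) * i + u * (i + d)" using *[OF s(2,3)] by blast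
  obtain v where v: "0 \<le> v" "v \<le> 1" "t = (1 - v) * j + v * (j + d)" using *[OF t(2,3)] by blast
  have q: "(a, b) \<in> quadrant" if "a \<in> {i, i + d, s}" "b \<in> {j, j + d, t}" for a b
    using that s t d by (auto simp: quadrant_def)
  have "(s, t) = (1 - u) *\<^sub>R (i, t) + u *\<^sub>R (i + d, t)" using u by (simp add: algebra_simps)
  then have 1: "G (s, t) \<le> max (G (i, t)) (G (i + d, t))"
    using convex_on_le_max[OF G q q u(1,2), of i t "i + d" t] by auto
  have "G (a, t) \<le> max (G (a, j)) (G (a, j + d))" if "a \<in> {i, i + d}" for a
  proof -
    have "(a, t) = (1 - v) *\<^sub>R (a, j) + v *\<^sub>R (a, j + d)" using v by (simp add: algebra_simps)
    then show ?thesis using convex_on_le_max[OF G q q v(1,2), of a j a "j + d"] that by auto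
  qed
  from this[of i] this[of "i + d"] 1 show ?thesis by (auto simp: le_max_iff_disj intro: order_trans)
qed

text \<open>A convex function that is close to a continuous one on a finite grid is close to it
  everywhere: upper bounds come from the corners of a cell, lower bounds from reflecting the point
  at a corner.\<close>

lemma convex_grid_approximation:
  fixes g :: "real \<times> real \<Rightarrow> real"
  assumes g: "continuous_on quadrant g" and b: "b > 0" and \<epsilon>: "\<epsilon> > 0"
  shows "\<exists>S. finite S \<and> S \<subseteq> quadrant \<and> (\<forall>G p. convex_on quadrant G \<and> p \<in> {0..b} \<times> {0..b} \<longrightarrow>
    \<bar>G p - g p\<bar> \<le> \<epsilon> + 3 * (\<Sum>c\<in>S. \<bar>G c - g c\<bar>))"
proof -
  \<comment> \<open>Margin \<open>3\<close>: a reflected point exceeds \<open>b\<close> by up to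
    \<open>2 * d \<le> 2\<close>, and the cell around it by another
    \<open>d \<le> 1\<close>.\<close>
  define B :: "(real \<times> real) set" where "B = {0..b + 3} \<times> {0..b + 3}"
  have "uniformly_continuous_on B g"
    by (intro compact_uniformly_continuous continuous_on_subset[OF g])
      (auto simp: B_def quadrant_def intro: compact_Times)
  then obtain e where e: "e > 0" "\<And>p q. p \<in> B \<Longrightarrow> q \<in> B \<Longrightarrow> dist q p < e \<Longrightarrow> dist (g q) (g p) < \<epsilon> / 3"
    using \<epsilon> unfolding uniformly_continuous_on_def by (metis divide_pos_pos zero_less_numeral)
  define d where "d = min 1 (e / 4)"
  have d: "d > 0" "d \<le> 1" "2 * d < e" using e by (auto simp: d_def)
  have near: "\<bar>g (s, t) - g (s', t')\<bar> \<le> \<epsilon> / 3"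
    if "(s, t) \<in> B" "(s', t') \<in> B" "\<bar>s - s'\<bar> \<le> d" "\<bar>t - t'\<bar> \<le> d" for s t s' t'
  proof -
    have "dist (s, t) (s', t') \<le> \<bar>s - s'\<bar> + \<bar>t - t'\<bar>"
      using sqrt_sum_squares_le_sum_abs[of "s - s'" "t - t'"] by (simp add: dist_Pair_Pair dist_real_def)
    then have "dist (s, t) (s', t') < e" using that d by linarith
    then show ?thesis using e(2)[OF that(2,1)] by (simp add: dist_real_def)
  qed
  obtain n :: nat where n: "b + 2 \<le> n * d" using reals_Archimedean3[OF d(1)] by (meson less_imp_le)
  define S where "S = (\<lambda>(i, j). (real i * d, real j * d)) ` ({i. i * d \<le> b + 3} \<times> {i. i * d \<le> b + 3})"
  have fin: "finite {i::nat. i * d \<le> b + 3}"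
  proof -
    obtain m :: nat where m: "b + 3 < m * d" using reals_Archimedean3[OF d(1)] by blast
    have "{i::nat. i * d \<le> b + 3} \<subseteq> {..m}"
    proof
      fix i :: nat assume "i \<in> {i. i * d \<le> b + 3}"
      then have "real i * d < m * d" using m by simp
      then show "i \<in> {..m}" using d by simp
    qed
    then show ?thesis by (rule finite_subset) simp
  qed
  have S: "finite S" "S \<subseteq> B"
    using fin d by (auto simp: S_def B_def)
  have SQ: "S \<subseteq> quadrant" using S(2) by (auto simp: B_def quadrant_def)
  have cell: "\<exists>i::nat. i * d \<le> x \<and> x \<le> i * d + d" if "x \<ge> 0" for x
  proof (intro exI conjI)
    have "real (nat \<lfloor>x / d\<rfloor>) = of_int \<lfloor>x / d\<rfloor>" using that d by simp
    moreover have "of_int \<lfloor>x / d\<rfloor> * d \<le> x / d * d" using d by (intro mult_right_mono) auto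
    moreover have "x / d * d \<le> (of_int \<lfloor>x / d\<rfloor> + 1) * d" using d by (intro mult_right_mono) (linarith, simp)
    ultimately show "real (nat \<lfloor>x / d\<rfloor>) * d \<le> x" "x \<le> real (nat \<lfloor>x / d\<rfloor>) * d + d"
      using d by (auto simp: distrib_right)
  qed
  show ?thesis
  proof (intro exI[of _ S] conjI allI impI S(1) SQ)
    fix G p assume a: "convex_on quadrant G \<and> p \<in> {0..b} \<times> {0..b}"
    then have G: "convex_on quadrant G" by simp
    define D where "D = (\<Sum>c\<in>S. \<bar>G c - g c\<bar>)"
    have D: "\<bar>G c - g c\<bar> \<le> D" if "c \<in> S" for c
      unfolding D_def by (rule member_le_sum[OF that _ S(1)]) simp
    have upper: "G (s, t) \<le> g (s, t) + \<epsilon> / 3 + D" if st: "0 \<le> s" "s \<le> b + 2" "0 \<le> t" "t \<le> b + 2" for s t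
    proof -
      obtain i :: nat where i: "i * d \<le> s" "s \<le> i * d + d" using cell[OF st(1)] by blast
      obtain j :: nat where j: "j * d \<le> t" "t \<le> j * d + d" using cell[OF st(3)] by blast
      obtain x y where xy: "x \<in> {i * d, i * d + d}" "y \<in> {j * d, j * d + d}" "G (s, t) \<le> G (x, y)"
        using convex_on_cell_le[OF G d(1) _ i _ j] d by auto
      have sucs: "real (Suc k) * d = k * d + d" for k by (simp add: distrib_right)
      have xS: "\<exists>k::nat. x = k * d \<and> k * d \<le> b + 3"
        using xy(1) i st(2) d sucs[of i] by (auto intro: exI[of _ i] exI[of _ "Suc i"])
      have yS: "\<exists>k::nat. y = k * d \<and> k * d \<le> b + 3"
        using xy(2) j st(4) d sucs[of j] by (auto intro: exI[of _ j] exI[of _ "Suc j"])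
      from xS yS have "(x, y) \<in> S" unfolding S_def by force
      moreover have "\<bar>x - s\<bar> \<le> d" "\<bar>y - t\<bar> \<le> d" using xy i j d by auto
      moreover have "(s, t) \<in> B" using st by (auto simp: B_def)
      ultimately have "\<bar>g (x, y) - g (s, t)\<bar> \<le> \<epsilon> / 3" "\<bar>G (x, y) - g (x, y)\<bar> \<le> D"
        using near[of x y s t] D S(2) by auto
      then show ?thesis using xy(3) by linarith
    qed
    obtain s t where p: "p = (s, t)" "0 \<le> s" "s \<le> b" "0 \<le> t" "t \<le> b" using a by auto
    obtain i :: nat where i: "i * d \<le> s" "s \<le> i * d + d" using cell[OF p(2)] by blast
    obtain j :: nat where j: "j * d \<le> t" "t \<le> j * d + d" using cell[OF p(4)] by blast
    \<comment> \<open>The upper corner of the cell: reflecting \<open>(s, t)\<close> at it leads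
      away from the axes, so the reflected point stays in the quadrant.\<close>
    define x where "x = real (Suc i) * d"
    define y where "y = real (Suc j) * d"
    have xi: "x = i * d + d" "y = j * d + d" by (simp_all add: x_def y_def distrib_right)
    have xb: "s \<le> x" "x \<le> s + d" "t \<le> y" "y \<le> t + d" using i j by (auto simp: xi)
    have xS: "(x, y) \<in> S"
      unfolding S_def using xb p d by (auto simp: x_def y_def intro!: image_eqI[of _ _ "(Suc i, Suc j)"])
    have Bs: "(s, t) \<in> B" "(x, y) \<in> B" "(2 * x - s, 2 * y - t) \<in> B"
      using xb p d by (auto simp: B_def)
    \<comment> \<open>The corner is the midpoint of the point and its reflection, so
      \<open>G (s, t) \<ge> 2 * G (x, y) - G'\<close>. Bounding the right side from below uses the
      grid error \<open>D\<close> three times and \<open>\<epsilon> / 3\<close> three times.\<close>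
    have "(x, y) = (1 - 1 / 2) *\<^sub>R (s, t) + (1 / 2) *\<^sub>R (2 * x - s, 2 * y - t)"
      by (simp add: algebra_simps)
    moreover have "G ((1 - 1 / 2) *\<^sub>R (s, t) + (1 / 2) *\<^sub>R (2 * x - s, 2 * y - t)) \<le>
      (1 - 1 / 2) * G (s, t) + (1 / 2) * G (2 * x - s, 2 * y - t)"
      using Bs by (intro convex_onD[OF G]) (auto simp: B_def quadrant_def)
    moreover define G' where "G' = G (2 * x - s, 2 * y - t)"
    moreover define g' where "g' = g (2 * x - s, 2 * y - t)"
    ultimately have "2 * G (x, y) \<le> G (s, t) + G'" by simp
    moreover have "G' \<le> g' + \<epsilon> / 3 + D"
      unfolding G'_def g'_def using xb p d by (intro upper) auto
    moreover have "\<bar>g' - g (x, y)\<bar> \<le> \<epsilon> / 3"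
      unfolding g'_def using xb by (intro near Bs) auto
    moreover have "\<bar>g (x, y) - g (s, t)\<bar> \<le> \<epsilon> / 3" using xb by (intro near Bs) auto
    moreover have "\<bar>G (x, y) - g (x, y)\<bar> \<le> D" by (rule D[OF xS])
    moreover have "G (s, t) \<le> g (s, t) + \<epsilon> / 3 + D" using p by (intro upper) auto
    moreover have "D \<ge> 0" unfolding D_def by (rule sum_nonneg) simp
    ultimately show "\<bar>G p - g p\<bar> \<le> \<epsilon> + 3 * (\<Sum>c\<in>S. \<bar>G c - g c\<bar>)"
      unfolding p(1) D_def[symmetric] using \<epsilon> by linarith
  qed
qed

context bounded_prior
begin

text \<open>In square root coordinates the Gaussian terms of the energy are linear, because the
  square root of the strength multiplies the noise, and the rest is quadratic. The added multiple of
  \<open>|p|^2\<close> makes the quadratic coefficients nonnegative, so the energy is convex for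
  each \<open>x\<close> and \<open>ln_pf_convex\<close> applies.\<close>

lemma logZ_convex:
  assumes N: "N > 0" and y: "y \<in> space (PN N)"
  shows "convex_on quadrant (\<lambda>p. logZ N ((fst p)\<^sup>2) ((snd p)\<^sup>2) ((fst p)\<^sup>2) ((snd p)\<^sup>2) y g / N +
    2 * (K\<^sup>2)\<^sup>2 * ((fst p)\<^sup>2 + (snd p)\<^sup>2))"
proof -
  interpret PN: prob_space "PN N" by (rule prob_PN)
  define C where "C = 2 * (K\<^sup>2)\<^sup>2"
  define B where "B = (\<lambda>p x. obs_energy (obs_idx N) (spin K N) (\<lambda>_ _. 0) (side K N ((fst p)\<^sup>2) ((snd p)\<^sup>2))
    (coef N ((fst p)\<^sup>2) ((snd p)\<^sup>2)) y g x + N * C * ((fst p)\<^sup>2 + (snd p)\<^sup>2))"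
  have bm0: "bounded_meas (PN N) (obs_energy (obs_idx N) (spin K N) (\<lambda>_ _. 0) (side K N u \<rho>) v y g)" for u \<rho> v
    by (rule gaussian_observation.bm_H[OF unplanted y])
  have bm: "bounded_meas (PN N) (B p)" for p
    unfolding B_def by (intro bounded_meas_add bm0 bounded_meas_const)
  have ln_B: "ln (pf (PN N) (B p)) = logZ N ((fst p)\<^sup>2) ((snd p)\<^sup>2) ((fst p)\<^sup>2) ((snd p)\<^sup>2) y g + N * C * ((fst p)\<^sup>2 + (snd p)\<^sup>2)" for p
  proof -
    have "pf (PN N) (B p) = pf (PN N) (obs_energy (obs_idx N) (spin K N) (\<lambda>_ _. 0) (side K N ((fst p)\<^sup>2) ((snd p)\<^sup>2))
      (coef N ((fst p)\<^sup>2) ((snd p)\<^sup>2)) y g) * exp (N * C * ((fst p)\<^sup>2 + (snd p)\<^sup>2))"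
      unfolding pf_def B_def by (simp add: exp_add)
    then show ?thesis unfolding logZ_def
      using PN.pf_pos[OF bm0, THEN less_imp_neq, THEN not_sym] by (simp add: ln_mult)
  qed
  have N0: "real N > 0" using N by simp
  have cvx: "B ((1 - u) *\<^sub>R p + u *\<^sub>R q) x \<le> (1 - u) * B p x + u * B q x"
    if pq: "p \<in> quadrant" "q \<in> quadrant" and u: "0 \<le> u" "u \<le> 1" for p q u x
  proof -
    define \<alpha> where "\<alpha> = (\<Sum>i<N. \<Sum>j<N. clip K (x i) * g (i, j) * clip K (x j)) / sqrt N"
    define \<beta> where "\<beta> = (\<Sum>i<N. g (i, N) * clip K (x i))"
    \<comment> \<open>The negative parts of the two quadratic coefficients are at most
      \<open>N * K^4 / 2\<close> and \<open>3 * N * K^2 / 2\<close>; both are below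
      \<open>N * C\<close> because \<open>K \<ge> 1\<close>.\<close>
    define \<gamma> where "\<gamma> = (ovl K N y x)\<^sup>2 / N - (ovl K N x x)\<^sup>2 / (2 * N) + N * C"
    define \<delta> where "\<delta> = ovl K N y x - ovl K N x x / 2 + N * C"
    have K4: "K\<^sup>2 \<le> (K\<^sup>2)\<^sup>2" using K1 power_increasing[of 2 4 K] by (simp flip: power_mult)
    have g0: "\<gamma> \<ge> 0"
    proof -
      have "(ovl K N x x)\<^sup>2 \<le> (N * K\<^sup>2)\<^sup>2" using ovl_le[of N x x] K1 by (simp add: power2_le_iff_abs_le)
      then have "(ovl K N x x)\<^sup>2 / (2 * N) \<le> (N * K\<^sup>2)\<^sup>2 / (2 * N)" by (intro divide_right_mono) auto
      also have "\<dots> = N * (K\<^sup>2)\<^sup>2 / 2" using N0 by (simp add: power2_eq_square)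
      also have "\<dots> \<le> N * C" unfolding C_def using N0 by (simp add: mult_le_cancel_left_pos)
      finally have "(ovl K N x x)\<^sup>2 / (2 * N) \<le> N * C" .
      moreover have "(ovl K N y x)\<^sup>2 / N \<ge> 0" by simp
      ultimately show ?thesis unfolding \<gamma>_def by linarith
    qed
    have d0: "\<delta> \<ge> 0"
    proof -
      have "N * K\<^sup>2 \<le> N * (K\<^sup>2)\<^sup>2" using K4 N0 by simp
      moreover have "0 \<le> N * K\<^sup>2" using N0 by simp
      ultimately show ?thesis using ovl_le[of N y x] ovl_le[of N x x] unfolding \<delta>_def C_def by simp
    qed
    have form: "B z x = fst z * \<alpha> + snd z * \<beta> + (fst z)\<^sup>2 * \<gamma> + (snd z)\<^sup>2 * \<delta>" if "z \<in> quadrant" for z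
    proof -
      have z: "fst z \<ge> 0" "snd z \<ge> 0" using that by (auto simp: quadrant_def)
      have s: "sqrt ((fst z)\<^sup>2 / N) = fst z / sqrt N" "sqrt ((snd z)\<^sup>2) = snd z"
        using z by (simp_all add: real_sqrt_divide)
      show ?thesis unfolding B_def energy_explicit[OF zero_le_power2 zero_le_power2] s
          side_def \<alpha>_def \<beta>_def \<gamma>_def \<delta>_def
        using N0 by (simp add: algebra_simps)
    qed
    have sq: "((1 - u) * a + u * b)\<^sup>2 \<le> (1 - u) * a\<^sup>2 + u * b\<^sup>2" for a b :: real
    proof -
      have "0 \<le> u * (1 - u) * (a - b)\<^sup>2" using u by simp
      also have "\<dots> = (1 - u) * a\<^sup>2 + u * b\<^sup>2 - ((1 - u) * a + u * b)\<^sup>2"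
        by (simp add: power2_eq_square algebra_simps)
      finally show ?thesis by simp
    qed
    have zq: "(1 - u) *\<^sub>R p + u *\<^sub>R q \<in> quadrant" using pq u by (auto simp: quadrant_def)
    have "((1 - u) * fst p + u * fst q)\<^sup>2 * \<gamma> \<le> ((1 - u) * (fst p)\<^sup>2 + u * (fst q)\<^sup>2) * \<gamma>"
      "((1 - u) * snd p + u * snd q)\<^sup>2 * \<delta> \<le> ((1 - u) * (snd p)\<^sup>2 + u * (snd q)\<^sup>2) * \<delta>"
      using sq g0 d0 by (intro mult_right_mono; simp)+
    then show ?thesis unfolding form[OF zq] form[OF pq(1)] form[OF pq(2)] fst_add snd_add fst_scaleR snd_scaleR real_scaleR_def
      by (simp add: algebra_simps)
  qed
  have "convex_on quadrant (\<lambda>p. ln (pf (PN N) (B p)) / N)"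
  proof (rule convex_onI)
    show "convex quadrant" unfolding quadrant_def by (intro convex_Times) auto
    fix u p q assume u: "0 < u" "u < (1::real)" and pq: "p \<in> quadrant" "q \<in> quadrant"
    have "ln (pf (PN N) (B ((1 - u) *\<^sub>R p + u *\<^sub>R q))) \<le> (1 - u) * ln (pf (PN N) (B p)) + u * ln (pf (PN N) (B q))"
      using u by (intro PN.ln_pf_convex bm cvx pq) auto
    then show "ln (pf (PN N) (B ((1 - u) *\<^sub>R p + u *\<^sub>R q))) / N \<le>
      (1 - u) * (ln (pf (PN N) (B p)) / N) + u * (ln (pf (PN N) (B q)) / N)"
      using N0 by (simp add: divide_le_eq distrib_right)
  qed
  then show ?thesis unfolding ln_B C_def using N0 by (simp add: add_divide_distrib mult.assoc)
qed

section \<open>Return to the free energy and the disorder of the statement\<close>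

lemma AE_clip_PN: "AE y in PN N. \<forall>i\<in>{..<N}. clip K (y i) = y i"
proof (rule AE_finite_allI)
  fix i assume "i \<in> {..<N}"
  then show "AE x in PN N. clip K (x i) = x i"
    using bdd by (intro AE_PiM_component prob_space_axioms) (auto elim: eventually_mono simp: clip_id)
qed simp

text \<open>The integration variable lies in the truncation range almost surely, so only the signal
  has to be assumed there. The exceptional set of signals does not depend on \<open>t\<close> and
  \<open>h\<close>, which matters for the supremum.\<close>

lemma FN_eq_logZ:
  assumes th: "t \<ge> 0" "h \<ge> 0" and y: "\<And>i. i < N \<Longrightarrow> clip K (xb i) = xb i"
    and W: "\<And>i j. i < N \<Longrightarrow> j < N \<Longrightarrow> W (i, j) = g (i, j)" and z: "\<And>i. i < N \<Longrightarrow> z i = g (i, N)"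
  shows "FN P N t h xb W z = logZ N t h t h xb g / N"
proof -
  have eq: "HN N t h xb W z x =
      obs_energy (obs_idx N) (spin K N) (\<lambda>_ _. 0) (side K N t h) (coef N t h) xb g x"
    if x: "\<forall>i\<in>{..<N}. clip K (x i) = x i" for x
  proof -
    have o: "ovl K N xb x = (\<Sum>i<N. x i * xb i)" "ovl K N x x = (\<Sum>i<N. x i * x i)"
      unfolding ovl_def using x y by (auto intro!: sum.cong)
    have s: "(\<Sum>i<N. \<Sum>j<N. clip K (x i) * g (i, j) * clip K (x j)) = (\<Sum>i<N. \<Sum>j<N. x i * W (i, j) * x j)"
      "(\<Sum>i<N. g (i, N) * clip K (x i)) = (\<Sum>i<N. z i * x i)"
      using x W z by (auto intro!: sum.cong)
    show ?thesis unfolding energy_explicit[OF th] side_def o s HN_def Let_def by (simp add: algebra_simps)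
  qed
  let ?E = "obs_energy (obs_idx N) (spin K N) (\<lambda>_ _. 0) (side K N t h) (coef N t h) xb g"
  have m2: "?E \<in> borel_measurable (PN N)"
  proof -
    have e: "?E = (\<lambda>x. side K N t h xb x + sqrt (t / N) * (\<Sum>i<N. \<Sum>j<N. clip K (x i) * g (i, j) * clip K (x j))
      - t / (2 * N) * (ovl K N x x)\<^sup>2 + sqrt h * (\<Sum>i<N. g (i, N) * clip K (x i)) - h / 2 * ovl K N x x)"
      by (rule ext) (rule energy_explicit[OF th])
    show ?thesis unfolding e side_def ovl_def
    by (intro borel_measurable_add borel_measurable_diff borel_measurable_times borel_measurable_power
        borel_measurable_const borel_measurable_sum clip_comp_meas) auto
  qed
  have m1: "HN N t h xb W z \<in> borel_measurable (PN N)"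
    unfolding HN_def Let_def
    by (intro borel_measurable_add borel_measurable_diff borel_measurable_times borel_measurable_power
        borel_measurable_const borel_measurable_sum) auto
  have "(\<integral>x. exp (HN N t h xb W z x) \<partial>PN N) = pf (PN N) ?E"
    unfolding pf_def
    by (rule integral_cong_AE) (use AE_clip_PN[of N] eq m1 m2 in \<open>auto elim!: eventually_mono\<close>)
  then show ?thesis unfolding FN_def logZ_def by simp
qed

abbreviation split_noise :: "nat \<Rightarrow> (nat \<times> nat \<Rightarrow> real) \<Rightarrow> (nat \<times> nat \<Rightarrow> real) \<times> (nat \<Rightarrow> real)" where
  "split_noise N g \<equiv> (restrict g ({..<N} \<times> {..<N}), \<lambda>i\<in>{..<N}. g (i, N))"

lemma split_noise_meas [measurable]:
  "split_noise N \<in> measurable (GN N) (gauss_vec ({..<N} \<times> {..<N}) \<Otimes>\<^sub>M gauss_vec {..<N})"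
  by (intro measurable_Pair measurable_restrict_subset measurable_restrict measurable_component_singleton)
    (auto simp: obs_idx_def)

text \<open>The index set \<open>obs_idx N\<close> is the disjoint union of the matrix indices and
  the column \<open>N\<close>; splitting along it and relabelling \<open>(i, N)\<close> as
  \<open>i\<close> recovers the independent pair \<open>(W, z)\<close>.\<close>

lemma distr_split_noise:
  "distr (GN N) (gauss_vec ({..<N} \<times> {..<N}) \<Otimes>\<^sub>M gauss_vec {..<N}) (split_noise N) =
    gauss_vec ({..<N} \<times> {..<N}) \<Otimes>\<^sub>M gauss_vec {..<N}"
proof -
  let ?A = "{..<N} \<times> {..<N}" and ?B = "{..<N} \<times> {N}"
  have un: "obs_idx N = ?A \<union> ?B" by (auto simp: obs_idx_def)
  have m: "merge ?A ?B \<in> measurable (gauss_vec ?A \<Otimes>\<^sub>M gauss_vec ?B) (GN N)"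
    unfolding un by (rule measurable_merge)
  have r: "distr (gauss_vec ?B) (gauss_vec {..<N}) (\<lambda>v. \<lambda>i\<in>{..<N}. v (i, N)) = gauss_vec {..<N}"
    using distr_PiM_reindex[of ?B "\<lambda>_. gauss" "\<lambda>i. (i, N)" "{..<N}"] prob_space_gauss
    by (auto simp: inj_on_def)
  have rm: "(\<lambda>v. \<lambda>i\<in>{..<N}. v (i, N)) \<in> measurable (gauss_vec ?B) (gauss_vec {..<N})"
    by (intro measurable_restrict measurable_component_singleton) auto
  have "distr (GN N) (gauss_vec ?A \<Otimes>\<^sub>M gauss_vec {..<N}) (split_noise N) =
    distr (distr (gauss_vec ?A \<Otimes>\<^sub>M gauss_vec ?B) (GN N) (merge ?A ?B)) (gauss_vec ?A \<Otimes>\<^sub>M gauss_vec {..<N}) (split_noise N)"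
    unfolding un by (subst gauss.distr_merge) auto
  also have "\<dots> = distr (gauss_vec ?A \<Otimes>\<^sub>M gauss_vec ?B) (gauss_vec ?A \<Otimes>\<^sub>M gauss_vec {..<N}) (split_noise N \<circ> merge ?A ?B)"
    by (rule distr_distr[OF split_noise_meas m])
  also have "\<dots> = distr (gauss_vec ?A \<Otimes>\<^sub>M gauss_vec ?B) (gauss_vec ?A \<Otimes>\<^sub>M gauss_vec {..<N}) (\<lambda>(w, v). (w, \<lambda>i\<in>{..<N}. v (i, N)))"
    by (rule distr_cong) (auto simp: merge_def space_pair_measure space_PiM PiE_iff extensional_def fun_eq_iff)
  also have "\<dots> = distr (gauss_vec ?A) (gauss_vec ?A) (\<lambda>w. w) \<Otimes>\<^sub>M distr (gauss_vec ?B) (gauss_vec {..<N}) (\<lambda>v. \<lambda>i\<in>{..<N}. v (i, N))"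
    by (rule pair_measure_distr[symmetric])
      (use rm r in \<open>auto intro: prob_space_imp_sigma_finite prob_space_gauss_vec\<close>)
  also have "\<dots> = gauss_vec ?A \<Otimes>\<^sub>M gauss_vec {..<N}" unfolding r by simp
  finally show ?thesis .
qed

lemma distr_disorder:
  "distr (PN N \<Otimes>\<^sub>M GN N) (disorder P N) (\<lambda>p. (fst p, split_noise N (snd p))) = disorder P N"
proof -
  have "distr (PN N) (PN N) (\<lambda>y. y) \<Otimes>\<^sub>M distr (GN N) (gauss_vec ({..<N} \<times> {..<N}) \<Otimes>\<^sub>M gauss_vec {..<N}) (split_noise N) =
    distr (PN N \<Otimes>\<^sub>M GN N) (PN N \<Otimes>\<^sub>M (gauss_vec ({..<N} \<times> {..<N}) \<Otimes>\<^sub>M gauss_vec {..<N})) (\<lambda>(y, g). (y, split_noise N g))"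
    by (rule pair_measure_distr)
      (auto simp: distr_split_noise intro!: prob_space_imp_sigma_finite prob_space_pair prob_space_gauss_vec split_noise_meas)
  then show ?thesis unfolding distr_split_noise disorder_def by (simp add: case_prod_beta')
qed

lemma disorder_map_meas:
  "(\<lambda>p. (fst p, split_noise N (snd p))) \<in> measurable (PN N \<Otimes>\<^sub>M GN N) (disorder P N)"
  unfolding disorder_def by (intro measurable_Pair measurable_fst measurable_compose[OF measurable_snd split_noise_meas])

lemma FN_meas: "(\<lambda>\<omega>. FN P N t h (fst \<omega>) (fst (snd \<omega>)) (snd (snd \<omega>))) \<in> borel_measurable (disorder P N)"
proof -
  interpret PN: prob_space "PN N" by (rule prob_PN)
  have "(\<lambda>q. HN N t h (fst (fst q)) (fst (snd (fst q))) (snd (snd (fst q))) (snd q)) \<in>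
    borel_measurable (disorder P N \<Otimes>\<^sub>M PN N)"
    unfolding HN_def Let_def disorder_def
    by (intro borel_measurable_add borel_measurable_diff borel_measurable_times borel_measurable_power
        borel_measurable_const borel_measurable_sum; measurable)
  then have [measurable]: "(\<lambda>q. exp (HN N t h (fst (fst q)) (fst (snd (fst q))) (snd (snd (fst q))) (snd q))) \<in>
    borel_measurable (disorder P N \<Otimes>\<^sub>M PN N)" by measurable
  have [measurable]: "(\<lambda>\<omega>. \<integral>x. exp (HN N t h (fst \<omega>) (fst (snd \<omega>)) (snd (snd \<omega>)) x) \<partial>PN N) \<in> borel_measurable (disorder P N)"
    by (rule PN.borel_measurable_lebesgue_integral) (simp add: case_prod_beta')
  show ?thesis unfolding FN_def by measurable
qed

lemma AE_fst_pair:
  assumes M: "prob_space M" and N: "prob_space N" and ae: "AE x in M. Q x"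
  shows "AE p in M \<Otimes>\<^sub>M N. Q (fst p)"
proof -
  interpret MN: pair_prob_space M N
    by (intro pair_prob_space.intro pair_sigma_finite.intro prob_space_imp_sigma_finite M N)
  show ?thesis using ae AE_distrD[of fst "M \<Otimes>\<^sub>M N" M Q] unfolding MN.distr_pair_fst by simp
qed

lemma FN_L2_limit:
  assumes th: "t \<ge> 0" "h \<ge> 0"
  shows "(\<lambda>N. \<integral>\<^sup>+\<omega>. ennreal ((FN P N t h (fst \<omega>) (fst (snd \<omega>)) (snd (snd \<omega>)) - hopf_lax (psi P) t h)\<^sup>2) \<partial>disorder P N) \<longlonglongrightarrow> 0"
proof -
  let ?c = "hopf_lax (psi P) t h"
  have eq: "(\<integral>\<^sup>+\<omega>. ennreal ((FN P N t h (fst \<omega>) (fst (snd \<omega>)) (snd (snd \<omega>)) - ?c)\<^sup>2) \<partial>disorder P N) =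
    ennreal (\<integral>p. (logZ N t h t h (fst p) (snd p) / N - ?c)\<^sup>2 \<partial>(PN N \<Otimes>\<^sub>M GN N))" if N: "N > 0" for N
  proof -
    interpret M: prob_space "PN N \<Otimes>\<^sub>M GN N" by (rule prob_PG)
    have "(\<integral>\<^sup>+\<omega>. ennreal ((FN P N t h (fst \<omega>) (fst (snd \<omega>)) (snd (snd \<omega>)) - ?c)\<^sup>2) \<partial>disorder P N) =
      (\<integral>\<^sup>+p. ennreal ((FN P N t h (fst p) (fst (split_noise N (snd p))) (snd (split_noise N (snd p))) - ?c)\<^sup>2) \<partial>(PN N \<Otimes>\<^sub>M GN N))"
    proof -
      have "(\<lambda>\<omega>. ennreal ((FN P N t h (fst \<omega>) (fst (snd \<omega>)) (snd (snd \<omega>)) - ?c)\<^sup>2)) \<in> borel_measurable (disorder P N)"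
        using FN_meas by measurable
      from nn_integral_distr[OF disorder_map_meas, unfolded distr_disorder, OF this]
      show ?thesis by (simp only: fst_conv snd_conv)
    qed
    also have "\<dots> = (\<integral>\<^sup>+p. ennreal ((logZ N t h t h (fst p) (snd p) / N - ?c)\<^sup>2) \<partial>(PN N \<Otimes>\<^sub>M GN N))"
    proof (rule nn_integral_cong_AE)
      have "AE p in PN N \<Otimes>\<^sub>M GN N. \<forall>i\<in>{..<N}. clip K (fst p i) = fst p i"
        by (rule AE_fst_pair[OF prob_PN prob_space_gauss_vec AE_clip_PN])
      then show "AE p in PN N \<Otimes>\<^sub>M GN N.
        ennreal ((FN P N t h (fst p) (fst (split_noise N (snd p))) (snd (split_noise N (snd p))) - ?c)\<^sup>2) =
        ennreal ((logZ N t h t h (fst p) (snd p) / N - ?c)\<^sup>2)"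
      proof eventually_elim
        case (elim p)
        have "FN P N t h (fst p) (fst (split_noise N (snd p))) (snd (split_noise N (snd p))) = logZ N t h t h (fst p) (snd p) / N"
          using elim by (intro FN_eq_logZ th) auto
        then show ?case by simp
      qed
    qed
    also have "\<dots> = ennreal (\<integral>p. (logZ N t h t h (fst p) (snd p) / N - ?c)\<^sup>2 \<partial>(PN N \<Otimes>\<^sub>M GN N))"
    proof (rule nn_integral_eq_integral)
      have "(\<lambda>p. logZ N t h t h (fst p) (snd p) / N) \<in> borel_measurable (PN N \<Otimes>\<^sub>M GN N)"
        using logZ_meas[OF N th] by (intro borel_measurable_divide) auto
      moreover have "integrable (PN N \<Otimes>\<^sub>M GN N) (\<lambda>p. (logZ N t h t h (fst p) (snd p) / N)\<^sup>2)"
        using logZ_square_integrable[OF N th] by (simp add: power_divide)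
      ultimately show "integrable (PN N \<Otimes>\<^sub>M GN N) (\<lambda>p. (logZ N t h t h (fst p) (snd p) / N - ?c)\<^sup>2)"
        by (rule M.integral_square_shift(2))
    qed simp
    finally show ?thesis .
  qed
  have ev: "eventually (\<lambda>N. ennreal (\<integral>p. (logZ N t h t h (fst p) (snd p) / N - ?c)\<^sup>2 \<partial>(PN N \<Otimes>\<^sub>M GN N)) =
    (\<integral>\<^sup>+\<omega>. ennreal ((FN P N t h (fst \<omega>) (fst (snd \<omega>)) (snd (snd \<omega>)) - ?c)\<^sup>2) \<partial>disorder P N)) sequentially"
    using eventually_gt_at_top[of 0] by eventually_elim (rule eq[symmetric])
  have "(\<lambda>N. ennreal (\<integral>p. (logZ N t h t h (fst p) (snd p) / N - ?c)\<^sup>2 \<partial>(PN N \<Otimes>\<^sub>M GN N))) \<longlonglongrightarrow> ennreal 0"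
    by (intro tendsto_ennrealI logZ_L2_limit th)
  from Lim_transform_eventually[OF this ev] show ?thesis by simp
qed

text \<open>In the coordinates \<open>(sqrt t, sqrt h)\<close> the free energy and
  \<open>hopf_lax\<close> receive the same quadratic correction, which cancels in all differences;
  the assumption \<open>grid\<close> is applied to the corrected, convex function.\<close>

lemma FN_sup_bound:
  assumes N: "N > 0" and M: "M > 0" and S: "S \<subseteq> quadrant"
    and grid: "\<And>G p. convex_on quadrant G \<Longrightarrow> p \<in> {0..sqrt M} \<times> {0..sqrt M} \<Longrightarrow>
      \<bar>G p - (hopf_lax (psi P) ((fst p)\<^sup>2) ((snd p)\<^sup>2) + 2 * (K\<^sup>2)\<^sup>2 * ((fst p)\<^sup>2 + (snd p)\<^sup>2))\<bar> \<le>
      \<epsilon> + 3 * (\<Sum>c\<in>S. \<bar>G c - (hopf_lax (psi P) ((fst c)\<^sup>2) ((snd c)\<^sup>2) + 2 * (K\<^sup>2)\<^sup>2 * ((fst c)\<^sup>2 + (snd c)\<^sup>2))\<bar>)"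
    and xb: "xb \<in> space (PN N)" "\<forall>i\<in>{..<N}. clip K (xb i) = xb i" and th: "t \<in> {0..M}" "h \<in> {0..M}"
  shows "\<bar>FN P N t h xb W z - hopf_lax (psi P) t h\<bar> \<le>
    \<epsilon> + 3 * (\<Sum>c\<in>S. \<bar>FN P N ((fst c)\<^sup>2) ((snd c)\<^sup>2) xb W z - hopf_lax (psi P) ((fst c)\<^sup>2) ((snd c)\<^sup>2)\<bar>)"
proof -
  define g where "g = (\<lambda>k. if snd k < N then W k else z (fst k))"
  have FN: "FN P N (s\<^sup>2) (r\<^sup>2) xb W z = logZ N (s\<^sup>2) (r\<^sup>2) (s\<^sup>2) (r\<^sup>2) xb g / N" for s r
    using xb(2) by (intro FN_eq_logZ) (auto simp: g_def)
  have p: "(sqrt t, sqrt h) \<in> {0..sqrt M} \<times> {0..sqrt M}" using th by auto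
  have "\<bar>FN P N ((sqrt t)\<^sup>2) ((sqrt h)\<^sup>2) xb W z - hopf_lax (psi P) ((sqrt t)\<^sup>2) ((sqrt h)\<^sup>2)\<bar> \<le>
    \<epsilon> + 3 * (\<Sum>c\<in>S. \<bar>FN P N ((fst c)\<^sup>2) ((snd c)\<^sup>2) xb W z - hopf_lax (psi P) ((fst c)\<^sup>2) ((snd c)\<^sup>2)\<bar>)"
    unfolding FN using grid[OF logZ_convex[OF N xb(1), of g] p] by simp
  then show ?thesis using th by simp
qed

lemma square_sum_bound:
  fixes a :: "'c \<Rightarrow> real"
  assumes S: "finite S" and x: "\<bar>x\<bar> \<le> \<epsilon> + 3 * (\<Sum>c\<in>S. \<bar>a c\<bar>)"
  shows "x\<^sup>2 \<le> 2 * \<epsilon>\<^sup>2 + 18 * card S * (\<Sum>c\<in>S. (a c)\<^sup>2)"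
proof -
  let ?s = "\<Sum>c\<in>S. \<bar>a c\<bar>"
  have "x\<^sup>2 \<le> (\<epsilon> + 3 * ?s)\<^sup>2" using power_mono[OF x, of 2] by simp
  also have "\<dots> \<le> 2 * \<epsilon>\<^sup>2 + 18 * ?s\<^sup>2"
    using zero_le_power2[of "\<epsilon> - 3 * ?s"] by (simp add: power2_eq_square algebra_simps)
  also have "?s\<^sup>2 \<le> (\<Sum>c\<in>S. (a c)\<^sup>2) * card S"
    using Cauchy_Schwarz_ineq_sum[of "\<lambda>c. \<bar>a c\<bar>" "\<lambda>_. 1" S] by simp
  finally show ?thesis by (simp add: mult_ac)
qed

text \<open>\<open>nn_integral\<close> is monotone for arbitrary functions, so the uncountable
  supremum is majorised directly by a constant plus a finite measurable sum over the grid, whose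
  terms vanish in the limit by \<open>FN_L2_limit\<close>.\<close>

lemma FN_uniform_limit:
  assumes M: "M > 0"
  shows "(\<lambda>N. \<integral>\<^sup>+ \<omega>. (SUP p\<in>{0..M} \<times> {0..M}.
      ennreal ((FN P N (fst p) (snd p) (fst \<omega>) (fst (snd \<omega>)) (snd (snd \<omega>)) - hopf_lax (psi P) (fst p) (snd p))\<^sup>2))
      \<partial>disorder P N) \<longlonglongrightarrow> 0"
proof (rule order_tendstoI)
  let ?f = "hopf_lax (psi P)"
  let ?I = "\<lambda>N. \<integral>\<^sup>+ \<omega>. (SUP p\<in>{0..M} \<times> {0..M}.
      ennreal ((FN P N (fst p) (snd p) (fst \<omega>) (fst (snd \<omega>)) (snd (snd \<omega>)) - ?f (fst p) (snd p))\<^sup>2)) \<partial>disorder P N"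
  fix a :: ennreal assume "0 < a"
  \<comment> \<open>The bound \<open>a\<close> may be infinite; a smaller positive \<open>a'\<close>
    is finite and gives a real threshold.\<close>
  then obtain a' where a': "0 < a'" "a' < a" using dense by blast
  have "a' < \<top>" using a'(2) by (rule less_le_trans[OF _ top_greatest])
  define e where "e = enn2real a'"
  have e: "e > 0" "ennreal e < a"
    using a' \<open>a' < \<top>\<close> by (simp_all add: e_def enn2real_positive_iff)
  obtain \<epsilon> where \<epsilon>: "\<epsilon> > 0" "2 * \<epsilon>\<^sup>2 \<le> e / 2"
  proof (rule that)
    show "sqrt (e / 4) > 0" "2 * (sqrt (e / 4))\<^sup>2 \<le> e / 2" using e by simp_all
  qed
  let ?gt = "\<lambda>p. ?f ((fst p)\<^sup>2) ((snd p)\<^sup>2) + 2 * (K\<^sup>2)\<^sup>2 * ((fst p)\<^sup>2 + (snd p)\<^sup>2)"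
  have "continuous_on quadrant (\<lambda>p. ?f ((fst p)\<^sup>2) ((snd p)\<^sup>2))"
    by (rule continuous_on_compose2[OF psi.hl_continuous, of _ "\<lambda>p. ((fst p)\<^sup>2, (snd p)\<^sup>2)", simplified])
      (auto intro!: continuous_intros simp: quadrant_def)
  then have "continuous_on quadrant ?gt" by (intro continuous_intros)
  from convex_grid_approximation[OF this, of "sqrt M" \<epsilon>] M \<epsilon>
  obtain S where S: "finite S" "S \<subseteq> quadrant"
    and grid: "\<And>G p. convex_on quadrant G \<Longrightarrow> p \<in> {0..sqrt M} \<times> {0..sqrt M} \<Longrightarrow>
      \<bar>G p - ?gt p\<bar> \<le> \<epsilon> + 3 * (\<Sum>c\<in>S. \<bar>G c - ?gt c\<bar>)"
    by auto
  let ?d = "\<lambda>N c \<omega>. FN P N ((fst c)\<^sup>2) ((snd c)\<^sup>2) (fst \<omega>) (fst (snd \<omega>)) (snd (snd \<omega>)) - ?f ((fst c)\<^sup>2) ((snd c)\<^sup>2)"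
  let ?J = "\<lambda>N c. \<integral>\<^sup>+ \<omega>. ennreal ((?d N c \<omega>)\<^sup>2) \<partial>disorder P N"
  have bound: "?I N \<le> ennreal (e / 2) + ennreal (18 * card S) * (\<Sum>c\<in>S. ?J N c)" if N: "N > 0" for N
  proof -
    have pd: "prob_space (gauss_vec ({..<N} \<times> {..<N}) \<Otimes>\<^sub>M gauss_vec {..<N})"
      by (intro prob_space_pair prob_space_gauss_vec)
    interpret D: prob_space "disorder P N"
      unfolding disorder_def by (intro prob_space_pair prob_PN pd)
    have [measurable]: "(\<lambda>\<omega>. ?d N c \<omega>) \<in> borel_measurable (disorder P N)" for c
      by (intro borel_measurable_diff FN_meas borel_measurable_const)
    have ae: "AE \<omega> in disorder P N. \<forall>i\<in>{..<N}. clip K (fst \<omega> i) = fst \<omega> i"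
      unfolding disorder_def by (rule AE_fst_pair[OF prob_PN pd AE_clip_PN])
    have "?I N \<le> (\<integral>\<^sup>+ \<omega>. ennreal (e / 2) + ennreal (18 * card S) * (\<Sum>c\<in>S. ennreal ((?d N c \<omega>)\<^sup>2)) \<partial>disorder P N)"
    proof (rule nn_integral_mono_AE, use ae AE_space in eventually_elim)
      case (elim \<omega>)
      then have y: "fst \<omega> \<in> space (PN N)" by (auto simp: disorder_def space_pair_measure)
      show ?case
      proof (rule SUP_least)
        fix p assume p: "p \<in> {0..M} \<times> {0..M}"
        let ?x = "FN P N (fst p) (snd p) (fst \<omega>) (fst (snd \<omega>)) (snd (snd \<omega>)) - ?f (fst p) (snd p)"
        have "\<bar>?x\<bar> \<le> \<epsilon> + 3 * (\<Sum>c\<in>S. \<bar>?d N c \<omega>\<bar>)"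
          using p by (intro FN_sup_bound[OF N M S(2) grid y]) (use elim in auto)
        from square_sum_bound[OF S(1) this] have "?x\<^sup>2 \<le> e / 2 + 18 * card S * (\<Sum>c\<in>S. (?d N c \<omega>)\<^sup>2)"
          using \<epsilon>(2) by linarith
        then have "ennreal (?x\<^sup>2) \<le> ennreal (e / 2 + 18 * card S * (\<Sum>c\<in>S. (?d N c \<omega>)\<^sup>2))"
          by (rule ennreal_leI)
        also have "\<dots> = ennreal (e / 2) + ennreal (18 * card S) * (\<Sum>c\<in>S. ennreal ((?d N c \<omega>)\<^sup>2))"
          using e by (subst ennreal_plus) (auto simp: ennreal_mult sum_nonneg sum_ennreal)
        finally show "ennreal (?x\<^sup>2) \<le> ennreal (e / 2) + ennreal (18 * card S) * (\<Sum>c\<in>S. ennreal ((?d N c \<omega>)\<^sup>2))" .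
      qed
    qed
    also have "\<dots> = ennreal (e / 2) + ennreal (18 * card S) * (\<Sum>c\<in>S. ?J N c)"
      by (subst nn_integral_add) (auto simp: nn_integral_cmult nn_integral_sum D.emeasure_space_1 simp del: sum_ennreal)
    finally show ?thesis .
  qed
  have "(\<lambda>N. ennreal (e / 2) + ennreal (18 * card S) * (\<Sum>c\<in>S. ?J N c)) \<longlonglongrightarrow> ennreal (e / 2) + ennreal (18 * card S) * (\<Sum>c\<in>S. 0)"
    using S(2) by (intro tendsto_add tendsto_const ennreal_tendsto_cmult tendsto_sum FN_L2_limit) auto
  then have lim: "(\<lambda>N. ennreal (e / 2) + ennreal (18 * card S) * (\<Sum>c\<in>S. ?J N c)) \<longlonglongrightarrow> ennreal (e / 2)" by simp
  have "ennreal (e / 2) < a"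
    using e by (intro le_less_trans[OF _ e(2)] ennreal_leI) auto
  from order_tendstoD(2)[OF lim this]
  have "eventually (\<lambda>N. ennreal (e / 2) + ennreal (18 * card S) * (\<Sum>c\<in>S. ?J N c) < a) sequentially" .
  then show "eventually (\<lambda>N. ?I N < a) sequentially"
    using eventually_gt_at_top[of 0]
    by eventually_elim (rule le_less_trans[OF bound])
qed simp

end

theorem theorem2p1:
  fixes P :: "real measure" and f :: "real \<Rightarrow> real \<Rightarrow> real" and M :: real
  assumes "prob_space P" and "sets P = sets borel"
    and "\<exists>K. AE x in P. \<bar>x\<bar> \<le> K"
    and "viscosity_solution f"
    and "\<forall>h\<ge>0. f 0 h = psi P h"
    and "M \<ge> 1"
  shows "(\<lambda>N. \<integral>\<^sup>+ (xb, W, z).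
            (SUP p\<in>{0..M} \<times> {0..M}. ennreal ((FN P N (fst p) (snd p) xb W z - f (fst p) (snd p))\<^sup>2))
          \<partial>(disorder P N)) \<longlonglongrightarrow> 0"
proof -
  obtain K0 where K0: "AE x in P. \<bar>x\<bar> \<le> K0" using assms(3) by blast
  interpret prob_space P by (rule assms(1))
  \<comment> \<open>Enlarging the bound to at least \<open>1\<close> allows powers of
    \<open>K\<close> to be compared.\<close>
  interpret bounded_prior P "max 1 K0"
    by unfold_locales (use K0 assms(2) in \<open>auto elim!: eventually_mono\<close>)
  have f: "f t h = hopf_lax (psi P) t h" if "t \<ge> 0" "h \<ge> 0" for t h
    by (rule psi.viscosity_solution_eq_hopf_lax[OF assms(4,5) that])
  have "(SUP p\<in>{0..M} \<times> {0..M}. ennreal ((FN P N (fst p) (snd p) xb W z - f (fst p) (snd p))\<^sup>2)) =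
    (SUP p\<in>{0..M} \<times> {0..M}. ennreal ((FN P N (fst p) (snd p) xb W z - hopf_lax (psi P) (fst p) (snd p))\<^sup>2))" for N xb W z
    by (intro SUP_cong) (auto simp: f)
  then show ?thesis using FN_uniform_limit[of M] assms(6) by (simp add: case_prod_beta')
qed

end
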